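(* Let $E$ be a locally compact Polish space equipped with a non-negative Radon measure $\mu$. Let $(N,\Pi)$ be a pair of independent point processes on $E$, where $N$ is a Poisson point process and $\Pi$ is a determinantal point process induced by a locally trace class (not necessarily self-adjoint) correlation kernel $K: L^2(E,\mu)\to L^2(E,\mu)$. Let $(N',\Pi')$ be another independent pair of point processes on $E$ of the same kind ($N'$ Poisson, $\Pi'$ determinantal with a locally trace class, not necessarily self-adjoint, correlation kernel $K'$). If $$N+\Pi \stackrel{d}{=} N'+\Pi',$$ then $N\stackrel{d}{=}N'$ and $\Pi\stackrel{d}{=}\Pi'$.
   Context: A point process on $E$ is a random variable with values in $\Gamma(E)$, the set of Radon measures on $E$ with values in $\mathbb{N}\cup\{\infty\}$, equipped with the smallest $\sigma$-algebra making $\xi\mapsto\xi(B)$ measurable for all Borel $B\subset E$. The sum $N+\Pi$ of two independent point processes is the sum of the random counting measures (independent superposition). $\mathcal{B}_c(E)$ denotes the set of bounded Borel functions $\varphi:E\to\mathbb{C}$ with compact support. The probability generating functional of a point process $\Lambda$ is $\mathscr{B}_\Lambda(\varphi)=\mathbb{E}\big(\prod_{x\in E}(1+\varphi(x))^{\Lambda(\{x\})}\big)$ for $\varphi\in\mathcal{B}_c(E)$. A Poisson point process $N$ with intensity a Radon measure $\nu$ satisfies: for disjoint relatively compact Borel $B_1,\dots,B_k$, the variables $N(B_1),\dots,N(B_k)$ are independent, and $N(B)$ is Poisson with mean $\nu(B)$ for relatively compact Borel $B$. A bounded operator $K$ on $L^2(E,\mu)$ is locally trace class if $\mathds{1}_A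 K\mathds{1}_B$ is trace class for all relatively compact Borel $A,B\subset E$. For bounded Borel $g_1,g_2$, $g_1Kg_2:=M_{g_1}\circ K\circ M_{g_2}$ where $M_g f=gf$. A point process $\Pi$ is determinantal with (locally trace class) correlation kernel $K$ if $\mathscr{B}_\Pi(\varphi)=\det(1+\varphi K\mathds{1}_{\mathrm{supp}_e(\varphi)})$ (Fredholm determinant) for all $\varphi\in\mathcal{B}_c(E)$, where $\mathrm{supp}_e(\varphi)$ is the smallest closed set outside of which $\varphi$ vanishes $\mu$-a.e. *)

theory Defs
  imports "HOL-Probability.Probability"
begin

text \<open>Radon measure on a locally compact Polish space: a Borel measure finite on compact sets
(on such spaces locally finite Borel measures are automatically regular).\<close>
definition radon_measure :: "'e::topological_space measure \<Rightarrow> bool" where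
  "radon_measure \<nu> \<longleftrightarrow> sets \<nu> = sets borel \<and> (\<forall>C. compact C \<longrightarrow> emeasure \<nu> C < \<infinity>)"

definition rel_compact :: "'e::topological_space set \<Rightarrow> bool" where
  "rel_compact B \<longleftrightarrow> compact (closure B)"

definition counting_radon :: "'e::topological_space measure \<Rightarrow> bool" where
  "counting_radon \<xi> \<longleftrightarrow> radon_measure \<xi> \<and>
     (\<forall>B\<in>sets borel. emeasure \<xi> B \<in> range of_nat \<union> {\<infinity>})"

definition config_space :: "'e::topological_space measure measure" where
  "config_space = sigma {\<xi>. counting_radon \<xi>}
     {{\<xi>. counting_radon \<xi> \<and> emeasure \<xi> B \<in> A} | B A.
        B \<in> sets (borel :: 'e measure) \<and> A \<in> sets (borel :: ennreal measure)}"

definition config_add :: "'e::topological_space measure \<Rightarrow> 'e measure \<Rightarrow> 'e measure" where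
  "config_add \<xi> \<eta> = measure_of UNIV (sets borel) (\<lambda>B. emeasure \<xi> B + emeasure \<eta> B)"

definition point_process :: "'w measure \<Rightarrow> ('w \<Rightarrow> 'e::topological_space measure) \<Rightarrow> bool" where
  "point_process M X \<longleftrightarrow> prob_space M \<and> X \<in> measurable M config_space"

definition poisson_pp_intensity ::
  "'w measure \<Rightarrow> ('w \<Rightarrow> 'e::topological_space measure) \<Rightarrow> 'e measure \<Rightarrow> bool" where
  "poisson_pp_intensity M N \<nu> \<longleftrightarrow> point_process M N \<and> radon_measure \<nu> \<and>
     (\<forall>(k::nat) (B::nat \<Rightarrow> 'e set).
        (\<forall>i<k. B i \<in> sets borel \<and> rel_compact (B i)) \<and> disjoint_family_on B {..<k} \<longrightarrow>
        prob_space.indep_vars M (\<lambda>_. borel) (\<lambda>i \<omega>. emeasure (N \<omega>) (B i)) {..<k}) \<and>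
     (\<forall>B. B \<in> sets borel \<and> rel_compact B \<longrightarrow>
        (\<forall>n::nat. measure M {\<omega>\<in>space M. emeasure (N \<omega>) B = of_nat n} =
            exp (- enn2real (emeasure \<nu> B)) * enn2real (emeasure \<nu> B) ^ n / fact n))"

definition poisson_pp :: "'w measure \<Rightarrow> ('w \<Rightarrow> 'e::topological_space measure) \<Rightarrow> bool" where
  "poisson_pp M N \<longleftrightarrow> (\<exists>\<nu>. poisson_pp_intensity M N \<nu>)"

type_synonym 'e op = "('e \<Rightarrow> complex) \<Rightarrow> ('e \<Rightarrow> complex)"

definition L2 :: "'e measure \<Rightarrow> ('e \<Rightarrow> complex) set" where
  "L2 \<mu> = {f. f \<in> borel_measurable \<mu> \<and> integrable \<mu> (\<lambda>x. (cmod (f x))\<^sup>2)}"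

definition l2_norm :: "'e measure \<Rightarrow> ('e \<Rightarrow> complex) \<Rightarrow> real" where
  "l2_norm \<mu> f = sqrt (\<integral>x. (cmod (f x))\<^sup>2 \<partial>\<mu>)"

definition l2_inner :: "'e measure \<Rightarrow> ('e \<Rightarrow> complex) \<Rightarrow> ('e \<Rightarrow> complex) \<Rightarrow> complex" where
  "l2_inner \<mu> f g = (\<integral>x. cnj (f x) * g x \<partial>\<mu>)"

definition l2_onb :: "'e measure \<Rightarrow> nat set \<Rightarrow> (nat \<Rightarrow> 'e \<Rightarrow> complex) \<Rightarrow> bool" where
  "l2_onb \<mu> J e \<longleftrightarrow> (\<forall>i\<in>J. e i \<in> L2 \<mu>) \<and>
     (\<forall>i\<in>J. \<forall>j\<in>J. l2_inner \<mu> (e i) (e j) = (if i = j then 1 else 0)) \<and>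
     (\<forall>f\<in>L2 \<mu>. (\<forall>i\<in>J. l2_inner \<mu> (e i) f = 0) \<longrightarrow> (AE x in \<mu>. f x = 0))"

definition bounded_op :: "'e measure \<Rightarrow> 'e op \<Rightarrow> bool" where
  "bounded_op \<mu> A \<longleftrightarrow>
     (\<forall>f\<in>L2 \<mu>. A f \<in> L2 \<mu>) \<and>
     (\<forall>f\<in>L2 \<mu>. \<forall>g\<in>L2 \<mu>. (AE x in \<mu>. f x = g x) \<longrightarrow> (AE x in \<mu>. A f x = A g x)) \<and>
     (\<forall>f\<in>L2 \<mu>. \<forall>g\<in>L2 \<mu>. \<forall>a b. AE x in \<mu>.
         A (\<lambda>y. a * f y + b * g y) x = a * A f x + b * A g x) \<and>
     (\<exists>C. \<forall>f\<in>L2 \<mu>. l2_norm \<mu> (A f) \<le> C * l2_norm \<mu> f)"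

definition mult_op :: "('e \<Rightarrow> complex) \<Rightarrow> 'e op" where
  "mult_op g f = (\<lambda>x. g x * f x)"

definition hilbert_schmidt :: "'e measure \<Rightarrow> 'e op \<Rightarrow> bool" where
  "hilbert_schmidt \<mu> A \<longleftrightarrow> bounded_op \<mu> A \<and>
     (\<exists>J e. l2_onb \<mu> J e \<and> (\<lambda>i. (l2_norm \<mu> (A (e i)))\<^sup>2) summable_on J)"

definition trace_class :: "'e measure \<Rightarrow> 'e op \<Rightarrow> bool" where
  "trace_class \<mu> A \<longleftrightarrow> bounded_op \<mu> A \<and>
     (\<exists>B C. hilbert_schmidt \<mu> B \<and> hilbert_schmidt \<mu> C \<and>
        (\<forall>f\<in>L2 \<mu>. AE x in \<mu>. A f x = B (C f) x))"

definition locally_trace_class :: "'e::topological_space measure \<Rightarrow> 'e op \<Rightarrow> bool" where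
  "locally_trace_class \<mu> K \<longleftrightarrow> bounded_op \<mu> K \<and>
     (\<forall>A B. A \<in> sets borel \<and> rel_compact A \<and> B \<in> sets borel \<and> rel_compact B \<longrightarrow>
        trace_class \<mu> (mult_op (indicator A) \<circ> K \<circ> mult_op (indicator B)))"

text \<open>Fredholm determinant det(1+A), via the expansion
  det(1+A) = sum_n tr(Lambda^n A) = sum over finite I of det (<e_i, A e_j>)_{i,j in I},
  in a (chosen) orthonormal basis; the sum is absolutely convergent and basis-independent
  for trace class A.\<close>
definition fredholm_det1 :: "'e measure \<Rightarrow> 'e op \<Rightarrow> complex" where
  "fredholm_det1 \<mu> A =
     (let (J, e) = (SOME (J, e). l2_onb \<mu> J e) in
      \<Sum>\<^sub>\<infinity>I\<in>{I. finite I \<and> I \<subseteq> J}.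
        \<Sum>p | p permutes I. of_int (sign p) * (\<Prod>i\<in>I. l2_inner \<mu> (e i) (A (e (p i)))))"

definition bdd_compact_fun :: "('e::topological_space \<Rightarrow> complex) \<Rightarrow> bool" where
  "bdd_compact_fun \<phi> \<longleftrightarrow> \<phi> \<in> borel_measurable borel \<and> bounded (range \<phi>) \<and>
     compact (closure {x. \<phi> x \<noteq> 0})"

definition ess_supp :: "'e::topological_space measure \<Rightarrow> ('e \<Rightarrow> complex) \<Rightarrow> 'e set" where
  "ess_supp \<mu> \<phi> = \<Inter>{F. closed F \<and> (AE x in \<mu>. x \<notin> F \<longrightarrow> \<phi> x = 0)}"

text \<open>Multiplicity xi({x}) as a natural number (finite for Radon counting measures).\<close>
definition mult_at :: "'e measure \<Rightarrow> 'e \<Rightarrow> nat" where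
  "mult_at \<xi> x = nat \<lfloor>enn2real (emeasure \<xi> {x})\<rfloor>"

text \<open>prod_{x in E} (1 + phi x)^{xi({x})} (only finitely many nontrivial factors).\<close>
definition config_prod :: "'e measure \<Rightarrow> ('e \<Rightarrow> complex) \<Rightarrow> complex" where
  "config_prod \<xi> \<phi> = (\<Prod>x\<in>{x. \<phi> x \<noteq> 0 \<and> emeasure \<xi> {x} \<noteq> 0}. (1 + \<phi> x) ^ mult_at \<xi> x)"

definition pgfl :: "'w measure \<Rightarrow> ('w \<Rightarrow> 'e measure) \<Rightarrow> ('e \<Rightarrow> complex) \<Rightarrow> complex" where
  "pgfl M X \<phi> = (\<integral>\<omega>. config_prod (X \<omega>) \<phi> \<partial>M)"

definition determinantal_pp ::
  "'e::topological_space measure \<Rightarrow> 'w measure \<Rightarrow> ('w \<Rightarrow> 'e measure) \<Rightarrow> 'e op \<Rightarrow> bool" where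
  "determinantal_pp \<mu> M DP K \<longleftrightarrow> point_process M DP \<and> locally_trace_class \<mu> K \<and>
     (\<forall>\<phi>. bdd_compact_fun \<phi> \<longrightarrow>
        pgfl M DP \<phi> = fredholm_det1 \<mu> (mult_op \<phi> \<circ> K \<circ> mult_op (indicator (ess_supp \<mu> \<phi>))))"

end

theory Submission
  imports Defs "HOL-Complex_Analysis.Complex_Analysis" "Jordan_Normal_Form.Determinant"
begin

text \<open>For a relatively compact Borel set \<open>B\<close>, the probability generating function of the number of
points of a superposition in \<open>B\<close> at \<open>1 + z\<close> is \<open>exp (\<nu>(B) z) D(z)\<close>, where \<open>D(z)\<close> is the Fredholm determinant
of \<open>1 + z A\<close> for a trace class operator \<open>A\<close>. Such a determinant is entire of minimal exponential
type: writing \<open>A\<close> as a product of two Hilbert--Schmidt operators, Hadamard's inequality bounds the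
minor of \<open>A\<close> on a finite index set \<open>I\<close> by \<open>\<Prod>i\<in>I. t\<^sub>i\<close> with \<open>t\<close> summable, so \<open>D(z)\<close> is dominated by the product
of all \<open>1 + |z| t\<^sub>i\<close>. The Taylor coefficients of \<open>D\<close> at \<open>-1\<close> are probabilities, hence \<open>D(x) \<ge> 1\<close>
for \<open>x \<ge> 0\<close>. If the laws of two superpositions agree and \<open>c = \<nu>(B) - \<nu>'(B) > 0\<close>, then
\<open>D'(x) = exp (c x) D(x) \<ge> exp (c x)\<close>, contradicting minimal type. So \<open>\<nu> = \<nu>'\<close> on relatively compact sets, which
determines the Poisson part. The joint counts of the determinantal part are then recovered by
deconvolution, which is possible since all counts of a Poisson process vanish simultaneously with
positive probability.\<close>

section \<open>Hadamard's inequality\<close>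

text \<open>\<open>K\<close> need not be self-adjoint, so growth cannot be read off a product over
  real eigenvalues. Moreover \<open>fredholm_det1\<close> is a sum of minors in an orthonormal basis
  picked by \<open>SOME\<close>, unrelated to the bases in which the two factors of \<open>A\<close>
  are known to be Hilbert-Schmidt. The estimates are therefore made in an arbitrary basis, which
  calls for Fourier expansions and hence for completeness of L2. Minimal type comes from splitting
  off finitely many \<open>t\<close> whose remainder sums to at most eps: they contribute a
  polynomial factor, the rest at most exp (eps x). The expectation of s to the number of points is
  expanded only for |s| < 1, where integrability is clear. This is the disc about -1 in z = s - 1;
  since D is entire, both the identity between the two processes and the expansion with nonnegative
  coefficients extend to x >= 0. Laws are determined by joint counts of sets that may overlap,
  whereas Poisson independence is postulated for disjoint sets; the atoms of a finite algebra of
  sets bridge this gap.\<close>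

lemma of_real_cmod_squared: "(complex_of_real (cmod z))\<^sup>2 = z * cnj z"
  by (simp only: complex_norm_square flip: of_real_power)

lemma cmod_add_squared_Re: "(cmod (z + w))\<^sup>2 = (cmod z)\<^sup>2 + (cmod w)\<^sup>2 + 2 * Re (z * cnj w)"
  unfolding cmod_power2 by (simp add: power2_eq_square algebra_simps)

lemma cmod_diff_squared_Re: "(cmod (z - w))\<^sup>2 = (cmod z)\<^sup>2 + (cmod w)\<^sup>2 - 2 * Re (z * cnj w)"
  unfolding cmod_power2 by (simp add: power2_eq_square algebra_simps)

text \<open>Gram--Schmidt without normalisation and without an independence hypothesis: a row that becomes
zero contributes nothing later, since division by zero yields zero.\<close>

fun gs_rows :: "(nat \<Rightarrow> nat \<Rightarrow> complex) \<Rightarrow> nat \<Rightarrow> nat \<Rightarrow> nat \<Rightarrow> complex" where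
  "gs_rows b m i = (\<lambda>k. b i k - (\<Sum>j<i.
     (\<Sum>l<m. b i l * cnj (gs_rows b m j l)) / (\<Sum>l<m. (cmod (gs_rows b m j l))\<^sup>2) * gs_rows b m j k))"
declare gs_rows.simps [simp del]

text \<open>Strong induction on the larger index: rows below \<open>i\<close> are already mutually
  orthogonal, so in the pairing of row \<open>i\<close> with row \<open>j\<close> a single
  correction term survives, and its coefficient was chosen to cancel the contribution of
  \<open>b i\<close>.\<close>

lemma gs_rows_orthogonal:
  "j < i \<Longrightarrow> (\<Sum>l<m. gs_rows b m i l * cnj (gs_rows b m j l)) = 0"
proof (induction i arbitrary: j rule: less_induct)
  case (less i)
  let ?g = "gs_rows b m"
  define ip where "ip = (\<lambda>u v. \<Sum>l<m. u l * cnj (v l) :: complex)"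
  have nn: "ip (?g j) (?g j) = (\<Sum>l<m. (cmod (?g j l))\<^sup>2)" for j
    by (simp add: ip_def of_real_cmod_squared)
  have orth: "ip (?g a) (?g c) = 0" if "a < i" "c < i" "a \<noteq> c" for a c
  proof (cases "c < a")
    case True
    then show ?thesis using less.IH[of a c] that by (simp add: ip_def)
  next
    case False
    then have "ip (?g c) (?g a) = 0" using less.IH[of c a] that by (simp add: ip_def)
    then have "cnj (ip (?g c) (?g a)) = 0" by simp
    then show ?thesis by (simp add: ip_def mult.commute)
  qed
  define t where "t = (\<lambda>a. ip (b i) (?g a) / ip (?g a) (?g a))"
  have gi: "?g i = (\<lambda>k. b i k - (\<Sum>a<i. t a * ?g a k))"
    by (subst gs_rows.simps) (simp add: t_def nn, simp add: ip_def)
  have "ip (?g i) (?g j) = ip (b i) (?g j) - (\<Sum>a<i. t a * ip (?g a) (?g j))"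
    unfolding gi ip_def
    by (simp add: left_diff_distrib sum_subtractf sum_distrib_left sum_distrib_right mult.assoc)
       (subst sum.swap, simp)
  also have "(\<Sum>a<i. t a * ip (?g a) (?g j)) = (\<Sum>a<i. if a = j then t j * ip (?g j) (?g j) else 0)"
    using orth less.prems by (intro sum.cong) auto
  also have "\<dots> = t j * ip (?g j) (?g j)" using less.prems by simp
  also have "\<dots> = ip (b i) (?g j)"
  \<comment> \<open>If row \<open>j\<close> vanishes, both sides are 0; only otherwise does the
    quotient in \<open>t j\<close> cancel.\<close>
  proof (cases "ip (?g j) (?g j) = 0")
    case True
    then have "(\<Sum>l<m. (cmod (?g j l))\<^sup>2) = 0" using nn[of j] by (simp only: of_real_eq_0_iff)
    then have "\<forall>l<m. ?g j l = 0" by (subst (asm) sum_nonneg_eq_0_iff) auto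
    then show ?thesis by (simp add: ip_def)
  qed (simp add: t_def)
  finally show ?case by (simp add: ip_def)
qed

definition gs_coeff :: "(nat \<Rightarrow> nat \<Rightarrow> complex) \<Rightarrow> nat \<Rightarrow> nat \<Rightarrow> nat \<Rightarrow> complex" where
  "gs_coeff b m i j = (\<Sum>l<m. b i l * cnj (gs_rows b m j l)) / (\<Sum>l<m. (cmod (gs_rows b m j l))\<^sup>2)"

lemma gs_rows_decomposition: "b i k = gs_rows b m i k + (\<Sum>j<i. gs_coeff b m i j * gs_rows b m j k)"
  by (subst gs_rows.simps) (simp add: gs_coeff_def)

lemma gs_rows_orthogonal_neq:
  assumes "i \<noteq> j"
  shows "(\<Sum>l<m. gs_rows b m i l * cnj (gs_rows b m j l)) = 0"
proof (cases "j < i")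
  case False
  then have "(\<Sum>l<m. gs_rows b m j l * cnj (gs_rows b m i l)) = 0"
    using assms by (intro gs_rows_orthogonal) auto
  then have "cnj (\<Sum>l<m. gs_rows b m j l * cnj (gs_rows b m i l)) = 0" by simp
  then show ?thesis by (simp add: mult.commute)
qed (rule gs_rows_orthogonal)

text \<open>Pythagoras: \<open>b i\<close> is its Gram-Schmidt row plus a combination
  \<open>r\<close> of earlier rows, and the two are orthogonal.\<close>

lemma gs_rows_norm_le: "(\<Sum>l<m. (cmod (gs_rows b m i l))\<^sup>2) \<le> (\<Sum>l<m. (cmod (b i l))\<^sup>2)"
proof -
  let ?g = "gs_rows b m"
  define r where "r l = (\<Sum>j<i. gs_coeff b m i j * ?g j l)" for l
  have "(\<Sum>l<m. ?g i l * cnj (r l)) = (\<Sum>j<i. cnj (gs_coeff b m i j) * (\<Sum>l<m. ?g i l * cnj (?g j l)))"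
    unfolding r_def by (simp add: sum_distrib_left mult_ac) (subst sum.swap, simp)
  also have "\<dots> = 0" by (simp add: gs_rows_orthogonal_neq)
  finally have z: "(\<Sum>l<m. ?g i l * cnj (r l)) = 0" .
  have "(\<Sum>l<m. (cmod (b i l))\<^sup>2) = (\<Sum>l<m. (cmod (?g i l + r l))\<^sup>2)"
    unfolding r_def by (subst gs_rows_decomposition[of b i _ m]) simp
  also have "\<dots> = (\<Sum>l<m. (cmod (?g i l))\<^sup>2) + (\<Sum>l<m. (cmod (r l))\<^sup>2) + 2 * Re (\<Sum>l<m. ?g i l * cnj (r l))"
    unfolding cmod_add_squared_Re sum.distrib Re_sum sum_distrib_left ..
  also have "\<dots> = (\<Sum>l<m. (cmod (?g i l))\<^sup>2) + (\<Sum>l<m. (cmod (r l))\<^sup>2)"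
    unfolding z by simp
  finally show ?thesis by (simp add: sum_nonneg)
qed

lemma det_unit_lower_triangular:
  "det (mat n n (\<lambda>(i,j). if i = j then 1 else if j < i then u i j else (0::complex))) = 1" (is "det ?U = 1")
proof -
  have "det ?U = prod_list (diag_mat ?U)"
    by (rule det_lower_triangular[of n]) auto
  also have "\<dots> = 1" by (simp add: prod_list_diag_prod)
  finally show ?thesis .
qed

text \<open>Undoing Gram-Schmidt is multiplication from the left by a unit lower triangular matrix.
  The factor \<open>c\<close> is carried along so that the result covers products through an inner
  dimension \<open>m\<close> as well as square matrices.\<close>

lemma det_gs_rows:
  fixes b c :: "nat \<Rightarrow> nat \<Rightarrow> complex"
  shows "det (mat n n (\<lambda>(i,j). \<Sum>k<m. b i k * c j k)) = det (mat n n (\<lambda>(i,j). \<Sum>k<m. gs_rows b m i k * c j k))"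
proof -
  let ?U = "mat n n (\<lambda>(i,j). if i = j then 1 else if j < i then gs_coeff b m i j else (0::complex))"
  let ?G = "mat n n (\<lambda>(i,j). \<Sum>k<m. gs_rows b m i k * c j k)"
  have "mat n n (\<lambda>(i,j). \<Sum>k<m. b i k * c j k) = ?U * ?G"
  proof (rule eq_matI)
    fix i j assume "i < dim_row (?U * ?G)" "j < dim_col (?U * ?G)"
    then have ij: "i < n" "j < n" by auto
    have "(?U * ?G) $$ (i,j) = (\<Sum>a\<in>{..<n}. (if i = a then 1 else if a < i then gs_coeff b m i a else 0) * (\<Sum>k<m. gs_rows b m a k * c j k))"
      using ij by (simp add: scalar_prod_def lessThan_atLeast0)
    also have "\<dots> = (\<Sum>a\<in>{..<Suc i}. (if i = a then 1 else if a < i then gs_coeff b m i a else 0) * (\<Sum>k<m. gs_rows b m a k * c j k))"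
      using ij by (intro sum.mono_neutral_right) auto
    also have "\<dots> = (\<Sum>k<m. gs_rows b m i k * c j k) + (\<Sum>a<i. gs_coeff b m i a * (\<Sum>k<m. gs_rows b m a k * c j k))"
      by simp
    also have "\<dots> = (\<Sum>k<m. gs_rows b m i k * c j k) + (\<Sum>k<m. \<Sum>a<i. gs_coeff b m i a * (gs_rows b m a k * c j k))"
      unfolding sum_distrib_left by (subst sum.swap) (rule refl)
    also have "\<dots> = (\<Sum>k<m. (gs_rows b m i k + (\<Sum>a<i. gs_coeff b m i a * gs_rows b m a k)) * c j k)"
      by (simp add: distrib_right sum.distrib sum_distrib_right mult.assoc)
    also have "\<dots> = (\<Sum>k<m. b i k * c j k)"
      by (simp only: gs_rows_decomposition[of b i _ m, symmetric])
    finally show "mat n n (\<lambda>(i,j). \<Sum>k<m. b i k * c j k) $$ (i,j) = (?U * ?G) $$ (i,j)"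
      using ij by simp
  qed auto
  then show ?thesis
    by (simp add: det_mult[of _ n] det_unit_lower_triangular)
qed

text \<open>Once the rows are orthogonal, the matrix times its adjoint is diagonal with the squared
  row norms as entries, and orthogonalisation has only shortened the rows.\<close>

lemma Hadamard_inequality_rows:
  fixes b :: "nat \<Rightarrow> nat \<Rightarrow> complex"
  shows "(cmod (det (mat n n (\<lambda>(i,j). b i j))))\<^sup>2 \<le> (\<Prod>i<n. \<Sum>j<n. (cmod (b i j))\<^sup>2)"
proof -
  define g where "g = gs_rows b n"
  \<comment> \<open>With the identity matrix as second factor, \<open>det_gs_rows\<close> speaks of
    the square matrix itself.\<close>
  let ?c = "\<lambda>j k. if j = k then 1 else (0::complex)"
  let ?G = "mat n n (\<lambda>(i,j). g i j)"
  have "mat n n (\<lambda>(i,j). \<Sum>k<n. f i k * ?c j k) = mat n n (\<lambda>(i,j). f i j)" for f :: "nat \<Rightarrow> nat \<Rightarrow> complex"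
    by (intro eq_matI) (auto simp: if_distrib cong: if_cong)
  with det_gs_rows[where n=n and b=b and m=n and c="?c"] have dbg: "det (mat n n (\<lambda>(i,j). b i j)) = det ?G" by (simp add: g_def)
  let ?H = "mat n n (\<lambda>(i,j). cnj (g j i))"
  have "det ?H = cnj (det ?G)"
  proof -
    have "?H = map_mat cnj (transpose_mat ?G)" by (intro eq_matI) auto
    moreover have "det (map_mat cnj A) = cnj (det A)" if "A \<in> carrier_mat n n" for A
      using that by (simp add: det_def)
    ultimately show ?thesis by (simp add: det_transpose[of _ n])
  qed
  then have "det (?G * ?H) = det ?G * cnj (det ?G)" by (simp add: det_mult[of _ n])
  also have "\<dots> = (cmod (det ?G))\<^sup>2" by (simp only: complex_norm_square)
  finally have 1: "det (?G * ?H) = (cmod (det ?G))\<^sup>2" .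
  have "det (?G * ?H) = prod_list (diag_mat (?G * ?H))"
  proof (rule det_lower_triangular[of n])
    fix i j assume "i < j" "j < n"
    then show "(?G * ?H) $$ (i,j) = 0"
      using gs_rows_orthogonal_neq[where i=i and j=j and m=n and b=b] by (simp add: g_def scalar_prod_def lessThan_atLeast0)
  qed auto
  also have "\<dots> = (\<Prod>i<n. \<Sum>l<n. g i l * cnj (g i l))"
    by (simp add: prod_list_diag_prod scalar_prod_def lessThan_atLeast0)
  also have "\<dots> = of_real (\<Prod>i<n. \<Sum>l<n. (cmod (g i l))\<^sup>2)"
    by (simp add: of_real_cmod_squared)
  finally have "(cmod (det ?G))\<^sup>2 = (\<Prod>i<n. \<Sum>l<n. (cmod (g i l))\<^sup>2)"
    using 1 by (simp only: of_real_eq_iff)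
  also have "\<dots> \<le> (\<Prod>i<n. \<Sum>l<n. (cmod (b i l))\<^sup>2)"
    by (intro prod_mono) (auto simp: g_def intro: gs_rows_norm_le sum_nonneg)
  finally show ?thesis unfolding dbg .
qed

text \<open>The pairing is bilinear, so this is Bessel's inequality for the conjugated rows:
  \<open>s\<close> is the projection of \<open>c\<close> onto their span, and the claim is that the
  squared length of \<open>c - s\<close> is nonnegative.\<close>

lemma finite_Bessel:
  fixes g :: "nat \<Rightarrow> nat \<Rightarrow> complex" and c :: "nat \<Rightarrow> complex"
  assumes orth: "\<And>i j. i < n \<Longrightarrow> j < n \<Longrightarrow> (\<Sum>l<m. g i l * cnj (g j l)) = (if i = j then 1 else 0)"
  shows "(\<Sum>i<n. (cmod (\<Sum>l<m. g i l * c l))\<^sup>2) \<le> (\<Sum>l<m. (cmod (c l))\<^sup>2)"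
proof -
  define a where "a i = (\<Sum>l<m. g i l * c l)" for i
  define s where "s l = (\<Sum>i<n. a i * cnj (g i l))" for l
  have "(\<Sum>l<m. s l * cnj (c l)) = (\<Sum>i<n. a i * (\<Sum>l<m. cnj (g i l) * cnj (c l)))"
    unfolding s_def by (simp add: sum_distrib_left sum_distrib_right mult_ac) (subst sum.swap, simp)
  also have "\<dots> = of_real (\<Sum>i<n. (cmod (a i))\<^sup>2)"
    by (simp add: a_def of_real_cmod_squared)
  finally have 1: "(\<Sum>l<m. s l * cnj (c l)) = of_real (\<Sum>i<n. (cmod (a i))\<^sup>2)" .
  have "(\<Sum>l<m. s l * cnj (s l)) = (\<Sum>i<n. \<Sum>j<n. a i * cnj (a j) * (\<Sum>l<m. g j l * cnj (g i l)))"
  proof -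
    have "(\<Sum>l<m. s l * cnj (s l)) = (\<Sum>l<m. \<Sum>i<n. \<Sum>j<n. a i * cnj (a j) * (g j l * cnj (g i l)))"
      unfolding s_def by (simp add: sum_product mult_ac)
    also have "\<dots> = (\<Sum>i<n. \<Sum>l<m. \<Sum>j<n. a i * cnj (a j) * (g j l * cnj (g i l)))"
      by (rule sum.swap)
    also have "\<dots> = (\<Sum>i<n. \<Sum>j<n. \<Sum>l<m. a i * cnj (a j) * (g j l * cnj (g i l)))"
      by (intro sum.cong refl sum.swap)
    finally show ?thesis by (simp add: sum_distrib_left)
  qed
  also have "\<dots> = (\<Sum>i<n. \<Sum>j<n. if i = j then a i * cnj (a i) else 0)"
    by (intro sum.cong refl) (auto simp: orth)
  also have "\<dots> = of_real (\<Sum>i<n. (cmod (a i))\<^sup>2)" by (simp add: of_real_cmod_squared)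
  finally have "of_real (\<Sum>l<m. (cmod (s l))\<^sup>2) = (of_real (\<Sum>i<n. (cmod (a i))\<^sup>2) :: complex)"
    by (simp add: of_real_cmod_squared)
  then have 2: "(\<Sum>l<m. (cmod (s l))\<^sup>2) = (\<Sum>i<n. (cmod (a i))\<^sup>2)" by (simp only: of_real_eq_iff)
  have "0 \<le> (\<Sum>l<m. (cmod (c l - s l))\<^sup>2)" by (simp add: sum_nonneg)
  also have "\<dots> = (\<Sum>l<m. (cmod (c l))\<^sup>2 + (cmod (s l))\<^sup>2 - 2 * Re (s l * cnj (c l)))"
    by (intro sum.cong refl) (simp add: cmod_diff_squared_Re mult.commute)
  also have "\<dots> = (\<Sum>l<m. (cmod (c l))\<^sup>2) + (\<Sum>l<m. (cmod (s l))\<^sup>2) - 2 * Re (\<Sum>l<m. s l * cnj (c l))"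
    by (simp add: sum.distrib sum_subtractf sum_distrib_left)
  also have "\<dots> = (\<Sum>l<m. (cmod (c l))\<^sup>2) - (\<Sum>i<n. (cmod (a i))\<^sup>2)"
    unfolding 1 2 by simp
  finally show ?thesis by (simp add: a_def)
qed

text \<open>The bound sees only the row norms of the two factors and not the inner dimension
  \<open>m\<close>, which later permits \<open>m\<close> to tend to infinity. After the rows of
  \<open>b\<close> are orthonormalised, each column of the remaining matrix consists of coefficients
  of one row of \<open>c\<close> in an orthonormal system.\<close>

lemma Hadamard_inequality_product:
  fixes b c :: "nat \<Rightarrow> nat \<Rightarrow> complex"
  shows "(cmod (det (mat n n (\<lambda>(i,j). \<Sum>k<m. b i k * c j k))))\<^sup>2 \<le>
    (\<Prod>i<n. (\<Sum>k<m. (cmod (b i k))\<^sup>2) * (\<Sum>k<m. (cmod (c i k))\<^sup>2))"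
proof -
  define g where "g = gs_rows b m"
  define N where "N i = (\<Sum>l<m. (cmod (g i l))\<^sup>2)" for i
  have N0: "0 \<le> N i" for i by (simp add: N_def sum_nonneg)
  let ?G = "mat n n (\<lambda>(i,j). \<Sum>k<m. g i k * c j k)"
  have "(cmod (det ?G))\<^sup>2 \<le> (\<Prod>i<n. N i * (\<Sum>k<m. (cmod (c i k))\<^sup>2))"
  \<comment> \<open>A vanishing row cannot be normalised, but then every term of the determinant has
    a zero factor.\<close>
  proof (cases "\<exists>i<n. N i = 0")
    case True
    then obtain i where i: "i < n" "N i = 0" by auto
    then have "\<forall>l<m. g i l = 0" unfolding N_def by (subst (asm) sum_nonneg_eq_0_iff) auto
    have "(\<Prod>r = 0..<n. ?G $$ (r, p r)) = 0" if "p permutes {0..<n}" for p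
      using i \<open>\<forall>l<m. g i l = 0\<close> permutes_in_image[OF that, of i] by (intro prod_zero bexI[of _ i]) auto
    then have "det ?G = 0" unfolding det_def by (simp add: sum.neutral)
    then show ?thesis using N0 by (simp add: prod_nonneg sum_nonneg)
  next
    case False
    define h where "h i k = g i k / of_real (sqrt (N i))" for i k
    let ?W = "mat n n (\<lambda>(i,j). \<Sum>k<m. h i k * c j k)"
    let ?D = "mat n n (\<lambda>(i,j). if i = j then of_real (sqrt (N i)) else (0::complex))"
    have gh: "g i k = of_real (sqrt (N i)) * h i k" if "i < n" for i k
      using that False N0[of i] by (auto simp: h_def)
    have "?G = ?D * ?W"
    proof (rule eq_matI)
      fix i j assume "i < dim_row (?D * ?W)" "j < dim_col (?D * ?W)"
      then have ij: "i < n" "j < n" by auto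
      then have "(?D * ?W) $$ (i,j) = (\<Sum>a\<in>{..<n}. (if i = a then of_real (sqrt (N i)) else 0) * (\<Sum>k<m. h a k * c j k))"
        by (simp add: scalar_prod_def lessThan_atLeast0)
      also have "\<dots> = of_real (sqrt (N i)) * (\<Sum>k<m. h i k * c j k)"
        using ij by (simp add: if_distrib[of "\<lambda>x. x * _"] cong: if_cong)
      also have "\<dots> = (\<Sum>k<m. g i k * c j k)"
        using ij by (simp add: gh sum_distrib_left mult_ac)
      finally show "?G $$ (i,j) = (?D * ?W) $$ (i,j)" using ij by simp
    qed auto
    then have "det ?G = det ?D * det ?W" by (simp add: det_mult[of _ n])
    moreover have "det ?D = of_real (\<Prod>i<n. sqrt (N i))"
    proof -
      have "det ?D = prod_list (diag_mat ?D)" by (rule det_lower_triangular[of n]) auto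
      then show ?thesis by (simp add: prod_list_diag_prod lessThan_atLeast0)
    qed
    ultimately have 1: "(cmod (det ?G))\<^sup>2 = (\<Prod>i<n. N i) * (cmod (det ?W))\<^sup>2"
      using N0 by (simp add: norm_mult power_mult_distrib del: of_real_prod)
         (simp add: power2_eq_square abs_mult flip: prod.distrib)
    \<comment> \<open>Transposition makes Hadamard bound \<open>?W\<close> by its columns, to which
      Bessel applies.\<close>
    have "(cmod (det ?W))\<^sup>2 = (cmod (det (mat n n (\<lambda>(j,i). \<Sum>k<m. h i k * c j k))))\<^sup>2"
    proof -
      have "transpose_mat ?W = mat n n (\<lambda>(j,i). \<Sum>k<m. h i k * c j k)" by (intro eq_matI) auto
      then show ?thesis using det_transpose[of ?W n] by simp
    qed
    also have "\<dots> \<le> (\<Prod>j<n. \<Sum>i<n. (cmod (\<Sum>k<m. h i k * c j k))\<^sup>2)"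
      by (rule Hadamard_inequality_rows)
    also have "\<dots> \<le> (\<Prod>j<n. \<Sum>k<m. (cmod (c j k))\<^sup>2)"
    proof (intro prod_mono conjI finite_Bessel sum_nonneg)
      fix i j assume ij: "i < n" "j < n"
      have "(\<Sum>l<m. h i l * cnj (h j l)) = (\<Sum>l<m. g i l * cnj (g j l)) / (of_real (sqrt (N i)) * of_real (sqrt (N j)))"
        by (simp add: h_def sum_divide_distrib)
      also have "\<dots> = (if i = j then 1 else 0)"
      proof (cases "i = j")
        case True
        have "(\<Sum>l<m. g i l * cnj (g i l)) = of_real (N i)" by (simp add: N_def of_real_cmod_squared)
        moreover have "of_real (sqrt (N i)) * of_real (sqrt (N i)) = (of_real (N i) :: complex)"
          using N0[of i] by (simp flip: of_real_mult)
        ultimately show ?thesis using True False ij by auto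
      qed (simp add: g_def gs_rows_orthogonal_neq)
      finally show "(\<Sum>l<m. h i l * cnj (h j l)) = (if i = j then 1 else 0)" .
    qed auto
    finally show ?thesis unfolding 1 prod.distrib using N0 by (intro mult_left_mono prod_nonneg) auto
  qed
  also have "\<dots> \<le> (\<Prod>i<n. (\<Sum>k<m. (cmod (b i k))\<^sup>2) * (\<Sum>k<m. (cmod (c i k))\<^sup>2))"
    using N0 gs_rows_norm_le by (intro prod_mono conjI mult_right_mono mult_nonneg_nonneg sum_nonneg) (auto simp: N_def g_def)
  finally show ?thesis unfolding g_def det_gs_rows[symmetric] .
qed

section \<open>Principal minors\<close>

text \<open>The summand of \<open>fredholm_det1\<close>, kept as a sum over permutations of an
  unordered index set so that it matches that definition literally.\<close>

definition minor :: "('i \<Rightarrow> 'i \<Rightarrow> complex) \<Rightarrow> 'i set \<Rightarrow> complex" where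
  "minor M I = (\<Sum>p | p permutes I. of_int (sign p) * (\<Prod>i\<in>I. M i (p i)))"

text \<open>Conjugation by the enumeration \<open>h\<close> is a sign-preserving bijection between
  the permutations of the two index sets. It makes determinant inequalities applicable to
  minors.\<close>

lemma minor_eq_det:
  assumes h: "bij_betw h {..<n} I"
  shows "minor M I = det (mat n n (\<lambda>(i,j). M (h i) (h j)))"
proof -
  have fin: "finite I" using h bij_betw_finite by blast
  have inj: "inj_on h {..<n}" and im: "h ` {..<n} = I" using h by (auto simp: bij_betw_def)
  have bij: "bij_betw (map_permutation {..<n} h) {p. p permutes {..<n}} {p. p permutes I}"
    unfolding bij_betw_def
  proof
    show "inj_on (map_permutation {..<n} h) {p. p permutes {..<n}}"
    proof (rule inj_onI)
      fix p q assume p: "p \<in> {p. p permutes {..<n}}" and q: "q \<in> {p. p permutes {..<n}}"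
        and eq: "map_permutation {..<n} h p = map_permutation {..<n} h q"
      show "p = q"
      proof
        fix x show "p x = q x"
        proof (cases "x < n")
          case True
          then have "h (p x) = h (q x)"
            using map_permutation_apply[OF inj, of x p] map_permutation_apply[OF inj, of x q] eq by simp
          moreover have "p x < n" "q x < n"
            using True p q permutes_in_image[of p "{..<n}" x] permutes_in_image[of q "{..<n}" x] by auto
          ultimately show ?thesis using inj by (simp add: inj_on_eq_iff)
        next
          case False
          then show ?thesis using p q by (auto simp: permutes_def)
        qed
      qed
    qed
    show "map_permutation {..<n} h ` {p. p permutes {..<n}} = {p. p permutes I}"
    proof (intro equalityI subsetI)
      fix q assume q: "q \<in> {p. p permutes I}"
      have hi: "bij_betw (inv_into {..<n} h) I {..<n}" using h by (rule bij_betw_inv_into)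
      have "map_permutation {..<n} h (map_permutation I (inv_into {..<n} h) q) = q"
        by (rule map_permutation_compose_inv[OF hi]) (use q h in \<open>auto simp: bij_betw_inv_into_right\<close>)
      moreover have "map_permutation I (inv_into {..<n} h) q permutes {..<n}"
        using q hi by (auto intro: map_permutation_permutes)
      ultimately show "q \<in> map_permutation {..<n} h ` {p. p permutes {..<n}}" by (intro image_eqI) auto
    qed (use h in \<open>auto intro: map_permutation_permutes\<close>)
  qed
  have "minor M I = (\<Sum>p | p permutes {..<n}. of_int (sign (map_permutation {..<n} h p)) * (\<Prod>i\<in>I. M i (map_permutation {..<n} h p i)))"
    unfolding minor_def by (subst sum.reindex_bij_betw[OF bij, symmetric]) simp
  also have "\<dots> = (\<Sum>p | p permutes {..<n}. of_int (sign p) * (\<Prod>i<n. M (h i) (h (p i))))"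
  proof (intro sum.cong refl arg_cong2[where f="(*)"])
    fix p assume p: "p \<in> {p. p permutes {..<n}}"
    show "of_int (sign (map_permutation {..<n} h p)) = (of_int (sign p) :: complex)"
      using p inj by (simp add: sign_map_permutation)
    have "(\<Prod>i\<in>I. M i (map_permutation {..<n} h p i)) = (\<Prod>i<n. M (h i) (map_permutation {..<n} h p (h i)))"
      by (subst prod.reindex_bij_betw[OF h, symmetric]) simp
    also have "\<dots> = (\<Prod>i<n. M (h i) (h (p i)))"
      using inj by (intro prod.cong refl) (simp add: map_permutation_apply)
    finally show "(\<Prod>i\<in>I. M i (map_permutation {..<n} h p i)) = (\<Prod>i<n. M (h i) (h (p i)))" .
  qed
  also have "\<dots> = det (mat n n (\<lambda>(i,j). M (h i) (h j)))"
    unfolding det_def by (auto simp: lessThan_atLeast0 intro!: sum.cong prod.cong dest: permutes_in_image)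
  finally show ?thesis .
qed

text \<open>The entries of \<open>M\<close> are only limits of finite products. The Hadamard bound
  is uniform in the truncation \<open>m\<close>, and a minor depends continuously on its finitely
  many entries.\<close>

lemma minor_bound:
  fixes b c :: "'i \<Rightarrow> nat \<Rightarrow> complex"
  assumes "finite I"
    and lim: "\<And>i j. i \<in> I \<Longrightarrow> j \<in> I \<Longrightarrow> (\<lambda>m. \<Sum>k<m. b i k * c j k) \<longlonglongrightarrow> M i j"
    and b: "\<And>i m. i \<in> I \<Longrightarrow> (\<Sum>k<m. (cmod (b i k))\<^sup>2) \<le> t i"
    and c: "\<And>i m. i \<in> I \<Longrightarrow> (\<Sum>k<m. (cmod (c i k))\<^sup>2) \<le> t i"
  shows "cmod (minor M I) \<le> (\<Prod>i\<in>I. t i)"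
proof -
  have t0: "0 \<le> t i" if "i \<in> I" for i using b[OF that, of 0] by simp
  obtain h where h: "bij_betw h {..<card I} I"
    using ex_bij_betw_nat_finite[OF \<open>finite I\<close>] unfolding lessThan_atLeast0 by blast
  let ?M = "\<lambda>m i j. \<Sum>k<m. b i k * c j k"
  have "cmod (minor (?M m) I) \<le> (\<Prod>i\<in>I. t i)" for m
  proof -
    have "(cmod (minor (?M m) I))\<^sup>2 \<le>
      (\<Prod>i<card I. (\<Sum>k<m. (cmod (b (h i) k))\<^sup>2) * (\<Sum>k<m. (cmod (c (h i) k))\<^sup>2))"
      unfolding minor_eq_det[OF h] by (rule Hadamard_inequality_product)
    also have "\<dots> = (\<Prod>i\<in>I. (\<Sum>k<m. (cmod (b i k))\<^sup>2) * (\<Sum>k<m. (cmod (c i k))\<^sup>2))"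
      by (rule prod.reindex_bij_betw[OF h])
    \<comment> \<open>Both factors share the bound \<open>t\<close>, so the squared minor is below a
      square and its root keeps each \<open>t i\<close> to the first power only. This is what fits a
      summable \<open>t\<close>.\<close>
    also have "\<dots> \<le> (\<Prod>i\<in>I. t i * t i)"
    proof (rule prod_mono, rule conjI)
      fix i assume i: "i \<in> I"
      show "0 \<le> (\<Sum>k<m. (cmod (b i k))\<^sup>2) * (\<Sum>k<m. (cmod (c i k))\<^sup>2)"
        by (simp add: sum_nonneg)
      show "(\<Sum>k<m. (cmod (b i k))\<^sup>2) * (\<Sum>k<m. (cmod (c i k))\<^sup>2) \<le> t i * t i"
        by (rule mult_mono[OF b[OF i] c[OF i] t0[OF i]]) (simp add: sum_nonneg)
    qed
    also have "\<dots> = (\<Prod>i\<in>I. t i)\<^sup>2" by (simp add: power2_eq_square prod.distrib)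
    finally show ?thesis by (rule power2_le_imp_le) (simp add: prod_nonneg t0)
  qed
  moreover have "(\<lambda>m. cmod (minor (?M m) I)) \<longlonglongrightarrow> cmod (minor M I)"
    unfolding minor_def
    by (intro tendsto_norm tendsto_sum tendsto_mult tendsto_const tendsto_prod lim)
      (auto simp: permutes_in_image)
  ultimately show ?thesis by (blast intro: LIMSEQ_le_const2)
qed

section \<open>The Hilbert space of square-integrable functions\<close>

lemma L2D: "f \<in> L2 \<mu> \<Longrightarrow> f \<in> borel_measurable \<mu>" "f \<in> L2 \<mu> \<Longrightarrow> integrable \<mu> (\<lambda>x. (cmod (f x))\<^sup>2)"
  by (auto simp: L2_def)

lemma L2_zero [simp]: "(\<lambda>_. 0) \<in> L2 \<mu>"
  by (simp add: L2_def)

lemma L2_add: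
  assumes "f \<in> L2 \<mu>" "g \<in> L2 \<mu>"
  shows "(\<lambda>x. f x + g x) \<in> L2 \<mu>"
proof -
  note [measurable] = L2D(1)[OF assms(1)] L2D(1)[OF assms(2)]
  have "integrable \<mu> (\<lambda>x. (cmod (f x + g x))\<^sup>2)"
  proof (rule Bochner_Integration.integrable_bound)
    show "integrable \<mu> (\<lambda>x. 2 * (cmod (f x))\<^sup>2 + 2 * (cmod (g x))\<^sup>2)"
      using assms by (auto simp: L2_def)
    have "(cmod (f x + g x))\<^sup>2 \<le> 2 * (cmod (f x))\<^sup>2 + 2 * (cmod (g x))\<^sup>2" for x
    proof -
      have "(cmod (f x + g x))\<^sup>2 \<le> (cmod (f x) + cmod (g x))\<^sup>2"
        by (intro power_mono norm_triangle_ineq) auto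
      also have "\<dots> \<le> 2 * (cmod (f x))\<^sup>2 + 2 * (cmod (g x))\<^sup>2"
        using sum_squares_bound[of "cmod (f x)" "cmod (g x)"] by (simp add: power2_sum)
      finally show ?thesis .
    qed
    then show "AE x in \<mu>. norm ((cmod (f x + g x))\<^sup>2) \<le> norm (2 * (cmod (f x))\<^sup>2 + 2 * (cmod (g x))\<^sup>2)"
      by simp
  qed measurable
  then show ?thesis by (simp add: L2_def)
qed

lemma L2_scale: "f \<in> L2 \<mu> \<Longrightarrow> (\<lambda>x. a * f x) \<in> L2 \<mu>"
  by (auto simp: L2_def norm_mult power_mult_distrib)

lemma L2_diff: "f \<in> L2 \<mu> \<Longrightarrow> g \<in> L2 \<mu> \<Longrightarrow> (\<lambda>x. f x - g x) \<in> L2 \<mu>"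
  using L2_add[of f \<mu> "\<lambda>x. (-1) * g x"] L2_scale[of g \<mu> "-1"] by simp

lemma L2_sum: "(\<And>i. i \<in> F \<Longrightarrow> g i \<in> L2 \<mu>) \<Longrightarrow> (\<lambda>x. \<Sum>i\<in>F. g i x) \<in> L2 \<mu>"
  by (induction F rule: infinite_finite_induct) (auto intro: L2_add)

lemma L2_lincomb: "(\<And>i. i \<in> F \<Longrightarrow> g i \<in> L2 \<mu>) \<Longrightarrow> (\<lambda>x. \<Sum>i\<in>F. a i * g i x) \<in> L2 \<mu>"
  by (intro L2_sum L2_scale)

lemma integrable_l2_inner:
  assumes "f \<in> L2 \<mu>" "g \<in> L2 \<mu>"
  shows "integrable \<mu> (\<lambda>x. cnj (f x) * g x)"
proof (rule Bochner_Integration.integrable_bound)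
  note [measurable] = L2D(1)[OF assms(1)] L2D(1)[OF assms(2)]
  show "integrable \<mu> (\<lambda>x. (cmod (f x))\<^sup>2 + (cmod (g x))\<^sup>2)"
    using assms by (auto simp: L2_def)
  have "cmod (f x) * cmod (g x) \<le> (cmod (f x))\<^sup>2 + (cmod (g x))\<^sup>2" for x
  proof -
    have "0 \<le> cmod (f x) * cmod (g x)" by simp
    then show ?thesis using sum_squares_bound[of "cmod (f x)" "cmod (g x)"] by linarith
  qed
  then show "AE x in \<mu>. norm (cnj (f x) * g x) \<le> norm ((cmod (f x))\<^sup>2 + (cmod (g x))\<^sup>2)"
    by (simp add: norm_mult)
  show "(\<lambda>x. cnj (f x) * g x) \<in> borel_measurable \<mu>"
    by (intro borel_measurable_times measurable_compose[OF L2D(1)[OF assms(1)]] L2D(1)[OF assms(2)]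
        borel_measurable_continuous_onI continuous_intros)
qed

lemma l2_inner_commute: "l2_inner \<mu> f g = cnj (l2_inner \<mu> g f)"
  using Bochner_Integration.integral_cnj[of \<mu> "\<lambda>x. cnj (g x) * f x"] by (simp add: l2_inner_def mult.commute)

lemma l2_inner_cong_AE:
  assumes "g \<in> L2 \<mu>" "h \<in> L2 \<mu>" "f \<in> L2 \<mu>" "AE x in \<mu>. g x = h x"
  shows "l2_inner \<mu> f g = l2_inner \<mu> f h"
  unfolding l2_inner_def
  by (rule integral_cong_AE)
     (use assms in \<open>auto intro: borel_measurable_integrable[OF integrable_l2_inner]\<close>)

lemma l2_inner_add_right:
  assumes "f \<in> L2 \<mu>" "g \<in> L2 \<mu>" "h \<in> L2 \<mu>"
  shows "l2_inner \<mu> f (\<lambda>x. g x + h x) = l2_inner \<mu> f g + l2_inner \<mu> f h"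
  using assms by (simp add: l2_inner_def distrib_left integrable_l2_inner)

lemma l2_inner_scale_right: "l2_inner \<mu> f (\<lambda>x. a * g x) = a * l2_inner \<mu> f g"
  by (simp add: l2_inner_def mult.left_commute)

lemma l2_inner_diff_right:
  assumes "f \<in> L2 \<mu>" "g \<in> L2 \<mu>" "h \<in> L2 \<mu>"
  shows "l2_inner \<mu> f (\<lambda>x. g x - h x) = l2_inner \<mu> f g - l2_inner \<mu> f h"
  using assms by (simp add: l2_inner_def right_diff_distrib integrable_l2_inner)

lemma l2_inner_lincomb_right:
  assumes "f \<in> L2 \<mu>" "\<And>i. i \<in> F \<Longrightarrow> g i \<in> L2 \<mu>"
  shows "l2_inner \<mu> f (\<lambda>x. \<Sum>i\<in>F. a i * g i x) = (\<Sum>i\<in>F. a i * l2_inner \<mu> f (g i))"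
  using assms(2)
proof (induction F rule: infinite_finite_induct)
  case (insert i F)
  then show ?case
    using assms(1) by (simp add: l2_inner_add_right L2_scale L2_lincomb l2_inner_scale_right)
qed (auto simp: l2_inner_def)

lemma l2_inner_lincomb_left:
  assumes "f \<in> L2 \<mu>" "\<And>i. i \<in> F \<Longrightarrow> g i \<in> L2 \<mu>"
  shows "l2_inner \<mu> (\<lambda>x. \<Sum>i\<in>F. a i * g i x) f = (\<Sum>i\<in>F. cnj (a i) * l2_inner \<mu> (g i) f)"
  by (subst l2_inner_commute, subst l2_inner_lincomb_right[OF assms])
     (auto simp flip: l2_inner_commute)

lemma l2_norm_nonneg [simp]: "0 \<le> l2_norm \<mu> f"
  by (simp add: l2_norm_def)

lemma l2_norm_squared: "(l2_norm \<mu> f)\<^sup>2 = (\<integral>x. (cmod (f x))\<^sup>2 \<partial>\<mu>)"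
  by (simp add: l2_norm_def)

lemma l2_inner_self: "l2_inner \<mu> f f = of_real ((l2_norm \<mu> f)\<^sup>2)"
  unfolding l2_norm_squared l2_inner_def
  by (simp add: of_real_cmod_squared mult.commute flip: integral_complex_of_real)

lemma l2_norm_cong_AE:
  assumes "f \<in> L2 \<mu>" "g \<in> L2 \<mu>" "AE x in \<mu>. f x = g x"
  shows "l2_norm \<mu> f = l2_norm \<mu> g"
proof -
  have "(\<integral>x. (cmod (f x))\<^sup>2 \<partial>\<mu>) = (\<integral>x. (cmod (g x))\<^sup>2 \<partial>\<mu>)"
    by (rule integral_cong_AE) (use assms in \<open>auto dest: L2D intro!: borel_measurable_integrable\<close>)
  then show ?thesis by (simp add: l2_norm_def)
qed

text \<open>Discriminant argument for t |f| - |g|, carried out for the integral \<open>w\<close> of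
  |f| |g|, which is real and dominates the modulus of the inner product.\<close>

lemma l2_Cauchy_Schwarz:
  assumes f: "f \<in> L2 \<mu>" and g: "g \<in> L2 \<mu>"
  shows "cmod (l2_inner \<mu> f g) \<le> l2_norm \<mu> f * l2_norm \<mu> g"
proof -
  define F where "F = (l2_norm \<mu> f)\<^sup>2"
  define G where "G = (l2_norm \<mu> g)\<^sup>2"
  define w where "w = (\<integral>x. cmod (f x) * cmod (g x) \<partial>\<mu>)"
  have int: "integrable \<mu> (\<lambda>x. cmod (f x) * cmod (g x))"
    using integrable_norm[OF integrable_l2_inner[OF f g]] by (simp add: norm_mult)
  have w: "cmod (l2_inner \<mu> f g) \<le> w"
    using integral_norm_bound[of \<mu> "\<lambda>x. cnj (f x) * g x"] by (simp add: l2_inner_def w_def norm_mult)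
  have q: "0 \<le> t\<^sup>2 * F - 2 * t * w + G" for t
  proof -
    have "0 \<le> (\<integral>x. (t * cmod (f x) - cmod (g x))\<^sup>2 \<partial>\<mu>)" by simp
    also have "\<dots> = (\<integral>x. t\<^sup>2 * (cmod (f x))\<^sup>2 - 2 * t * (cmod (f x) * cmod (g x)) + (cmod (g x))\<^sup>2 \<partial>\<mu>)"
      by (simp add: power2_diff power_mult_distrib algebra_simps)
    also have "\<dots> = t\<^sup>2 * F - 2 * t * w + G"
      using int L2D(2)[OF f] L2D(2)[OF g] by (simp add: F_def G_def w_def l2_norm_squared)
    finally show ?thesis .
  qed
  have "w\<^sup>2 \<le> F * G"
  proof (cases "F = 0")
    case True
    have "w = 0"
    proof (rule ccontr)
      assume "w \<noteq> 0"
      \<comment> \<open>For \<open>F = 0\<close> the form is affine in \<open>t\<close>, and at this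
        point it takes the value -1.\<close>
      with q[of "(G + 1) / (2 * w)"] True show False by simp
    qed
    then show ?thesis using True by simp
  next
    case False
    then have F: "F > 0" by (simp add: F_def)
    \<comment> \<open>The quadratic form in \<open>t\<close> attains its minimum at
      \<open>w / F\<close>.\<close>
    have "0 \<le> F * ((w / F)\<^sup>2 * F - 2 * (w / F) * w + G)"
      using q[of "w / F"] F by (intro mult_nonneg_nonneg) auto
    also have "\<dots> = F * G - w\<^sup>2" using F by (simp add: field_simps power2_eq_square)
    finally show ?thesis by simp
  qed
  then have "w\<^sup>2 \<le> (l2_norm \<mu> f * l2_norm \<mu> g)\<^sup>2" by (simp add: F_def G_def power_mult_distrib)
  then have "w \<le> l2_norm \<mu> f * l2_norm \<mu> g" by (rule power2_le_imp_le) simp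
  with w show ?thesis by simp
qed

lemma l2_norm_diff_squared:
  assumes f: "f \<in> L2 \<mu>" and g: "g \<in> L2 \<mu>"
  shows "(l2_norm \<mu> (\<lambda>x. f x - g x))\<^sup>2 = (l2_norm \<mu> f)\<^sup>2 + (l2_norm \<mu> g)\<^sup>2 - 2 * Re (l2_inner \<mu> f g)"
proof -
  define R where "R x = Re (cnj (f x) * g x)" for x
  have R: "integrable \<mu> R" "(\<integral>x. R x \<partial>\<mu>) = Re (l2_inner \<mu> f g)"
    unfolding R_def l2_inner_def
    using integrable_Re[OF integrable_l2_inner[OF f g]] integral_Re[OF integrable_l2_inner[OF f g]] by auto
  have "(cmod (f x - g x))\<^sup>2 = (cmod (f x))\<^sup>2 + (cmod (g x))\<^sup>2 - 2 * R x" for x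
    unfolding cmod_diff_squared_Re R_def by simp
  then have "(l2_norm \<mu> (\<lambda>x. f x - g x))\<^sup>2 = (\<integral>x. (cmod (f x))\<^sup>2 + (cmod (g x))\<^sup>2 - 2 * R x \<partial>\<mu>)"
    by (simp only: l2_norm_squared)
  also have "\<dots> = (l2_norm \<mu> f)\<^sup>2 + (l2_norm \<mu> g)\<^sup>2 - 2 * Re (l2_inner \<mu> f g)"
    using R L2D(2)[OF f] L2D(2)[OF g] by (simp add: l2_norm_squared)
  finally show ?thesis .
qed

lemma l2_norm_scale: "l2_norm \<mu> (\<lambda>x. a * f x) = cmod a * l2_norm \<mu> f"
  by (simp add: l2_norm_def norm_mult power_mult_distrib real_sqrt_mult)

lemma l2_norm_minus_commute: "l2_norm \<mu> (\<lambda>x. f x - g x) = l2_norm \<mu> (\<lambda>x. g x - f x)"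
  by (simp add: l2_norm_def norm_minus_commute)

lemma l2_norm_triangle:
  assumes f: "f \<in> L2 \<mu>" and g: "g \<in> L2 \<mu>"
  shows "l2_norm \<mu> (\<lambda>x. f x + g x) \<le> l2_norm \<mu> f + l2_norm \<mu> g"
proof (rule power2_le_imp_le)
  have g': "(\<lambda>x. (-1) * g x) \<in> L2 \<mu>" using g by (rule L2_scale)
  have "(l2_norm \<mu> (\<lambda>x. f x + g x))\<^sup>2 = (l2_norm \<mu> f)\<^sup>2 + (l2_norm \<mu> g)\<^sup>2 + 2 * Re (l2_inner \<mu> f g)"
    using l2_norm_diff_squared[OF f g'] unfolding l2_norm_scale l2_inner_scale_right by simp
  also have "\<dots> \<le> (l2_norm \<mu> f)\<^sup>2 + (l2_norm \<mu> g)\<^sup>2 + 2 * (l2_norm \<mu> f * l2_norm \<mu> g)"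
    using l2_Cauchy_Schwarz[OF f g] complex_Re_le_cmod[of "l2_inner \<mu> f g"] by simp
  finally show "(l2_norm \<mu> (\<lambda>x. f x + g x))\<^sup>2 \<le> (l2_norm \<mu> f + l2_norm \<mu> g)\<^sup>2"
    by (simp add: power2_sum)
qed simp

lemma l2_norm_sum:
  assumes "finite F" "\<And>i. i \<in> F \<Longrightarrow> g i \<in> L2 \<mu>"
  shows "l2_norm \<mu> (\<lambda>x. \<Sum>i\<in>F. g i x) \<le> (\<Sum>i\<in>F. l2_norm \<mu> (g i))"
  using assms
proof (induction F rule: finite_induct)
  case (insert i F)
  have "l2_norm \<mu> (\<lambda>x. \<Sum>i\<in>insert i F. g i x) \<le> l2_norm \<mu> (g i) + l2_norm \<mu> (\<lambda>x. \<Sum>i\<in>F. g i x)"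
    using insert by (simp add: l2_norm_triangle L2_sum)
  then show ?case using insert by fastforce
qed (simp add: l2_norm_def)

section \<open>Completeness of L2 (Riesz-Fischer)\<close>

lemma nn_integral_L2: "f \<in> L2 \<mu> \<Longrightarrow> (\<integral>\<^sup>+x. ennreal ((cmod (f x))\<^sup>2) \<partial>\<mu>) = ennreal ((l2_norm \<mu> f)\<^sup>2)"
  unfolding l2_norm_squared by (rule nn_integral_eq_integral) (auto simp: L2_def)

lemma L2I_nn_integral:
  assumes [measurable]: "f \<in> borel_measurable \<mu>"
    and le: "(\<integral>\<^sup>+x. ennreal ((cmod (f x))\<^sup>2) \<partial>\<mu>) \<le> ennreal (c\<^sup>2)" and "0 \<le> c"
  shows "f \<in> L2 \<mu>" "l2_norm \<mu> f \<le> c"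
proof -
  have "(\<integral>\<^sup>+x. ennreal ((cmod (f x))\<^sup>2) \<partial>\<mu>) < \<infinity>"
    using le by (rule le_less_trans) simp
  then show f: "f \<in> L2 \<mu>" by (auto simp: L2_def intro!: integrableI_nonneg)
  show "l2_norm \<mu> f \<le> c"
    using le \<open>0 \<le> c\<close> unfolding nn_integral_L2[OF f] by (auto intro: power2_le_imp_le)
qed

text \<open>The norms of the increments \<open>d k\<close> sum to at most 2. By monotone convergence
  the pointwise sum of the increments is then finite almost everywhere, and the telescoping series
  converges absolutely there.\<close>

lemma L2_rapidly_Cauchy_AE_convergent:
  assumes v: "\<And>k. v k \<in> L2 \<mu>"
    and le: "\<And>k. l2_norm \<mu> (\<lambda>x. v (Suc k) x - v k x) \<le> (1/2) ^ k"
  shows "AE x in \<mu>. convergent (\<lambda>k. v k x)"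
proof -
  note [measurable] = L2D(1)[OF v]
  define d where "d k x = cmod (v (Suc k) x - v k x)" for k x
  have [measurable]: "d k \<in> borel_measurable \<mu>" for k unfolding d_def by measurable
  have d0: "0 \<le> d k x" for k x by (simp add: d_def)
  have "(\<integral>\<^sup>+x. ennreal ((\<Sum>k<n. d k x)\<^sup>2) \<partial>\<mu>) \<le> ennreal (2\<^sup>2)" for n
  proof -
    have dL: "(\<lambda>x. of_real (d k x)) \<in> L2 \<mu>" for k
      using L2D[OF L2_diff[OF v[of "Suc k"] v[of k]]] by (simp add: L2_def d_def)
    have dn: "l2_norm \<mu> (\<lambda>x. of_real (d k x)) \<le> (1/2) ^ k" for k
      using le[of k] by (simp add: l2_norm_def d_def)
    have "l2_norm \<mu> (\<lambda>x. \<Sum>k<n. of_real (d k x)) \<le> (\<Sum>k<n. (1/2) ^ k)"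
      by (rule order_trans[OF l2_norm_sum[OF _ dL] sum_mono[OF dn]]) simp
    also have "\<dots> \<le> (\<Sum>k. (1/2::real) ^ k)" by (intro sum_le_suminf summable_geometric) auto
    also have "\<dots> = 2" by (subst suminf_geometric) auto
    finally have "(l2_norm \<mu> (\<lambda>x. \<Sum>k<n. of_real (d k x)))\<^sup>2 \<le> 2\<^sup>2" by (intro power_mono) auto
    then have "(\<integral>\<^sup>+x. ennreal ((cmod (\<Sum>k<n. of_real (d k x)))\<^sup>2) \<partial>\<mu>) \<le> ennreal (2\<^sup>2)"
      by (subst nn_integral_L2[OF L2_sum[OF dL]]) (rule ennreal_leI)
    then show ?thesis by (simp add: flip: of_real_sum)
  qed
  moreover have "incseq (\<lambda>n x. ennreal ((\<Sum>k<n. d k x)\<^sup>2))"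
    by (intro monoI le_funI ennreal_leI power_mono sum_mono2 sum_nonneg) (auto simp: d0)
  ultimately have "(\<integral>\<^sup>+x. (SUP n. ennreal ((\<Sum>k<n. d k x)\<^sup>2)) \<partial>\<mu>) \<le> ennreal (2\<^sup>2)"
    by (subst nn_integral_monotone_convergence_SUP) (auto intro!: SUP_least)
  then have "(\<integral>\<^sup>+x. (SUP n. ennreal ((\<Sum>k<n. d k x)\<^sup>2)) \<partial>\<mu>) \<noteq> \<infinity>"
    by (auto simp: top_unique)
  then have "AE x in \<mu>. (SUP n. ennreal ((\<Sum>k<n. d k x)\<^sup>2)) \<noteq> \<infinity>"
    by (intro nn_integral_PInf_AE) auto
  then show ?thesis
  proof eventually_elim
    case (elim x)
    then obtain c where c: "0 \<le> c" "(SUP n. ennreal ((\<Sum>k<n. d k x)\<^sup>2)) = ennreal c"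
      by (cases "SUP n. ennreal ((\<Sum>k<n. d k x)\<^sup>2)") auto
    have "(\<Sum>k<n. d k x) \<le> sqrt c" for n
    proof -
      have "ennreal ((\<Sum>k<n. d k x)\<^sup>2) \<le> ennreal c" unfolding c(2)[symmetric] by (intro SUP_upper) auto
      then show ?thesis using c(1) by (auto intro: real_le_rsqrt)
    qed
    then have "summable (\<lambda>k. d k x)" by (intro summableI_nonneg_bounded) (auto simp: d0)
    then have "summable (\<lambda>k. v (Suc k) x - v k x)" unfolding d_def by (rule summable_norm_cancel)
    then have "convergent (\<lambda>n. (\<Sum>k<n. v (Suc k) x - v k x) + v 0 x)"
      unfolding summable_iff_convergent by (intro convergent_add convergent_const)
    then show ?case by (simp add: sum_lessThan_telescope[of "\<lambda>k. v k x"])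
  qed
qed

text \<open>A rapidly Cauchy subsequence converges almost everywhere to some \<open>s\<close>.
  Fatou's lemma turns the Cauchy bound into an L2 bound on \<open>u n - s\<close>.\<close>

theorem L2_complete:
  assumes u: "\<And>n. u n \<in> L2 \<mu>"
    and Cauchy: "\<And>\<epsilon>. 0 < \<epsilon> \<Longrightarrow> \<exists>N. \<forall>m\<ge>N. \<forall>n\<ge>N. l2_norm \<mu> (\<lambda>x. u m x - u n x) < \<epsilon>"
  shows "\<exists>s\<in>L2 \<mu>. (\<lambda>n. l2_norm \<mu> (\<lambda>x. u n x - s x)) \<longlonglongrightarrow> 0"
proof -
  note [measurable] = L2D(1)[OF u]
  have "\<exists>N. \<forall>m\<ge>N. \<forall>n\<ge>N. l2_norm \<mu> (\<lambda>x. u m x - u n x) < (1/2) ^ k" for k :: nat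
    by (rule Cauchy) simp
  then have "\<forall>k. \<exists>N. \<forall>m\<ge>N. \<forall>n\<ge>N. l2_norm \<mu> (\<lambda>x. u m x - u n x) < (1/2) ^ k" by blast
  from choice[OF this] obtain N
    where N: "\<And>k m n. m \<ge> N k \<Longrightarrow> n \<ge> N k \<Longrightarrow> l2_norm \<mu> (\<lambda>x. u m x - u n x) < (1/2) ^ k"
    by blast
  \<comment> \<open>The cumulative sum puts both \<open>r k\<close> and \<open>r (Suc k)\<close>
    beyond \<open>N k\<close>; the summand \<open>k\<close> makes \<open>r\<close>
    unbounded.\<close>
  define r where "r k = (\<Sum>j\<le>k. N j) + k" for k
  have r: "r k \<ge> N k" "r (Suc k) \<ge> N k" "r k \<ge> k" for k
  proof -
    have "N k \<le> (\<Sum>j\<le>k. N j)" by (rule member_le_sum) auto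
    then show "r k \<ge> N k" "r (Suc k) \<ge> N k" "r k \<ge> k" by (simp_all add: r_def)
  qed
  have "AE x in \<mu>. convergent (\<lambda>k. u (r k) x)"
    using u N[OF r(2) r(1)] by (intro L2_rapidly_Cauchy_AE_convergent) (auto intro: less_imp_le)
  then have lim: "AE x in \<mu>. (\<lambda>k. u (r k) x) \<longlonglongrightarrow> lim (\<lambda>k. u (r k) x)"
    by eventually_elim (simp add: convergent_LIMSEQ_iff)
  \<comment> \<open>Since \<open>lim\<close> is total, \<open>s\<close> is defined everywhere and
    measurable; it is the true limit off a null set.\<close>
  define s where "s x = lim (\<lambda>k. u (r k) x)" for x
  have [measurable]: "s \<in> borel_measurable \<mu>" unfolding s_def by measurable
  have *: "(\<lambda>x. u n x - s x) \<in> L2 \<mu> \<and> l2_norm \<mu> (\<lambda>x. u n x - s x) \<le> (1/2)^k" if n: "n \<ge> N k" for n k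
  proof -
    have "(\<integral>\<^sup>+x. ennreal ((cmod (u n x - s x))\<^sup>2) \<partial>\<mu>)
        = (\<integral>\<^sup>+x. liminf (\<lambda>j. ennreal ((cmod (u n x - u (r j) x))\<^sup>2)) \<partial>\<mu>)"
    proof (rule nn_integral_cong_AE, use lim in eventually_elim)
      case (elim x)
      have "(\<lambda>j. ennreal ((cmod (u n x - u (r j) x))\<^sup>2)) \<longlonglongrightarrow> ennreal ((cmod (u n x - s x))\<^sup>2)"
        using elim unfolding s_def by (intro tendsto_intros tendsto_ennrealI)
      then show ?case by (rule lim_imp_Liminf[OF sequentially_bot, symmetric])
    qed
    also have "\<dots> \<le> liminf (\<lambda>j. \<integral>\<^sup>+x. ennreal ((cmod (u n x - u (r j) x))\<^sup>2) \<partial>\<mu>)"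
      by (intro nn_integral_liminf) measurable
    also have "\<dots> \<le> liminf (\<lambda>j. ennreal (((1/2)^k)\<^sup>2))"
    proof (intro Liminf_mono eventually_sequentiallyI[of "N k"])
      fix j assume "N k \<le> j"
      then have "l2_norm \<mu> (\<lambda>x. u n x - u (r j) x) < (1/2)^k" using r(3)[of j] n by (intro N) auto
      then show "(\<integral>\<^sup>+x. ennreal ((cmod (u n x - u (r j) x))\<^sup>2) \<partial>\<mu>) \<le> ennreal (((1/2)^k)\<^sup>2)"
        using u by (subst nn_integral_L2) (auto intro!: L2_diff ennreal_leI power_mono)
    qed
    also have "\<dots> = ennreal (((1/2)^k)\<^sup>2)" by (simp add: Liminf_const)
    finally show ?thesis by (intro conjI L2I_nn_integral) auto
  qed
  \<comment> \<open>So far only differences \<open>u n - s\<close> are known to lie in L2;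
    subtracting one of them from \<open>u n\<close> recovers \<open>s\<close>.\<close>
  have "(\<lambda>x. u (N 0) x - (u (N 0) x - s x)) \<in> L2 \<mu>"
    by (rule L2_diff[OF u]) (use *[of 0 "N 0"] in simp)
  then have "s \<in> L2 \<mu>" by simp
  moreover have "(\<lambda>n. l2_norm \<mu> (\<lambda>x. u n x - s x)) \<longlonglongrightarrow> 0"
  proof (rule LIMSEQ_I)
    fix e :: real assume "0 < e"
    then obtain k where k: "(1/2::real)^k < e" using real_arch_pow_inv[of e "1/2"] by auto
    show "\<exists>no. \<forall>n\<ge>no. norm (l2_norm \<mu> (\<lambda>x. u n x - s x) - 0) < e"
    proof (intro exI allI impI)
      fix n assume "N k \<le> n"
      from *[OF this] k show "norm (l2_norm \<mu> (\<lambda>x. u n x - s x) - 0) < e" by simp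
    qed
  qed
  ultimately show ?thesis by blast
qed

section \<open>Orthonormal systems and Fourier expansions\<close>

lemma l2_norm_orthonormal_lincomb:
  assumes F: "finite F" and e: "\<And>i. i \<in> F \<Longrightarrow> e i \<in> L2 \<mu>"
    and orth: "\<And>i j. i \<in> F \<Longrightarrow> j \<in> F \<Longrightarrow> l2_inner \<mu> (e i) (e j) = (if i = j then 1 else 0)"
  shows "(l2_norm \<mu> (\<lambda>x. \<Sum>i\<in>F. c i * e i x))\<^sup>2 = (\<Sum>i\<in>F. (cmod (c i))\<^sup>2)"
proof -
  have s: "(\<lambda>x. \<Sum>i\<in>F. c i * e i x) \<in> L2 \<mu>" using e by (rule L2_lincomb)
  have "l2_inner \<mu> (\<lambda>x. \<Sum>i\<in>F. c i * e i x) (\<lambda>x. \<Sum>i\<in>F. c i * e i x)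
      = (\<Sum>i\<in>F. cnj (c i) * (\<Sum>j\<in>F. c j * l2_inner \<mu> (e i) (e j)))"
    by (simp add: l2_inner_lincomb_left[OF s e] l2_inner_lincomb_right e)
  also have "\<dots> = (\<Sum>i\<in>F. c i * cnj (c i))"
  proof (rule sum.cong[OF refl])
    fix i assume i: "i \<in> F"
    have "(\<Sum>j\<in>F. c j * l2_inner \<mu> (e i) (e j)) = (\<Sum>j\<in>F. if i = j then c j else 0)"
      by (rule sum.cong[OF refl]) (simp add: orth[OF i])
    also have "\<dots> = c i" using i F by simp
    finally show "cnj (c i) * (\<Sum>j\<in>F. c j * l2_inner \<mu> (e i) (e j)) = c i * cnj (c i)"
      by (simp add: mult.commute)
  qed
  finally have "complex_of_real ((l2_norm \<mu> (\<lambda>x. \<Sum>i\<in>F. c i * e i x))\<^sup>2) = of_real (\<Sum>i\<in>F. (cmod (c i))\<^sup>2)"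
    by (simp only: l2_inner_self complex_norm_square of_real_sum)
  then show ?thesis by (simp only: of_real_eq_iff)
qed

lemma Bessel_residual:
  assumes F: "finite F" and e: "\<And>i. i \<in> F \<Longrightarrow> e i \<in> L2 \<mu>"
    and orth: "\<And>i j. i \<in> F \<Longrightarrow> j \<in> F \<Longrightarrow> l2_inner \<mu> (e i) (e j) = (if i = j then 1 else 0)"
    and f: "f \<in> L2 \<mu>"
  shows "(l2_norm \<mu> (\<lambda>x. f x - (\<Sum>i\<in>F. l2_inner \<mu> (e i) f * e i x)))\<^sup>2
    = (l2_norm \<mu> f)\<^sup>2 - (\<Sum>i\<in>F. (cmod (l2_inner \<mu> (e i) f))\<^sup>2)"
proof -
  define c where "c i = l2_inner \<mu> (e i) f" for i
  have s: "(\<lambda>x. \<Sum>i\<in>F. c i * e i x) \<in> L2 \<mu>" using e by (rule L2_lincomb)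
  have "l2_inner \<mu> f (\<lambda>x. \<Sum>i\<in>F. c i * e i x) = (\<Sum>i\<in>F. c i * cnj (c i))"
    by (rule trans[OF l2_inner_lincomb_right[OF f e]])
      (auto simp: c_def l2_inner_commute[of \<mu> f] intro: sum.cong)
  then have 1: "Re (l2_inner \<mu> f (\<lambda>x. \<Sum>i\<in>F. c i * e i x)) = (\<Sum>i\<in>F. (cmod (c i))\<^sup>2)"
    by (simp only: complex_norm_square[symmetric] of_real_sum[symmetric] Re_complex_of_real)
  have 2: "(l2_norm \<mu> (\<lambda>x. \<Sum>i\<in>F. c i * e i x))\<^sup>2 = (\<Sum>i\<in>F. (cmod (c i))\<^sup>2)"
    using F e orth by (rule l2_norm_orthonormal_lincomb)
  show ?thesis
    using l2_norm_diff_squared[OF f s] unfolding 1 2 by (simp add: c_def)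
qed

lemma Bessel_inequality:
  assumes "finite F" "\<And>i. i \<in> F \<Longrightarrow> e i \<in> L2 \<mu>"
    and "\<And>i j. i \<in> F \<Longrightarrow> j \<in> F \<Longrightarrow> l2_inner \<mu> (e i) (e j) = (if i = j then 1 else 0)"
    and "f \<in> L2 \<mu>"
  shows "(\<Sum>i\<in>F. (cmod (l2_inner \<mu> (e i) f))\<^sup>2) \<le> (l2_norm \<mu> f)\<^sup>2"
  using Bessel_residual[OF assms] zero_le_power2[of "l2_norm \<mu> (\<lambda>x. f x - (\<Sum>i\<in>F. l2_inner \<mu> (e i) f * e i x))"]
  by linarith

lemma l2_onbD:
  assumes "l2_onb \<mu> J e"
  shows "i \<in> J \<Longrightarrow> e i \<in> L2 \<mu>"
    and "i \<in> J \<Longrightarrow> j \<in> J \<Longrightarrow> l2_inner \<mu> (e i) (e j) = (if i = j then 1 else 0)"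
    and "f \<in> L2 \<mu> \<Longrightarrow> (\<And>i. i \<in> J \<Longrightarrow> l2_inner \<mu> (e i) f = 0) \<Longrightarrow> AE x in \<mu>. f x = 0"
  using assms unfolding l2_onb_def by blast+

text \<open>Cutting off by the value of the index, instead of enumerating \<open>J\<close>, treats
  finite and infinite bases alike.\<close>

definition fourier_sum :: "'e measure \<Rightarrow> nat set \<Rightarrow> (nat \<Rightarrow> 'e \<Rightarrow> complex) \<Rightarrow> ('e \<Rightarrow> complex) \<Rightarrow> nat \<Rightarrow> 'e \<Rightarrow> complex" where
  "fourier_sum \<mu> J e f n = (\<lambda>x. \<Sum>i\<in>J \<inter> {..<n}. l2_inner \<mu> (e i) f * e i x)"

lemma fourier_sum_L2: "l2_onb \<mu> J e \<Longrightarrow> fourier_sum \<mu> J e f n \<in> L2 \<mu>"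
  unfolding fourier_sum_def by (intro L2_lincomb) (auto simp: l2_onbD)

lemma l2_inner_fourier_sum:
  assumes onb: "l2_onb \<mu> J e" and i: "i \<in> J" "i < n"
  shows "l2_inner \<mu> (e i) (fourier_sum \<mu> J e f n) = l2_inner \<mu> (e i) f"
proof -
  have "l2_inner \<mu> (e i) (fourier_sum \<mu> J e f n) = (\<Sum>j\<in>J \<inter> {..<n}. l2_inner \<mu> (e j) f * l2_inner \<mu> (e i) (e j))"
    unfolding fourier_sum_def using i by (intro l2_inner_lincomb_right) (auto simp: l2_onbD[OF onb])
  also have "\<dots> = (\<Sum>j\<in>J \<inter> {..<n}. if i = j then l2_inner \<mu> (e j) f else 0)"
    using i by (intro sum.cong) (auto simp: l2_onbD(2)[OF onb])
  also have "\<dots> = l2_inner \<mu> (e i) f" using i by simp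
  finally show ?thesis .
qed

lemma fourier_sum_residual:
  assumes onb: "l2_onb \<mu> J e" and f: "f \<in> L2 \<mu>"
  shows "(l2_norm \<mu> (\<lambda>x. f x - fourier_sum \<mu> J e f n x))\<^sup>2
    = (l2_norm \<mu> f)\<^sup>2 - (\<Sum>i\<in>J \<inter> {..<n}. (cmod (l2_inner \<mu> (e i) f))\<^sup>2)"
  unfolding fourier_sum_def by (intro Bessel_residual f) (auto simp: l2_onbD[OF onb])

text \<open>\<open>l2_onb\<close> only says that nothing but null functions is orthogonal to the
  system. The partial sums are Cauchy by Bessel, so completeness supplies a limit \<open>s\<close>;
  then \<open>f - s\<close> is orthogonal to every basis function and vanishes almost
  everywhere.\<close>

theorem fourier_sum_tendsto:
  assumes onb: "l2_onb \<mu> J e" and f: "f \<in> L2 \<mu>"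
  shows "(\<lambda>n. l2_norm \<mu> (\<lambda>x. f x - fourier_sum \<mu> J e f n x)) \<longlonglongrightarrow> 0"
proof -
  let ?S = "fourier_sum \<mu> J e f"
  define q where "q n = (\<Sum>i\<in>J \<inter> {..<n}. (cmod (l2_inner \<mu> (e i) f))\<^sup>2)" for n
  have q_le: "q n \<le> (l2_norm \<mu> f)\<^sup>2" for n
    unfolding q_def using onb f by (intro Bessel_inequality) (auto simp: l2_onbD[OF onb])
  have "incseq q" unfolding q_def by (intro monoI sum_mono2) auto
  then obtain L where "q \<longlonglongrightarrow> L" by (rule incseq_convergent) (use q_le in auto)
  then have "Cauchy q" by (rule LIMSEQ_imp_Cauchy)
  \<comment> \<open>Truncating \<open>?S m\<close> at \<open>n\<close> gives \<open>?S n\<close>, so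
    the residual identity applied to \<open>?S m\<close> computes the distance between two partial
    sums.\<close>
  have res: "(l2_norm \<mu> (\<lambda>x. ?S m x - ?S n x))\<^sup>2 = (l2_norm \<mu> (?S m))\<^sup>2 - q n" if "n \<le> m" for m n
  proof -
    have ip: "l2_inner \<mu> (e i) (?S m) = l2_inner \<mu> (e i) f" if "i \<in> J \<inter> {..<n}" for i
      using that \<open>n \<le> m\<close> by (intro l2_inner_fourier_sum[OF onb]) auto
    have "fourier_sum \<mu> J e (?S m) n = ?S n"
      unfolding fourier_sum_def[of _ _ _ "?S m"] fourier_sum_def[of _ _ _ f n]
      by (intro ext sum.cong refl) (simp only: ip)
    moreover have "(\<Sum>i\<in>J \<inter> {..<n}. (cmod (l2_inner \<mu> (e i) (?S m)))\<^sup>2) = q n"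
      unfolding q_def by (intro sum.cong refl) (simp only: ip)
    ultimately show ?thesis
      using fourier_sum_residual[OF onb fourier_sum_L2[OF onb, of f m], of n] by simp
  qed
  have diff: "(l2_norm \<mu> (\<lambda>x. ?S m x - ?S n x))\<^sup>2 = q m - q n" if "n \<le> m" for m n
  proof -
    have "(l2_norm \<mu> (\<lambda>x. ?S m x - ?S m x))\<^sup>2 = 0" by (simp add: l2_norm_def)
    with res[OF order_refl, of m] have "(l2_norm \<mu> (?S m))\<^sup>2 = q m" by simp
    with res[OF that] show ?thesis by simp
  qed
  have "\<exists>N. \<forall>m\<ge>N. \<forall>n\<ge>N. l2_norm \<mu> (\<lambda>x. ?S m x - ?S n x) < \<epsilon>" if "0 < \<epsilon>" for \<epsilon>
  proof -
    obtain N where N: "\<And>m n. m \<ge> N \<Longrightarrow> n \<ge> N \<Longrightarrow> \<bar>q m - q n\<bar> < \<epsilon>\<^sup>2"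
      using metric_CauchyD[OF \<open>Cauchy q\<close>, of "\<epsilon>\<^sup>2"] \<open>0 < \<epsilon>\<close> by (auto simp: dist_real_def)
    have *: "l2_norm \<mu> (\<lambda>x. ?S m x - ?S n x) < \<epsilon>" if "n \<le> m" "N \<le> n" for m n
    proof (rule power2_less_imp_less)
      show "(l2_norm \<mu> (\<lambda>x. ?S m x - ?S n x))\<^sup>2 < \<epsilon>\<^sup>2"
        unfolding diff[OF that(1)] using N[of m n] that by simp
    qed (use \<open>0 < \<epsilon>\<close> in simp)
    show ?thesis
    proof (intro exI allI impI)
      fix m n assume mn: "N \<le> m" "N \<le> n"
      show "l2_norm \<mu> (\<lambda>x. ?S m x - ?S n x) < \<epsilon>"
      proof (cases "n \<le> m")
        case False
        then show ?thesis
          using *[of m n] mn by (subst l2_norm_minus_commute) simp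
      qed (use *[of n m] mn in simp)
    qed
  qed
  from L2_complete[of ?S \<mu>, OF fourier_sum_L2[OF onb] this]
  obtain s where s: "s \<in> L2 \<mu>" and lim: "(\<lambda>n. l2_norm \<mu> (\<lambda>x. ?S n x - s x)) \<longlonglongrightarrow> 0"
    by auto
  have "l2_inner \<mu> (e i) (\<lambda>x. f x - s x) = 0" if i: "i \<in> J" for i
  proof -
    have ei: "e i \<in> L2 \<mu>" using onb i by (rule l2_onbD)
    have "(\<lambda>n. cmod (l2_inner \<mu> (e i) (\<lambda>x. ?S n x - s x))) \<longlonglongrightarrow> 0"
    proof (rule tendsto_sandwich[OF _ _ tendsto_const])
      show "(\<lambda>n. l2_norm \<mu> (e i) * l2_norm \<mu> (\<lambda>x. ?S n x - s x)) \<longlonglongrightarrow> 0"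
        using tendsto_mult_right_zero[OF lim] .
      show "\<forall>\<^sub>F n in sequentially. cmod (l2_inner \<mu> (e i) (\<lambda>x. ?S n x - s x)) \<le> l2_norm \<mu> (e i) * l2_norm \<mu> (\<lambda>x. ?S n x - s x)"
        using ei s by (intro always_eventually allI l2_Cauchy_Schwarz L2_diff fourier_sum_L2[OF onb])
    qed auto
    moreover have "\<forall>\<^sub>F n in sequentially. cmod (l2_inner \<mu> (e i) (\<lambda>x. ?S n x - s x)) = cmod (l2_inner \<mu> (e i) (\<lambda>x. f x - s x))"
      using eventually_gt_at_top[of i]
      by eventually_elim
        (simp add: l2_inner_diff_right ei s f fourier_sum_L2[OF onb] l2_inner_fourier_sum[OF onb i])
    ultimately have "(\<lambda>n::nat. cmod (l2_inner \<mu> (e i) (\<lambda>x. f x - s x))) \<longlonglongrightarrow> 0"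
      by (rule Lim_transform_eventually)
    then show ?thesis by (simp add: LIMSEQ_const_iff)
  qed
  then have "AE x in \<mu>. f x - s x = 0"
    by (intro l2_onbD(3)[OF onb] L2_diff f s)
  then have AE: "AE x in \<mu>. f x - ?S n x = s x - ?S n x" for n by eventually_elim simp
  have "l2_norm \<mu> (\<lambda>x. f x - ?S n x) = l2_norm \<mu> (\<lambda>x. ?S n x - s x)" for n
    using l2_norm_cong_AE[OF L2_diff[OF f fourier_sum_L2[OF onb]] L2_diff[OF s fourier_sum_L2[OF onb]] AE]
    by (simp only: l2_norm_minus_commute[of _ "?S n"])
  with lim show ?thesis by simp
qed

section \<open>Matrices of trace class operators\<close>

lemma bounded_opD:
  assumes "bounded_op \<mu> A"
  shows "f \<in> L2 \<mu> \<Longrightarrow> A f \<in> L2 \<mu>"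
    and "f \<in> L2 \<mu> \<Longrightarrow> g \<in> L2 \<mu> \<Longrightarrow>
      AE x in \<mu>. A (\<lambda>y. a * f y + b * g y) x = a * A f x + b * A g x"
  using assms unfolding bounded_op_def by blast+

lemma bounded_op_lincomb:
  assumes A: "bounded_op \<mu> A" and "finite F" and e: "\<And>i. i \<in> F \<Longrightarrow> e i \<in> L2 \<mu>"
  shows "AE x in \<mu>. A (\<lambda>x. \<Sum>i\<in>F. a i * e i x) x = (\<Sum>i\<in>F. a i * A (e i) x)"
  using assms(2) e
proof (induction F rule: finite_induct)
  case empty
  show ?case using bounded_opD(2)[OF A L2_zero L2_zero, of 0 0] by simp
next
  case (insert i F)
  have "AE x in \<mu>. A (\<lambda>x. a i * e i x + 1 * (\<Sum>i\<in>F. a i * e i x)) x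
      = a i * A (e i) x + 1 * A (\<lambda>x. \<Sum>i\<in>F. a i * e i x) x"
    using insert.prems by (intro bounded_opD(2)[OF A] L2_lincomb) auto
  moreover have "AE x in \<mu>. A (\<lambda>x. \<Sum>i\<in>F. a i * e i x) x = (\<Sum>i\<in>F. a i * A (e i) x)"
    using insert by simp
  ultimately show ?case by eventually_elim (simp add: insert.hyps)
qed

text \<open>Inserts the basis between \<open>B\<close> and \<open>g\<close>. Operators act on
  representatives and are linear only almost everywhere, so finite expansions are compared inside
  inner products; the error is controlled by Cauchy-Schwarz and the operator bound.\<close>

lemma bounded_op_matrix_tendsto:
  assumes B: "bounded_op \<mu> B" and onb: "l2_onb \<mu> J f" and h: "h \<in> L2 \<mu>" and g: "g \<in> L2 \<mu>"
  shows "(\<lambda>n. \<Sum>k\<in>J \<inter> {..<n}. l2_inner \<mu> h (B (f k)) * l2_inner \<mu> (f k) g) \<longlonglongrightarrow> l2_inner \<mu> h (B g)"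
proof -
  let ?S = "fourier_sum \<mu> J f g"
  obtain C where C: "\<And>u. u \<in> L2 \<mu> \<Longrightarrow> l2_norm \<mu> (B u) \<le> C * l2_norm \<mu> u"
    using B unfolding bounded_op_def by blast
  have S: "?S n \<in> L2 \<mu>" for n using onb by (rule fourier_sum_L2)
  have f: "f k \<in> L2 \<mu>" if "k \<in> J \<inter> {..<n}" for k n using that l2_onbD(1)[OF onb] by blast
  have sum: "l2_inner \<mu> h (B (?S n)) = (\<Sum>k\<in>J \<inter> {..<n}. l2_inner \<mu> h (B (f k)) * l2_inner \<mu> (f k) g)" for n
  proof -
    have "l2_inner \<mu> h (B (?S n)) = l2_inner \<mu> h (\<lambda>x. \<Sum>k\<in>J \<inter> {..<n}. l2_inner \<mu> (f k) g * B (f k) x)"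
    proof (rule l2_inner_cong_AE[OF _ _ h])
      show "B (?S n) \<in> L2 \<mu>" by (rule bounded_opD(1)[OF B S])
      show "(\<lambda>x. \<Sum>k\<in>J \<inter> {..<n}. l2_inner \<mu> (f k) g * B (f k) x) \<in> L2 \<mu>"
        by (rule L2_lincomb) (rule bounded_opD(1)[OF B f])
      show "AE x in \<mu>. B (?S n) x = (\<Sum>k\<in>J \<inter> {..<n}. l2_inner \<mu> (f k) g * B (f k) x)"
        unfolding fourier_sum_def by (rule bounded_op_lincomb[OF B _ f]) auto
    qed
    also have "\<dots> = (\<Sum>k\<in>J \<inter> {..<n}. l2_inner \<mu> (f k) g * l2_inner \<mu> h (B (f k)))"
      by (rule l2_inner_lincomb_right[OF h]) (rule bounded_opD(1)[OF B f])
    finally show ?thesis by (simp add: mult.commute)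
  qed
  have le: "cmod (l2_inner \<mu> h (B (?S n)) - l2_inner \<mu> h (B g))
      \<le> l2_norm \<mu> h * (C * l2_norm \<mu> (\<lambda>x. g x - ?S n x))" for n
  proof -
    have gS: "(\<lambda>x. g x - ?S n x) \<in> L2 \<mu>" by (rule L2_diff[OF g S])
    have "AE x in \<mu>. B (\<lambda>x. 1 * g x + (-1) * ?S n x) x = 1 * B g x + (-1) * B (?S n) x"
      by (rule bounded_opD(2)[OF B g S])
    then have "AE x in \<mu>. B (\<lambda>x. g x - ?S n x) x = B g x - B (?S n) x" by simp
    then have "l2_inner \<mu> h (B (\<lambda>x. g x - ?S n x)) = l2_inner \<mu> h (\<lambda>x. B g x - B (?S n) x)"
      by (rule l2_inner_cong_AE[OF bounded_opD(1)[OF B gS] L2_diff[OF bounded_opD(1)[OF B g] bounded_opD(1)[OF B S]] h])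
    also have "\<dots> = l2_inner \<mu> h (B g) - l2_inner \<mu> h (B (?S n))"
      by (rule l2_inner_diff_right[OF h bounded_opD(1)[OF B g] bounded_opD(1)[OF B S]])
    finally have "cmod (l2_inner \<mu> h (B (?S n)) - l2_inner \<mu> h (B g)) = cmod (l2_inner \<mu> h (B (\<lambda>x. g x - ?S n x)))"
      by (simp only: norm_minus_commute)
    also have "\<dots> \<le> l2_norm \<mu> h * l2_norm \<mu> (B (\<lambda>x. g x - ?S n x))"
      by (rule l2_Cauchy_Schwarz[OF h bounded_opD(1)[OF B gS]])
    also have "\<dots> \<le> l2_norm \<mu> h * (C * l2_norm \<mu> (\<lambda>x. g x - ?S n x))"
      by (rule mult_left_mono[OF C[OF gS] l2_norm_nonneg])
    finally show ?thesis .
  qed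
  have "(\<lambda>n. l2_norm \<mu> h * (C * l2_norm \<mu> (\<lambda>x. g x - ?S n x))) \<longlonglongrightarrow> l2_norm \<mu> h * (C * 0)"
    by (intro tendsto_mult tendsto_const fourier_sum_tendsto[OF onb g])
  then have "(\<lambda>n. l2_norm \<mu> h * (C * l2_norm \<mu> (\<lambda>x. g x - ?S n x))) \<longlonglongrightarrow> 0" by simp
  then have "(\<lambda>n. l2_inner \<mu> h (B (?S n)) - l2_inner \<mu> h (B g)) \<longlonglongrightarrow> 0"
    by (rule Lim_null_comparison[rotated]) (intro always_eventually allI le)
  then show ?thesis unfolding sum by (simp add: LIM_zero_iff)
qed

text \<open>For each \<open>k\<close>, Bessel in the basis \<open>e\<close> bounds the sum over
  \<open>i\<close> by the squared norm of \<open>B (f k)\<close>.\<close>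

lemma hilbert_schmidt_rows:
  assumes B: "bounded_op \<mu> B" and f: "l2_onb \<mu> J' f"
    and summ: "(\<lambda>k. (l2_norm \<mu> (B (f k)))\<^sup>2) summable_on J'"
    and e: "l2_onb \<mu> J e" and F: "finite F" "F \<subseteq> J"
  shows "(\<Sum>i\<in>F. \<Sum>k\<in>J' \<inter> {..<m}. (cmod (l2_inner \<mu> (e i) (B (f k))))\<^sup>2)
    \<le> (\<Sum>\<^sub>\<infinity>k\<in>J'. (l2_norm \<mu> (B (f k)))\<^sup>2)"
proof -
  have "(\<Sum>i\<in>F. \<Sum>k\<in>J' \<inter> {..<m}. (cmod (l2_inner \<mu> (e i) (B (f k))))\<^sup>2)
      = (\<Sum>k\<in>J' \<inter> {..<m}. \<Sum>i\<in>F. (cmod (l2_inner \<mu> (e i) (B (f k))))\<^sup>2)"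
    by (rule sum.swap)
  also have "\<dots> \<le> (\<Sum>k\<in>J' \<inter> {..<m}. (l2_norm \<mu> (B (f k)))\<^sup>2)"
  proof (rule sum_mono)
    fix k assume "k \<in> J' \<inter> {..<m}"
    then have "B (f k) \<in> L2 \<mu>" using l2_onbD(1)[OF f] bounded_opD(1)[OF B] by blast
    then show "(\<Sum>i\<in>F. (cmod (l2_inner \<mu> (e i) (B (f k))))\<^sup>2) \<le> (l2_norm \<mu> (B (f k)))\<^sup>2"
      using F l2_onbD(1,2)[OF e] by (intro Bessel_inequality) blast+
  qed
  also have "\<dots> \<le> (\<Sum>\<^sub>\<infinity>k\<in>J'. (l2_norm \<mu> (B (f k)))\<^sup>2)"
    by (rule finite_sum_le_infsum[OF summ]) auto
  finally show ?thesis .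
qed

text \<open>The Hilbert-Schmidt sum is known in the basis \<open>g\<close>, while the columns are
  indexed by \<open>e\<close>, so sums of squares must be moved between bases. \<open>X\<close>
  expands the entries through \<open>g\<close>; its truncations are bounded uniformly in
  \<open>n\<close>, and the limit keeps the bound.\<close>

lemma hilbert_schmidt_columns:
  assumes C: "bounded_op \<mu> C" and g: "l2_onb \<mu> J' g"
    and summ: "(\<lambda>l. (l2_norm \<mu> (C (g l)))\<^sup>2) summable_on J'"
    and e: "l2_onb \<mu> J e" and F: "finite F" "F \<subseteq> J"
    and f: "l2_onb \<mu> L f"
  shows "(\<Sum>j\<in>F. \<Sum>k\<in>L \<inter> {..<m}. (cmod (l2_inner \<mu> (f k) (C (e j))))\<^sup>2)
    \<le> (\<Sum>\<^sub>\<infinity>l\<in>J'. (l2_norm \<mu> (C (g l)))\<^sup>2)"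
proof -
  define X where "X n k j = (\<Sum>l\<in>J' \<inter> {..<n}. l2_inner \<mu> (f k) (C (g l)) * l2_inner \<mu> (g l) (e j))" for n k j
  have X: "(\<lambda>n. X n k j) \<longlonglongrightarrow> l2_inner \<mu> (f k) (C (e j))" if "k \<in> L" "j \<in> F" for k j
    unfolding X_def using that F l2_onbD(1)[OF f] l2_onbD(1)[OF e]
    by (intro bounded_op_matrix_tendsto[OF C g]) blast+
  have lim: "(\<lambda>n. \<Sum>j\<in>F. \<Sum>k\<in>L \<inter> {..<m}. (cmod (X n k j))\<^sup>2) \<longlonglongrightarrow>
      (\<Sum>j\<in>F. \<Sum>k\<in>L \<inter> {..<m}. (cmod (l2_inner \<mu> (f k) (C (e j))))\<^sup>2)"
    by (intro tendsto_sum tendsto_power tendsto_norm X) auto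
  have "(\<Sum>j\<in>F. \<Sum>k\<in>L \<inter> {..<m}. (cmod (X n k j))\<^sup>2) \<le> (\<Sum>\<^sub>\<infinity>l\<in>J'. (l2_norm \<mu> (C (g l)))\<^sup>2)" for n
  proof -
    have gL: "g l \<in> L2 \<mu>" if "l \<in> J' \<inter> {..<n}" for l using that l2_onbD(1)[OF g] by blast
    have 1: "(\<Sum>j\<in>F. (cmod (X n k j))\<^sup>2) \<le> (\<Sum>l\<in>J' \<inter> {..<n}. (cmod (l2_inner \<mu> (f k) (C (g l))))\<^sup>2)" for k
    proof -
      \<comment> \<open>The truncated expansion in \<open>g\<close> of the adjoint of
        \<open>C\<close> applied to \<open>f k\<close>. Up to conjugation, the entries
        \<open>X n k j\<close> are its coefficients along the \<open>e j\<close>, ready for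
        Bessel.\<close>
      define v where "v = (\<lambda>x. \<Sum>l\<in>J' \<inter> {..<n}. cnj (l2_inner \<mu> (f k) (C (g l))) * g l x)"
      have v: "v \<in> L2 \<mu>" unfolding v_def by (rule L2_lincomb[OF gL])
      have "cmod (X n k j) = cmod (l2_inner \<mu> (e j) v)" if "j \<in> F" for j
      proof -
        have "e j \<in> L2 \<mu>" using that F l2_onbD(1)[OF e] by blast
        then have "X n k j = l2_inner \<mu> v (e j)"
          unfolding v_def X_def by (subst l2_inner_lincomb_left[OF _ gL]) simp_all
        then show ?thesis by (simp only: l2_inner_commute[of \<mu> v "e j"] complex_mod_cnj)
      qed
      then have "(\<Sum>j\<in>F. (cmod (X n k j))\<^sup>2) = (\<Sum>j\<in>F. (cmod (l2_inner \<mu> (e j) v))\<^sup>2)" by simp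
      also have "\<dots> \<le> (l2_norm \<mu> v)\<^sup>2"
        using F l2_onbD(1,2)[OF e] v by (intro Bessel_inequality) blast+
      also have "\<dots> = (\<Sum>l\<in>J' \<inter> {..<n}. (cmod (cnj (l2_inner \<mu> (f k) (C (g l)))))\<^sup>2)"
        unfolding v_def using l2_onbD(1,2)[OF g] by (intro l2_norm_orthonormal_lincomb) auto
      finally show ?thesis by simp
    qed
    have "(\<Sum>j\<in>F. \<Sum>k\<in>L \<inter> {..<m}. (cmod (X n k j))\<^sup>2) = (\<Sum>k\<in>L \<inter> {..<m}. \<Sum>j\<in>F. (cmod (X n k j))\<^sup>2)"
      by (rule sum.swap)
    also have "\<dots> \<le> (\<Sum>k\<in>L \<inter> {..<m}. \<Sum>l\<in>J' \<inter> {..<n}. (cmod (l2_inner \<mu> (f k) (C (g l))))\<^sup>2)"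
      by (intro sum_mono 1)
    also have "\<dots> \<le> (\<Sum>\<^sub>\<infinity>l\<in>J'. (l2_norm \<mu> (C (g l)))\<^sup>2)"
      by (rule hilbert_schmidt_rows[OF C g summ f]) auto
    finally show ?thesis .
  qed
  then show ?thesis by (intro LIMSEQ_le_const2[OF lim]) blast
qed

text \<open>Passes from finite rectangles to full rows: \<open>t i\<close> is the sum of the series
  \<open>w i\<close>, and for finitely many rows the two summations commute.\<close>

lemma row_sums_exist:
  fixes w :: "nat \<Rightarrow> nat \<Rightarrow> real"
  assumes w: "\<And>i k. 0 \<le> w i k"
    and S: "\<And>F m. finite F \<Longrightarrow> F \<subseteq> J \<Longrightarrow> (\<Sum>i\<in>F. \<Sum>k<m. w i k) \<le> S"
  obtains t where "\<And>i m. i \<in> J \<Longrightarrow> (\<Sum>k<m. w i k) \<le> t i" "\<And>i. i \<in> J \<Longrightarrow> 0 \<le> t i"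
    "\<And>F. finite F \<Longrightarrow> F \<subseteq> J \<Longrightarrow> (\<Sum>i\<in>F. t i) \<le> S"
proof
  have summ: "summable (w i)" if "i \<in> J" for i
    using S[of "{i}"] that w by (intro summableI_nonneg_bounded[of _ S]) auto
  show "(\<Sum>k<m. w i k) \<le> suminf (w i)" if "i \<in> J" for i m
    using summ[OF that] w by (intro sum_le_suminf) auto
  show "0 \<le> suminf (w i)" if "i \<in> J" for i
    using summ[OF that] w by (intro suminf_nonneg)
  show "(\<Sum>i\<in>F. suminf (w i)) \<le> S" if F: "finite F" "F \<subseteq> J" for F
  proof -
    have "(\<Sum>i\<in>F. suminf (w i)) = (\<Sum>k. \<Sum>i\<in>F. w i k)"
      using summ F by (subst suminf_sum) auto
    also have "\<dots> \<le> S"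
    proof (rule suminf_le_const)
      show "summable (\<lambda>k. \<Sum>i\<in>F. w i k)" using summ F by (intro summable_sum) auto
      show "(\<Sum>k<m. \<Sum>i\<in>F. w i k) \<le> S" for m using S[OF F] by (subst sum.swap)
    qed
    finally show ?thesis .
  qed
qed

text \<open>The factorisation of \<open>A\<close> seen in an arbitrary orthonormal basis
  \<open>e\<close>: \<open>b\<close> holds the rows of the first Hilbert-Schmidt factor,
  \<open>c\<close> the columns of the second, joined through the basis that witnesses the
  Hilbert-Schmidt property of the first.\<close>

theorem trace_class_matrix:
  assumes A: "trace_class \<mu> A" and e: "l2_onb \<mu> J e"
  obtains b c :: "nat \<Rightarrow> nat \<Rightarrow> complex" and t :: "nat \<Rightarrow> real" and T where
    "\<And>i j. i \<in> J \<Longrightarrow> j \<in> J \<Longrightarrow> (\<lambda>m. \<Sum>k<m. b i k * c j k) \<longlonglongrightarrow> l2_inner \<mu> (e i) (A (e j))"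
    "\<And>i m. i \<in> J \<Longrightarrow> (\<Sum>k<m. (cmod (b i k))\<^sup>2) \<le> t i"
    "\<And>i m. i \<in> J \<Longrightarrow> (\<Sum>k<m. (cmod (c i k))\<^sup>2) \<le> t i"
    "\<And>F. finite F \<Longrightarrow> F \<subseteq> J \<Longrightarrow> (\<Sum>i\<in>F. t i) \<le> T"
proof -
  obtain B C where B: "hilbert_schmidt \<mu> B" and C: "hilbert_schmidt \<mu> C" and A_op: "bounded_op \<mu> A"
    and ABC: "\<And>f. f \<in> L2 \<mu> \<Longrightarrow> AE x in \<mu>. A f x = B (C f) x"
    using A unfolding trace_class_def by blast
  obtain L f where B_op: "bounded_op \<mu> B" and f: "l2_onb \<mu> L f"
    and fs: "(\<lambda>i. (l2_norm \<mu> (B (f i)))\<^sup>2) summable_on L"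
    using B unfolding hilbert_schmidt_def by blast
  obtain L' g where C_op: "bounded_op \<mu> C" and g: "l2_onb \<mu> L' g"
    and gs: "(\<lambda>i. (l2_norm \<mu> (C (g i)))\<^sup>2) summable_on L'"
    using C unfolding hilbert_schmidt_def by blast
  \<comment> \<open>The value 0 outside \<open>L\<close> lets the sums run over all
    \<open>k < m\<close>.\<close>
  define b where "b i k = (if k \<in> L then l2_inner \<mu> (e i) (B (f k)) else 0)" for i k
  define c where "c j k = (if k \<in> L then l2_inner \<mu> (f k) (C (e j)) else 0)" for j k
  have restrict: "(\<Sum>k\<in>L \<inter> {..<m}. h k) = (\<Sum>k<m. if k \<in> L then h k else 0)" for m and h :: "nat \<Rightarrow> 'x::comm_monoid_add"
    by (subst Int_commute) (simp add: sum.inter_restrict)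
  have lim: "(\<lambda>m. \<Sum>k<m. b i k * c j k) \<longlonglongrightarrow> l2_inner \<mu> (e i) (A (e j))" if ij: "i \<in> J" "j \<in> J" for i j
  proof -
    have ei: "e i \<in> L2 \<mu>" and ej: "e j \<in> L2 \<mu>" using ij l2_onbD(1)[OF e] by auto
    have Cej: "C (e j) \<in> L2 \<mu>" by (rule bounded_opD(1)[OF C_op ej])
    have "(\<lambda>m. \<Sum>k<m. b i k * c j k) = (\<lambda>n. \<Sum>k\<in>L \<inter> {..<n}. l2_inner \<mu> (e i) (B (f k)) * l2_inner \<mu> (f k) (C (e j)))"
      unfolding restrict b_def c_def by (intro ext sum.cong) auto
    also have "\<dots> \<longlonglongrightarrow> l2_inner \<mu> (e i) (B (C (e j)))"
      by (rule bounded_op_matrix_tendsto[OF B_op f ei Cej])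
    also have "l2_inner \<mu> (e i) (B (C (e j))) = l2_inner \<mu> (e i) (A (e j))"
      by (rule l2_inner_cong_AE[OF bounded_opD(1)[OF A_op ej] bounded_opD(1)[OF B_op Cej] ei ABC[OF ej], symmetric])
    finally show ?thesis .
  qed
  obtain tb where tb: "\<And>i m. i \<in> J \<Longrightarrow> (\<Sum>k<m. (cmod (b i k))\<^sup>2) \<le> tb i" "\<And>i. i \<in> J \<Longrightarrow> 0 \<le> tb i"
    "\<And>F. finite F \<Longrightarrow> F \<subseteq> J \<Longrightarrow> (\<Sum>i\<in>F. tb i) \<le> (\<Sum>\<^sub>\<infinity>k\<in>L. (l2_norm \<mu> (B (f k)))\<^sup>2)"
  proof (rule row_sums_exist[of "\<lambda>i k. (cmod (b i k))\<^sup>2" J])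
    fix F m assume F: "finite F" "F \<subseteq> J"
    have "(\<Sum>i\<in>F. \<Sum>k<m. (cmod (b i k))\<^sup>2) = (\<Sum>i\<in>F. \<Sum>k\<in>L \<inter> {..<m}. (cmod (l2_inner \<mu> (e i) (B (f k))))\<^sup>2)"
      unfolding restrict b_def by (intro sum.cong) auto
    also have "\<dots> \<le> (\<Sum>\<^sub>\<infinity>k\<in>L. (l2_norm \<mu> (B (f k)))\<^sup>2)"
      by (rule hilbert_schmidt_rows[OF B_op f fs e F])
    finally show "(\<Sum>i\<in>F. \<Sum>k<m. (cmod (b i k))\<^sup>2) \<le> (\<Sum>\<^sub>\<infinity>k\<in>L. (l2_norm \<mu> (B (f k)))\<^sup>2)" .
  qed auto
  obtain tc where tc: "\<And>i m. i \<in> J \<Longrightarrow> (\<Sum>k<m. (cmod (c i k))\<^sup>2) \<le> tc i" "\<And>i. i \<in> J \<Longrightarrow> 0 \<le> tc i"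
    "\<And>F. finite F \<Longrightarrow> F \<subseteq> J \<Longrightarrow> (\<Sum>i\<in>F. tc i) \<le> (\<Sum>\<^sub>\<infinity>l\<in>L'. (l2_norm \<mu> (C (g l)))\<^sup>2)"
  proof (rule row_sums_exist[of "\<lambda>i k. (cmod (c i k))\<^sup>2" J])
    fix F m assume F: "finite F" "F \<subseteq> J"
    have "(\<Sum>i\<in>F. \<Sum>k<m. (cmod (c i k))\<^sup>2) = (\<Sum>i\<in>F. \<Sum>k\<in>L \<inter> {..<m}. (cmod (l2_inner \<mu> (f k) (C (e i))))\<^sup>2)"
      unfolding restrict c_def by (intro sum.cong) auto
    also have "\<dots> \<le> (\<Sum>\<^sub>\<infinity>l\<in>L'. (l2_norm \<mu> (C (g l)))\<^sup>2)"
      by (rule hilbert_schmidt_columns[OF C_op g gs e F f])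
    finally show "(\<Sum>i\<in>F. \<Sum>k<m. (cmod (c i k))\<^sup>2) \<le> (\<Sum>\<^sub>\<infinity>l\<in>L'. (l2_norm \<mu> (C (g l)))\<^sup>2)" .
  qed auto
  show thesis
  \<comment> \<open>A sum of two nonnegative bounds dominates each of them and gives the single
    \<open>t\<close> that \<open>minor_bound\<close> asks for.\<close>
  proof (rule that[of b c "\<lambda>i. tb i + tc i"])
    show "(\<lambda>m. \<Sum>k<m. b i k * c j k) \<longlonglongrightarrow> l2_inner \<mu> (e i) (A (e j))" if "i \<in> J" "j \<in> J" for i j
      using that by (rule lim)
    show "(\<Sum>k<m. (cmod (b i k))\<^sup>2) \<le> tb i + tc i" if "i \<in> J" for i m
      using tb(1)[OF that, of m] tc(2)[OF that] by linarith
    show "(\<Sum>k<m. (cmod (c i k))\<^sup>2) \<le> tb i + tc i" if "i \<in> J" for i m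
      using tc(1)[OF that, of m] tb(2)[OF that] by linarith
    show "(\<Sum>i\<in>F. tb i + tc i) \<le> (\<Sum>\<^sub>\<infinity>k\<in>L. (l2_norm \<mu> (B (f k)))\<^sup>2) + (\<Sum>\<^sub>\<infinity>l\<in>L'. (l2_norm \<mu> (C (g l)))\<^sup>2)"
      if "finite F" "F \<subseteq> J" for F
      using tb(3)[OF that] tc(3)[OF that] by (simp add: sum.distrib)
  qed
qed

section \<open>Growth of Fredholm determinants\<close>

lemma minor_scale: "minor (\<lambda>i j. z * M i j) I = z ^ card I * minor M I"
  by (simp add: minor_def prod.distrib sum_distrib_left mult_ac)

definition minor_series :: "'i set \<Rightarrow> ('i \<Rightarrow> 'i \<Rightarrow> complex) \<Rightarrow> complex \<Rightarrow> complex" where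
  "minor_series J M z = (\<Sum>\<^sub>\<infinity>I\<in>{I. finite I \<and> I \<subseteq> J}. z ^ card I * minor M I)"

text \<open>For the matrix of a trace class operator this is the trace of its \<open>n\<close>-th
  exterior power.\<close>

definition minor_coeff :: "'i set \<Rightarrow> ('i \<Rightarrow> 'i \<Rightarrow> complex) \<Rightarrow> nat \<Rightarrow> complex" where
  "minor_coeff J M n = (\<Sum>\<^sub>\<infinity>I\<in>{I. finite I \<and> I \<subseteq> J \<and> card I = n}. minor M I)"

text \<open>All that the growth estimate uses of a trace class operator: its minors are dominated by
  those of a diagonal matrix with summable entries \<open>t\<close>.\<close>

locale dominated_minors =
  fixes J :: "'i set" and M :: "'i \<Rightarrow> 'i \<Rightarrow> complex" and t :: "'i \<Rightarrow> real" and T :: real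
  assumes minor_le: "\<And>I. finite I \<Longrightarrow> I \<subseteq> J \<Longrightarrow> cmod (minor M I) \<le> (\<Prod>i\<in>I. t i)"
    and t_nonneg: "\<And>i. i \<in> J \<Longrightarrow> 0 \<le> t i"
    and sum_t_le: "\<And>F. finite F \<Longrightarrow> F \<subseteq> J \<Longrightarrow> (\<Sum>i\<in>F. t i) \<le> T"
begin

text \<open>The product expands into a sum over all subsets of \<open>U\<close>, and the family
  selects some of them.\<close>

lemma sum_minors_le_prod:
  assumes fin: "finite \<F>" and sub: "\<And>I. I \<in> \<F> \<Longrightarrow> I \<subseteq> U" and U: "finite U" "U \<subseteq> J" and r: "0 \<le> r"
  shows "(\<Sum>I\<in>\<F>. r ^ card I * cmod (minor M I)) \<le> (\<Prod>i\<in>U. 1 + r * t i)"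
proof -
  have "(\<Sum>I\<in>\<F>. r ^ card I * cmod (minor M I)) \<le> (\<Sum>I\<in>Pow U. r ^ card I * cmod (minor M I))"
    using sub U r by (intro sum_mono2) auto
  also have "\<dots> \<le> (\<Sum>I\<in>Pow U. \<Prod>i\<in>I. r * t i)"
  proof (rule sum_mono)
    fix I assume "I \<in> Pow U"
    then have "finite I" "I \<subseteq> J" using U finite_subset by auto
    then show "r ^ card I * cmod (minor M I) \<le> (\<Prod>i\<in>I. r * t i)"
      using minor_le r by (simp add: prod.distrib mult_left_mono)
  qed
  also have "\<dots> = (\<Prod>i\<in>U. 1 + r * t i)"
    using prod_add[OF U(1), of "\<lambda>i. r * t i" "\<lambda>_. 1"] by (simp add: add.commute)
  finally show ?thesis .
qed

lemma prod_le_exp: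
  assumes "finite U" "U \<subseteq> J" "0 \<le> r"
  shows "(\<Prod>i\<in>U. 1 + r * t i) \<le> exp (r * (\<Sum>i\<in>U. t i))"
proof -
  have "(\<Prod>i\<in>U. 1 + r * t i) \<le> (\<Prod>i\<in>U. exp (r * t i))"
    using assms t_nonneg by (intro prod_mono) (auto intro!: add_nonneg_nonneg mult_nonneg_nonneg)
  also have "\<dots> = exp (r * (\<Sum>i\<in>U. t i))"
    using assms by (simp add: exp_sum sum_distrib_left)
  finally show ?thesis .
qed

lemma abs_summable_minors: "(\<lambda>I. norm (z ^ card I * minor M I)) summable_on {I. finite I \<and> I \<subseteq> J}"
  unfolding abs_summable_iff_bdd_above
proof (rule bdd_aboveI2)
  fix \<F> assume F: "\<F> \<in> {\<F>. \<F> \<subseteq> {I. finite I \<and> I \<subseteq> J} \<and> finite \<F>}"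
  define U where "U = \<Union>\<F>"
  have U: "finite U" "U \<subseteq> J" using F by (auto simp: U_def)
  have "(\<Sum>I\<in>\<F>. norm (z ^ card I * minor M I)) = (\<Sum>I\<in>\<F>. cmod z ^ card I * cmod (minor M I))"
    by (simp add: norm_mult norm_power)
  also have "\<dots> \<le> (\<Prod>i\<in>U. 1 + cmod z * t i)"
    using F U by (intro sum_minors_le_prod) (auto simp: U_def)
  also have "\<dots> \<le> exp (cmod z * (\<Sum>i\<in>U. t i))" using U by (intro prod_le_exp) auto
  also have "\<dots> \<le> exp (cmod z * T)" using sum_t_le[OF U] by (simp add: mult_left_mono)
  finally show "(\<Sum>I\<in>\<F>. norm (z ^ card I * minor M I)) \<le> exp (cmod z * T)" .
qed

text \<open>Absolute summability permits regrouping the index sets by cardinality, which turns an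
  unordered sum into an ordinary power series.\<close>

lemma minor_series_sums: "(\<lambda>n. minor_coeff J M n * z ^ n) sums minor_series J M z"
proof -
  let ?B = "\<lambda>n. {I. finite I \<and> I \<subseteq> J \<and> card I = n}"
  have summ: "(\<lambda>I. z ^ card I * minor M I) summable_on {I. finite I \<and> I \<subseteq> J}"
    by (rule abs_summable_summable[OF abs_summable_minors])
  have bij: "bij_betw snd (Sigma UNIV ?B) {I. finite I \<and> I \<subseteq> J}"
    by (rule bij_betw_byWitness[where f'="\<lambda>I. (card I, I)"]) auto
  have summ': "(\<lambda>(n, I). z ^ n * minor M I) summable_on Sigma UNIV ?B"
  proof -
    have "(\<lambda>x. z ^ card (snd x) * minor M (snd x)) summable_on Sigma UNIV ?B"
      using summ summable_on_reindex_bij_betw[OF bij, of "\<lambda>I. z ^ card I * minor M I"] by simp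
    then show ?thesis by (rule summable_on_cong[THEN iffD1, rotated]) auto
  qed
  have inner: "(\<Sum>\<^sub>\<infinity>I\<in>?B n. z ^ n * minor M I) = minor_coeff J M n * z ^ n" for n
    unfolding minor_coeff_def
    by (subst infsum_cmult_right') (rule mult.commute)
  have "(\<Sum>\<^sub>\<infinity>n. \<Sum>\<^sub>\<infinity>I\<in>?B n. z ^ n * minor M I) = (\<Sum>\<^sub>\<infinity>(n, I)\<in>Sigma UNIV ?B. z ^ n * minor M I)"
    by (rule infsum_Sigma'_banach[OF summ'])
  also have "\<dots> = (\<Sum>\<^sub>\<infinity>x\<in>Sigma UNIV ?B. z ^ card (snd x) * minor M (snd x))"
    by (rule infsum_cong) auto
  also have "\<dots> = minor_series J M z"
    unfolding minor_series_def by (rule infsum_reindex_bij_betw[OF bij])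
  finally have "(\<Sum>\<^sub>\<infinity>n. minor_coeff J M n * z ^ n) = minor_series J M z" unfolding inner .
  moreover have "(\<lambda>n. minor_coeff J M n * z ^ n) summable_on UNIV"
    using summable_on_Sigma_banach[OF summ'] unfolding inner .
  ultimately show ?thesis using has_sum_imp_sums[OF has_sum_infsum] by force
qed

text \<open>The total of all \<open>t\<close> is exhausted up to eps by a finite set
  \<open>F\<close>. Each factor indexed by \<open>F\<close> is at most \<open>1 + x * T\<close>,
  which gives the polynomial; the remaining \<open>t\<close> sum to at most eps and enter through
  the exponential.\<close>

lemma minor_series_growth:
  assumes "0 < \<epsilon>"
  obtains m where "\<And>x. 0 \<le> x \<Longrightarrow> cmod (minor_series J M (of_real x)) \<le> (1 + x * T) ^ m * exp (\<epsilon> * x)"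
proof -
  define s where "s = (SUP F\<in>{F. finite F \<and> F \<subseteq> J}. \<Sum>i\<in>F. t i)"
  have bdd: "bdd_above ((\<lambda>F. \<Sum>i\<in>F. t i) ` {F. finite F \<and> F \<subseteq> J})"
    using sum_t_le by (intro bdd_aboveI2) auto
  have "s - \<epsilon> < s" using assms by simp
  then have "\<exists>F\<in>{F. finite F \<and> F \<subseteq> J}. s - \<epsilon> < (\<Sum>i\<in>F. t i)"
    unfolding s_def by (subst (asm) less_cSUP_iff[OF _ bdd]) auto
  then obtain F where F: "finite F" "F \<subseteq> J" "s - \<epsilon> < (\<Sum>i\<in>F. t i)" by auto
  have tT: "t i \<le> T" if "i \<in> J" for i using sum_t_le[of "{i}"] that by simp
  have T0: "0 \<le> T" using sum_t_le[of "{}"] by simp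
  have "cmod (minor_series J M (of_real x)) \<le> (1 + x * T) ^ card F * exp (\<epsilon> * x)" if x: "0 \<le> x" for x
  proof -
    have "cmod (minor_series J M (of_real x)) \<le> (\<Sum>\<^sub>\<infinity>I\<in>{I. finite I \<and> I \<subseteq> J}. norm (of_real x ^ card I * minor M I))"
      unfolding minor_series_def by (rule norm_infsum_bound[OF abs_summable_minors])
    also have "\<dots> \<le> (1 + x * T) ^ card F * exp (\<epsilon> * x)"
    proof (rule infsum_le_finite_sums[OF abs_summable_minors])
      fix \<F> assume fin: "finite \<F>" and sub: "\<F> \<subseteq> {I. finite I \<and> I \<subseteq> J}"
      \<comment> \<open>\<open>F\<close> is adjoined so that its factors can be split off, whatever
        index sets the family contains.\<close>
      define U where "U = \<Union>\<F> \<union> F"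
      have U: "finite U" "U \<subseteq> J" "F \<subseteq> U" using fin sub F by (auto simp: U_def)
      have "(\<Sum>I\<in>\<F>. norm (of_real x ^ card I * minor M I)) = (\<Sum>I\<in>\<F>. x ^ card I * cmod (minor M I))"
        using x by (simp add: norm_mult norm_power)
      also have "\<dots> \<le> (\<Prod>i\<in>U. 1 + x * t i)"
        using fin U x by (intro sum_minors_le_prod) (auto simp: U_def)
      also have "\<dots> = (\<Prod>i\<in>F. 1 + x * t i) * (\<Prod>i\<in>U - F. 1 + x * t i)"
        using U by (subst prod.subset_diff[OF U(3) U(1)]) (simp add: mult.commute)
      also have "\<dots> \<le> (1 + x * T) ^ card F * exp (\<epsilon> * x)"
      proof (rule mult_mono)
        have "(\<Prod>i\<in>F. 1 + x * t i) \<le> (\<Prod>i\<in>F. 1 + x * T)"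
          using F x t_nonneg tT by (intro prod_mono conjI add_nonneg_nonneg add_left_mono mult_left_mono) auto
        then show "(\<Prod>i\<in>F. 1 + x * t i) \<le> (1 + x * T) ^ card F" by simp
        have "(\<Sum>i\<in>U. t i) \<le> s" unfolding s_def using U by (intro cSUP_upper[OF _ bdd]) auto
        then have "(\<Sum>i\<in>U - F. t i) \<le> \<epsilon>" using F(3) U by (simp add: sum_diff)
        then have "x * (\<Sum>i\<in>U - F. t i) \<le> \<epsilon> * x" by (subst mult.commute) (rule mult_right_mono[OF _ x])
        moreover have "(\<Prod>i\<in>U - F. 1 + x * t i) \<le> exp (x * (\<Sum>i\<in>U - F. t i))"
          using U x by (intro prod_le_exp) auto
        ultimately show "(\<Prod>i\<in>U - F. 1 + x * t i) \<le> exp (\<epsilon> * x)"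
          by (meson exp_le_cancel_iff order_trans)
        show "0 \<le> (1 + x * T) ^ card F" using x T0 by simp
        show "0 \<le> (\<Prod>i\<in>U - F. 1 + x * t i)"
          using U x t_nonneg by (intro prod_nonneg add_nonneg_nonneg mult_nonneg_nonneg) auto
      qed
      finally show "(\<Sum>I\<in>\<F>. norm (of_real x ^ card I * minor M I)) \<le> (1 + x * T) ^ card F * exp (\<epsilon> * x)" .
    qed
    finally show ?thesis .
  qed
  then show ?thesis by (rule that)
qed

end

lemma exp_not_polynomially_bounded:
  fixes c T :: real
  assumes c: "0 < c" and T: "0 \<le> T" and bound: "\<And>x. 0 \<le> x \<Longrightarrow> exp (c * x) \<le> (1 + x * T) ^ m"
  shows False
proof -
  \<comment> \<open>The constant comes from the substitution y = c x: for y >= 1, the base 1 + y T /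
    c is at most (1 + T / c) y.\<close>
  define Q where "Q = (1 + T / c) ^ m"
  have Q: "Q > 0" unfolding Q_def using c T by (intro zero_less_power add_pos_nonneg) auto
  have "eventually (\<lambda>y::real. y ^ m / exp y < 1 / Q) at_top"
    using tendsto_power_div_exp_0[of m] Q by (intro order_tendstoD) auto
  moreover have "eventually (\<lambda>y::real. y \<ge> 1) at_top" by (rule eventually_ge_at_top)
  ultimately have "eventually (\<lambda>y::real. y ^ m / exp y < 1 / Q \<and> y \<ge> 1) at_top" by (rule eventually_conj)
  then obtain y :: real where y: "y ^ m / exp y < 1 / Q" "y \<ge> 1"
    by (auto dest: eventually_happens)
  have "exp y \<le> (1 + y / c * T) ^ m" using bound[of "y / c"] y c by simp
  also have "\<dots> \<le> ((1 + T / c) * y) ^ m"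
    using y c T by (intro power_mono) (auto simp: algebra_simps divide_simps)
  also have "\<dots> = Q * y ^ m" by (simp add: Q_def power_mult_distrib)
  finally show False using y Q by (simp add: field_simps)
qed

lemma trace_class_imp_onb:
  assumes "trace_class \<mu> A"
  obtains J e where "l2_onb \<mu> J e"
  using assms unfolding trace_class_def hilbert_schmidt_def by blast

text \<open>The matrix estimates hold in every orthonormal basis, in particular in the one selected
  by \<open>SOME\<close>. The scalar \<open>z\<close> is pulled out of the minors, so one matrix
  serves all \<open>z\<close>.\<close>

theorem fredholm_det1_entire:
  assumes A: "trace_class \<mu> A"
  obtains a :: "nat \<Rightarrow> complex" and T where
    "\<And>z. (\<lambda>n. a n * z ^ n) sums fredholm_det1 \<mu> (\<lambda>f x. z * A f x)" "0 \<le> T"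
    "\<And>\<epsilon>. 0 < \<epsilon> \<Longrightarrow> \<exists>m. \<forall>x\<ge>0. cmod (fredholm_det1 \<mu> (\<lambda>f y. of_real x * A f y)) \<le> (1 + x * T) ^ m * exp (\<epsilon> * x)"
proof -
  define Je where "Je = (SOME (J, e). l2_onb \<mu> J e)"
  obtain J e where Je: "Je = (J, e)" by (cases Je)
  \<comment> \<open>The choice is meaningful because the Hilbert-Schmidt factors of \<open>A\<close>
    supply an orthonormal basis.\<close>
  have "\<exists>p. (case p of (J, e) \<Rightarrow> l2_onb \<mu> J e)" using trace_class_imp_onb[OF A] by blast
  then have "case Je of (J, e) \<Rightarrow> l2_onb \<mu> J e" unfolding Je_def by (rule someI_ex)
  then have onb: "l2_onb \<mu> J e" by (simp add: Je)
  define M where "M i j = l2_inner \<mu> (e i) (A (e j))" for i j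
  obtain b c :: "nat \<Rightarrow> nat \<Rightarrow> complex" and t T where
    lim: "\<And>i j. i \<in> J \<Longrightarrow> j \<in> J \<Longrightarrow> (\<lambda>m. \<Sum>k<m. b i k * c j k) \<longlonglongrightarrow> M i j" and
    b: "\<And>i m. i \<in> J \<Longrightarrow> (\<Sum>k<m. (cmod (b i k))\<^sup>2) \<le> t i" and
    c: "\<And>i m. i \<in> J \<Longrightarrow> (\<Sum>k<m. (cmod (c i k))\<^sup>2) \<le> t i" and
    T: "\<And>F. finite F \<Longrightarrow> F \<subseteq> J \<Longrightarrow> (\<Sum>i\<in>F. t i) \<le> T"
    unfolding M_def by (rule trace_class_matrix[OF A onb]) blast
  interpret dominated_minors J M t T
  proof
    show "cmod (minor M I) \<le> (\<Prod>i\<in>I. t i)" if "finite I" "I \<subseteq> J" for I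
      by (rule minor_bound[OF that(1) lim b c]) (use that in auto)
    show "0 \<le> t i" if "i \<in> J" for i using b[OF that, of 0] by simp
  qed (rule T)
  have fred: "fredholm_det1 \<mu> (\<lambda>f x. z * A f x) = minor_series J M z" for z
  proof -
    have "fredholm_det1 \<mu> (\<lambda>f x. z * A f x) = (\<Sum>\<^sub>\<infinity>I\<in>{I. finite I \<and> I \<subseteq> J}. minor (\<lambda>i j. z * M i j) I)"
      unfolding fredholm_det1_def Je_def[symmetric] Je by (simp add: minor_def M_def l2_inner_scale_right)
    then show ?thesis by (simp add: minor_scale minor_series_def)
  qed
  show thesis
  proof (rule that[of "minor_coeff J M" T])
    show "(\<lambda>n. minor_coeff J M n * z ^ n) sums fredholm_det1 \<mu> (\<lambda>f x. z * A f x)" for z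
      unfolding fred by (rule minor_series_sums)
    show "0 \<le> T" using T[of "{}"] by simp
    show "\<exists>m. \<forall>x\<ge>0. cmod (fredholm_det1 \<mu> (\<lambda>f y. of_real x * A f y)) \<le> (1 + x * T) ^ m * exp (\<epsilon> * x)"
      if "0 < \<epsilon>" for \<epsilon>
      unfolding fred using minor_series_growth[OF that] by blast
  qed
qed

section \<open>Counting measures\<close>

lemma rel_compact_subset: "A \<subseteq> B \<Longrightarrow> rel_compact B \<Longrightarrow> rel_compact (A :: 'e::t2_space set)"
  unfolding rel_compact_def
  using compact_Int_closed[of "closure B" "closure A"] closure_mono[of A B] by (simp add: Int_absorb1)

definition bounded_borel :: "'e::topological_space set \<Rightarrow> bool" where
  "bounded_borel B \<longleftrightarrow> B \<in> sets borel \<and> rel_compact B"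

lemma bounded_borelD [simp]:
  assumes "bounded_borel B" shows "B \<in> sets borel" "rel_compact B"
  using assms by (auto simp: bounded_borel_def)

lemma bounded_borel_subset:
  "bounded_borel B \<Longrightarrow> A \<subseteq> B \<Longrightarrow> A \<in> sets borel \<Longrightarrow> bounded_borel (A :: 'e::t2_space set)"
  using rel_compact_subset[of A B] by (simp add: bounded_borel_def del: bounded_borelD)

lemma bounded_borel_Int: "bounded_borel B \<Longrightarrow> A \<in> sets borel \<Longrightarrow> bounded_borel (B \<inter> A :: 'e::t2_space set)"
  by (rule bounded_borel_subset[of B]) auto

lemma bounded_borel_UN:
  assumes "finite I" "\<And>i. i \<in> I \<Longrightarrow> bounded_borel (B i :: 'e::t2_space set)"
  shows "bounded_borel (\<Union>i\<in>I. B i)"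
proof -
  let ?V = "\<Union>i\<in>I. closure (B i)"
  have V: "compact ?V"
    by (rule compact_UN[OF assms(1)]) (use assms(2) in \<open>simp add: bounded_borel_def rel_compact_def\<close>)
  have "(\<Union>i\<in>I. B i) \<subseteq> ?V" by (intro UN_mono closure_subset order_refl)
  then have "closure (\<Union>i\<in>I. B i) \<subseteq> ?V" using compact_imp_closed[OF V] by (rule closure_minimal)
  then have "closure (\<Union>i\<in>I. B i) = ?V \<inter> closure (\<Union>i\<in>I. B i)" by (rule inf.absorb_iff2[THEN iffD1, symmetric])
  moreover have "compact (?V \<inter> closure (\<Union>i\<in>I. B i))" using V closed_closure by (rule compact_Int_closed)
  ultimately have "rel_compact (\<Union>i\<in>I. B i)" unfolding rel_compact_def by (rule ssubst)
  moreover have "(\<Union>i\<in>I. B i) \<in> sets borel" using assms(2) by (intro sets.finite_UN[OF assms(1)]) simp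
  ultimately show ?thesis by (simp add: bounded_borel_def del: bounded_borelD)
qed

lemma radon_measure_finite:
  fixes \<nu> :: "'e::t2_space measure"
  assumes \<nu>: "radon_measure \<nu>" and B: "bounded_borel B"
  shows "emeasure \<nu> B < \<infinity>"
proof -
  have "emeasure \<nu> B \<le> emeasure \<nu> (closure B)"
    using \<nu> by (intro emeasure_mono closure_subset) (auto simp: radon_measure_def)
  also have "\<dots> < \<infinity>" using \<nu> B by (auto simp: radon_measure_def bounded_borel_def rel_compact_def simp del: bounded_borelD)
  finally show ?thesis .
qed

text \<open>The analogue of \<open>mult_at\<close> for sets. It is the true count only where the
  measure is finite, as on bounded Borel sets.\<close>

definition num_points :: "'e measure \<Rightarrow> 'e set \<Rightarrow> nat" where
  "num_points \<xi> B = nat \<lfloor>enn2real (emeasure \<xi> B)\<rfloor>"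

lemma counting_radon_radon: "counting_radon \<xi> \<Longrightarrow> radon_measure \<xi>"
  by (simp add: counting_radon_def)

lemma counting_radon_sets: "counting_radon \<xi> \<Longrightarrow> sets \<xi> = sets borel"
  by (simp add: counting_radon_def radon_measure_def)

lemma emeasure_eq_num_points:
  fixes \<xi> :: "'e::t2_space measure"
  assumes \<xi>: "counting_radon \<xi>" and B: "bounded_borel B"
  shows "emeasure \<xi> B = of_nat (num_points \<xi> B)"
proof -
  have "emeasure \<xi> B \<in> range of_nat \<union> {\<infinity>}" using \<xi> B by (auto simp: counting_radon_def)
  moreover have "emeasure \<xi> B < \<infinity>" by (rule radon_measure_finite[OF counting_radon_radon[OF \<xi>] B])
  ultimately obtain n :: nat where "emeasure \<xi> B = of_nat n" by auto
  then show ?thesis by (simp add: num_points_def ennreal_of_nat_eq_real_of_nat)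
qed

lemma bounded_borel_singleton [simp]: "bounded_borel {x :: 'e::t2_space}"
  by (simp add: bounded_borel_def rel_compact_def del: bounded_borelD)

text \<open>Small balls around a point without mass have measure below 1 inside \<open>R\<close>,
  hence 0 because the values are integers. Countably many basic open sets with null trace on
  \<open>R\<close> then cover \<open>R\<close>.\<close>

lemma null_of_no_atoms:
  fixes \<xi> :: "'e::{metric_space, second_countable_topology} measure"
  assumes \<xi>: "counting_radon \<xi>" and R: "bounded_borel R" and 0: "\<And>x. x \<in> R \<Longrightarrow> emeasure \<xi> {x} = 0"
  shows "emeasure \<xi> R = 0"
proof -
  have sets: "A \<in> sets \<xi>" if "A \<in> sets borel" for A using that counting_radon_sets[OF \<xi>] by simp
  obtain \<B> :: "'e set set" where \<B>: "countable \<B>" "topological_basis \<B>"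
    using ex_countable_basis by blast
  define \<N> where "\<N> = {U \<in> \<B>. emeasure \<xi> (R \<inter> U) = 0}"
  have open_\<B>: "open U" if "U \<in> \<B>" for U using that \<B>(2) topological_basis_open by blast
  have "R \<subseteq> (\<Union>U\<in>\<N>. R \<inter> U)"
  proof
    fix x assume x: "x \<in> R"
    define b where "b n = R \<inter> ball x (1 / Suc n)" for n :: nat
    have bb: "bounded_borel (b n)" for n unfolding b_def using R by (intro bounded_borel_Int) auto
    have "(\<lambda>n. emeasure \<xi> (b n)) \<longlonglongrightarrow> emeasure \<xi> (\<Inter>n. b n)"
    proof (rule Lim_emeasure_decseq)
      show "range b \<subseteq> sets \<xi>" using sets[OF bounded_borelD(1)[OF bb]] by blast
      show "decseq b" unfolding b_def
        by (intro decseq_SucI Int_mono subset_ball) (auto simp: field_simps)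
      show "emeasure \<xi> (b n) \<noteq> \<infinity>" for n using radon_measure_finite[OF counting_radon_radon[OF \<xi>] bb, of n] by simp
    qed
    moreover have "(\<Inter>n. b n) = {x}"
    proof (intro equalityI subsetI)
      fix y assume y: "y \<in> (\<Inter>n. b n)"
      have "dist x y = 0"
      proof (rule ccontr)
        assume "dist x y \<noteq> 0"
        then obtain n where "inverse (real (Suc n)) < dist x y" using reals_Archimedean[of "dist x y"] by auto
        with y show False by (auto simp: b_def field_simps dest: spec[of _ n])
      qed
      then show "y \<in> {x}" by simp
    qed (use x in \<open>auto simp: b_def\<close>)
    ultimately have "(\<lambda>n. emeasure \<xi> (b n)) \<longlonglongrightarrow> 0" using 0[OF x] by simp
    then have "eventually (\<lambda>n. emeasure \<xi> (b n) < 1) sequentially" by (rule order_tendstoD) simp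
    then obtain n where "emeasure \<xi> (b n) < 1" by (auto dest: eventually_happens)
    then have bn: "emeasure \<xi> (b n) = 0" using emeasure_eq_num_points[OF \<xi> bb[of n]] by (cases "num_points \<xi> (b n)") (auto simp: add_increasing)
    obtain U where U: "U \<in> \<B>" "x \<in> U" "U \<subseteq> ball x (1 / Suc n)"
      using topological_basisE[OF \<B>(2), of "ball x (1 / Suc n)" x] by auto
    have "emeasure \<xi> (R \<inter> U) \<le> emeasure \<xi> (b n)"
      using U sets[OF bounded_borelD(1)[OF bb]] by (intro emeasure_mono) (auto simp: b_def)
    then have "U \<in> \<N>" using U bn by (simp add: \<N>_def)
    then show "x \<in> (\<Union>U\<in>\<N>. R \<inter> U)" using U x by auto
  qed
  moreover have "(\<Union>U\<in>\<N>. R \<inter> U) \<in> null_sets \<xi>"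
  proof (rule null_sets_UN')
    show "countable \<N>" unfolding \<N>_def using \<B>(1) by simp
    fix U assume U: "U \<in> \<N>"
    then have "open U" using open_\<B> by (simp add: \<N>_def)
    then show "R \<inter> U \<in> null_sets \<xi>" using U R by (intro null_setsI sets) (auto simp: \<N>_def)
  qed
  ultimately have "R \<in> null_sets \<xi>" using R by (intro null_sets_subset[of "\<Union>U\<in>\<N>. R \<inter> U" \<xi> R] sets) auto
  then show ?thesis by auto
qed

text \<open>Every atom has mass at least 1, so \<open>B\<close> contains at most
  \<open>num_points \<xi> B\<close> of them, and what remains of \<open>B\<close> is null. This
  links \<open>config_prod\<close>, a product over atoms, to counts of sets.\<close>

theorem num_points_eq_sum_mult_at:
  fixes \<xi> :: "'e::{metric_space, second_countable_topology} measure"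
  assumes \<xi>: "counting_radon \<xi>" and B: "bounded_borel B"
  defines "A \<equiv> {x \<in> B. emeasure \<xi> {x} \<noteq> 0}"
  shows "finite A" "num_points \<xi> B = (\<Sum>x\<in>A. mult_at \<xi> x)"
proof -
  have sets: "S \<in> sets \<xi>" if "S \<in> sets borel" for S using that counting_radon_sets[OF \<xi>] by simp
  have mult: "emeasure \<xi> {x} = of_nat (mult_at \<xi> x)" for x
    using emeasure_eq_num_points[OF \<xi> bounded_borel_singleton, of x] by (simp add: mult_at_def num_points_def)
  have sum: "emeasure \<xi> G = of_nat (\<Sum>x\<in>G. mult_at \<xi> x)" if "finite G" for G
    using emeasure_eq_sum_singleton[of G \<xi>] that sets by (simp add: mult of_nat_sum)
  have "finite A \<and> card A \<le> num_points \<xi> B"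
  proof (rule finite_if_finite_subsets_card_bdd)
    fix G assume G: "G \<subseteq> A" "finite G"
    have "card G = (\<Sum>x\<in>G. 1)" by simp
    also have "\<dots> \<le> (\<Sum>x\<in>G. mult_at \<xi> x)"
    proof (rule sum_mono)
      fix x assume "x \<in> G"
      then have "emeasure \<xi> {x} \<noteq> 0" using G by (auto simp: A_def)
      then show "1 \<le> mult_at \<xi> x" by (simp add: mult Suc_le_eq)
    qed
    finally have "card G \<le> (\<Sum>x\<in>G. mult_at \<xi> x)" .
    moreover have "emeasure \<xi> G \<le> emeasure \<xi> B"
      using G B sets by (intro emeasure_mono) (auto simp: A_def)
    ultimately show "card G \<le> num_points \<xi> B"
      by (simp add: sum[OF G(2)] emeasure_eq_num_points[OF \<xi> B] del: of_nat_sum)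
  qed
  then show A: "finite A" by simp
  have A_borel: "A \<in> sets borel" using A by (simp add: sets.countable countable_finite)
  have bR: "bounded_borel (B - A)" by (rule bounded_borel_subset[OF B]) (use B A_borel in auto)
  have "emeasure \<xi> (B - A) = 0"
    by (rule null_of_no_atoms[OF \<xi> bR]) (auto simp: A_def)
  moreover have "emeasure \<xi> B = emeasure \<xi> A + emeasure \<xi> (B - A)"
  proof -
    have "A \<union> (B - A) = B" by (auto simp: A_def)
    moreover have "A \<in> sets \<xi>" "B - A \<in> sets \<xi>" using A_borel bR sets by auto
    ultimately show ?thesis using plus_emeasure[of A \<xi> "B - A"] by simp
  qed
  ultimately have "of_nat (num_points \<xi> B) = (of_nat (\<Sum>x\<in>A. mult_at \<xi> x) :: ennreal)"
    using sum[OF A] emeasure_eq_num_points[OF \<xi> B] by simp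
  then show "num_points \<xi> B = (\<Sum>x\<in>A. mult_at \<xi> x)" by (simp del: of_nat_sum)
qed

text \<open>One plus the test function is \<open>s\<close> on \<open>B\<close> and 1 elsewhere, so
  the generating functional becomes the generating function of a single count.\<close>

lemma config_prod_indicator:
  fixes \<xi> :: "'e::{metric_space, second_countable_topology} measure"
  assumes \<xi>: "counting_radon \<xi>" and B: "bounded_borel B" and s: "s \<noteq> 1"
  shows "config_prod \<xi> (\<lambda>x. (s - 1) * indicator B x) = s ^ num_points \<xi> B"
proof -
  have "{x. (s - 1) * indicator B x \<noteq> 0 \<and> emeasure \<xi> {x} \<noteq> 0} = {x \<in> B. emeasure \<xi> {x} \<noteq> 0}"
    using s by (auto simp: indicator_def)
  then have "config_prod \<xi> (\<lambda>x. (s - 1) * indicator B x) = (\<Prod>x\<in>{x \<in> B. emeasure \<xi> {x} \<noteq> 0}. s ^ mult_at \<xi> x)"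
    unfolding config_prod_def by (intro prod.cong) auto
  then show ?thesis
    by (simp add: power_sum num_points_eq_sum_mult_at[OF \<xi> B])
qed

section \<open>Power series of integer-valued random variables\<close>

lemma (in prob_space) prob_nat_sums:
  assumes "\<And>n::nat. {\<omega> \<in> space M. k \<omega> = n} \<in> events"
  shows "(\<lambda>n. prob {\<omega> \<in> space M. k \<omega> = n}) sums 1"
proof -
  let ?E = "\<lambda>n. {\<omega> \<in> space M. k \<omega> = n}"
  have "(\<lambda>n. prob (?E n)) sums prob (\<Union>n. ?E n)"
    using assms by (intro finite_measure_UNION) (auto simp: disjoint_family_on_def)
  also have "(\<Union>n. ?E n) = space M" by auto
  finally show ?thesis by (simp add: prob_space)
qed

text \<open>Sum and expectation are exchanged: for each outcome only the term with
  \<open>n = k \<omega>\<close> is nonzero, and for |s| at most 1 the norms integrate to at most the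
  summable point probabilities.\<close>

lemma (in prob_space) expectation_power_sums:
  fixes k :: "'a \<Rightarrow> nat" and s :: complex
  assumes meas: "\<And>n. {\<omega> \<in> space M. k \<omega> = n} \<in> events" and s: "norm s \<le> 1"
  shows "(\<lambda>n. of_real (prob {\<omega> \<in> space M. k \<omega> = n}) * s ^ n) sums (\<integral>\<omega>. s ^ k \<omega> \<partial>M)"
proof -
  let ?E = "\<lambda>n. {\<omega> \<in> space M. k \<omega> = n}"
  define f where "f n \<omega> = indicator (?E n) \<omega> *\<^sub>R s ^ n" for n \<omega>
  have f_eq: "f n \<omega> = (if n = k \<omega> then s ^ k \<omega> else 0)" if "\<omega> \<in> space M" for n \<omega>
    using that by (auto simp: f_def)
  have int: "integrable M (\<lambda>\<omega>. indicator (?E n) \<omega> :: real)" for n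
    using meas by (rule integrable_real_indicator) (simp add: emeasure_eq_measure)
  have E: "(\<integral>\<omega>. indicator (?E n) \<omega> \<partial>M) = prob (?E n)" for n
    using meas[of n] by (simp add: Int_absorb2 sets.sets_into_space)
  have "(\<lambda>n. \<integral>\<omega>. f n \<omega> \<partial>M) sums (\<integral>\<omega>. (\<Sum>n. f n \<omega>) \<partial>M)"
  proof (rule sums_integral)
    show "integrable M (f n)" for n
      unfolding f_def using int by (rule integrable_scaleR_left)
    show "AE \<omega> in M. summable (\<lambda>n. norm (f n \<omega>))"
    proof (rule AE_I2)
      fix \<omega> assume "\<omega> \<in> space M"
      then show "summable (\<lambda>n. norm (f n \<omega>))"
        by (intro summable_finite[of "{k \<omega>}"]) (auto simp: f_eq)
    qed
    have norm: "(\<integral>\<omega>. norm (f n \<omega>) \<partial>M) = prob (?E n) * norm s ^ n" for n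
    proof -
      have "(\<integral>\<omega>. norm (f n \<omega>) \<partial>M) = (\<integral>\<omega>. indicator (?E n) \<omega> * norm s ^ n \<partial>M)"
        by (rule Bochner_Integration.integral_cong[OF refl]) (simp add: f_def norm_power)
      then show ?thesis unfolding Bochner_Integration.integral_mult_left[OF int] E .
    qed
    show "summable (\<lambda>n. \<integral>\<omega>. norm (f n \<omega>) \<partial>M)"
      unfolding norm
    proof (rule summable_comparison_test')
      show "summable (\<lambda>n. prob (?E n))" using prob_nat_sums[OF meas] by (rule sums_summable)
      show "norm (prob (?E n) * norm s ^ n) \<le> prob (?E n)" if "0 \<le> n" for n
        using s by (simp add: mult_left_le power_le_one)
    qed
  qed
  moreover have "(\<integral>\<omega>. f n \<omega> \<partial>M) = of_real (prob (?E n)) * s ^ n" for n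
    unfolding f_def by (subst integral_scaleR_left[OF int]) (simp only: E scaleR_conv_of_real)
  moreover have "(\<integral>\<omega>. (\<Sum>n. f n \<omega>) \<partial>M) = (\<integral>\<omega>. s ^ k \<omega> \<partial>M)"
  proof (rule Bochner_Integration.integral_cong[OF refl])
    fix \<omega> assume "\<omega> \<in> space M"
    then show "(\<Sum>n. f n \<omega>) = s ^ k \<omega>"
      by (subst suminf_finite[of "{k \<omega>}"]) (auto simp: f_eq)
  qed
  ultimately show ?thesis by simp
qed

section \<open>Entire generating functions\<close>

text \<open>Agreement on the unit disc forces \<open>q\<close> to be the Taylor coefficients of
  \<open>F\<close> at 0, and the Taylor series of an entire function converges everywhere.\<close>

lemma power_series_eq_of_entire:
  fixes F :: "complex \<Rightarrow> complex" and q :: "nat \<Rightarrow> complex"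
  assumes F: "F holomorphic_on UNIV" and q: "\<And>s. norm s < 1 \<Longrightarrow> (\<lambda>n. q n * s ^ n) sums F s"
  shows "(\<lambda>n. q n * s ^ n) sums F s"
proof -
  define Q where "Q = Abs_fps q"
  \<comment> \<open>The point 1/2 merely shows that the radius of convergence is positive.\<close>
  have "conv_radius q \<ge> norm (1/2 :: complex)"
    by (rule conv_radius_geI) (rule sums_summable[OF q], simp)
  then have Q: "fps_conv_radius Q > 0"
    unfolding fps_conv_radius_def Q_def by (simp add: Abs_fps_inverse) (rule less_le_trans[rotated], auto)
  have ev: "eventually (\<lambda>s. eval_fps Q s = F s) (nhds 0)"
    unfolding eventually_nhds
    by (rule exI[of _ "ball 0 1"]) (use q in \<open>auto simp: eval_fps_def Q_def sums_iff\<close>)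
  have "q n = (deriv ^^ n) F 0 / fact n" for n
  proof -
    have "q n = fps_nth Q n" by (simp add: Q_def)
    also have "\<dots> = (deriv ^^ n) (eval_fps Q) 0 / fact n" by (rule fps_nth_conv_deriv[OF Q])
    also have "(deriv ^^ n) (eval_fps Q) 0 = (deriv ^^ n) F 0" by (rule higher_deriv_cong_ev[OF ev refl])
    finally show ?thesis .
  qed
  then show ?thesis
    using holomorphic_power_series[of F 0 "norm s + 1" s] holomorphic_on_subset[OF F] by simp
qed

lemma entire_of_sums:
  assumes "\<And>z :: complex. (\<lambda>n. a n * z ^ n) sums D z"
  shows "D holomorphic_on UNIV"
proof -
  have "D holomorphic_on ball 0 r" for r
    by (rule power_series_holomorphic[where a = a]) (use assms in simp)
  then have "D field_differentiable at z" for z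
    using holomorphic_on_imp_differentiable_at[of D "ball 0 (norm z + 1)" z] by simp
  then show ?thesis by (auto simp: holomorphic_on_def field_differentiable_at_within)
qed

text \<open>One-sided on purpose: nonnegative coefficients are asked of \<open>D\<close> and slow
  growth of \<open>D'\<close>; the reverse inequality comes from exchanging the two pairs of
  processes.\<close>

theorem exponential_rate_le:
  fixes D D' :: "complex \<Rightarrow> complex" and q :: "nat \<Rightarrow> real" and r r' T :: real
  assumes D: "\<And>z. (\<lambda>n. a n * z ^ n) sums D z" and D': "\<And>z. (\<lambda>n. a' n * z ^ n) sums D' z"
    and q: "\<And>s. norm s < 1 \<Longrightarrow> (\<lambda>n. of_real (q n) * s ^ n) sums D (s - 1)"
    and q_nonneg: "\<And>n. 0 \<le> q n" and q_sum: "q sums 1"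
    and eq: "\<And>s. norm s < 1 \<Longrightarrow> exp (of_real r * (s - 1)) * D (s - 1) = exp (of_real r' * (s - 1)) * D' (s - 1)"
    and T: "0 \<le> T"
    and growth: "\<And>\<epsilon>. 0 < \<epsilon> \<Longrightarrow> \<exists>m. \<forall>x\<ge>0. cmod (D' (of_real x)) \<le> (1 + x * T) ^ m * exp (\<epsilon> * x)"
  shows "r \<le> r'"
proof (rule ccontr)
  assume "\<not> r \<le> r'"
  define c where "c = r - r'"
  have c: "0 < c" using \<open>\<not> r \<le> r'\<close> by (simp add: c_def)
  have hol: "D holomorphic_on UNIV" "D' holomorphic_on UNIV" using D D' by (auto intro: entire_of_sums)
  have D'_eq: "D' z = exp (of_real c * z) * D z" for z
  \<comment> \<open>The hypothesis for |s| < 1 covers the disc of radius 1 about -1 in the variable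
    z = s - 1.\<close>
  proof (rule analytic_continuation_open[where f = D' and g = "\<lambda>z. exp (of_real c * z) * D z" and s = "ball (-1) 1" and s' = UNIV])
    show "D' holomorphic_on UNIV" by fact
    show "(\<lambda>z. exp (of_real c * z) * D z) holomorphic_on UNIV" using hol by (intro holomorphic_intros)
    fix z :: complex assume "z \<in> ball (-1) 1"
    then have "norm (z + 1) < 1" by (simp add: dist_norm norm_minus_commute add.commute)
    from eq[OF this] have "exp (of_real r * z) * D z = exp (of_real r' * z) * D' z" by simp
    then have "exp (- (of_real r' * z)) * (exp (of_real r' * z) * D' z) = exp (- (of_real r' * z)) * (exp (of_real r * z) * D z)"
      by simp
    then show "D' z = exp (of_real c * z) * D z"
      by (simp add: c_def algebra_simps flip: mult.assoc exp_add)
  qed auto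
  \<comment> \<open>Convergence of the probability series beyond the unit disc is inherited from
    \<open>D\<close> being entire; it makes s = 1 + x admissible.\<close>
  have D_series: "(\<lambda>n. of_real (q n) * s ^ n) sums D (s - 1)" for s :: complex
  proof (rule power_series_eq_of_entire)
    show "(\<lambda>s. D (s - 1)) holomorphic_on UNIV"
      using holomorphic_on_compose_gen[of "\<lambda>s. s - 1" UNIV D UNIV] hol by (simp add: o_def holomorphic_intros)
  qed (rule q)
  have D_ge: "1 \<le> cmod (D (of_real x))" if x: "0 \<le> x" for x
  proof -
    have "(\<lambda>n. of_real (q n * (1 + x) ^ n)) sums D (of_real x)"
      using D_series[of "of_real (1 + x)"] by simp
    then have "(\<lambda>n. q n * (1 + x) ^ n) sums Re (D (of_real x))" using sums_Re by fastforce
    moreover have "q n \<le> q n * (1 + x) ^ n" for n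
      using q_nonneg[of n] x by (simp add: mult_le_cancel_left1 one_le_power)
    ultimately have "1 \<le> Re (D (of_real x))" using q_sum by (meson sums_le)
    then show ?thesis using complex_Re_le_cmod[of "D (of_real x)"] by linarith
  qed
  \<comment> \<open>Half of the rate \<open>c\<close> is spent on the growth bound; the other half
    would then be polynomially bounded.\<close>
  obtain m where m: "\<And>x. 0 \<le> x \<Longrightarrow> cmod (D' (of_real x)) \<le> (1 + x * T) ^ m * exp (c / 2 * x)"
    using growth[of "c / 2"] c by auto
  show False
  proof (rule exp_not_polynomially_bounded[of "c / 2" T m])
    fix x :: real assume x: "0 \<le> x"
    have "exp (c / 2 * x) * exp (c / 2 * x) = exp (c * x)" by (simp flip: exp_add)
    also have "\<dots> \<le> exp (c * x) * cmod (D (of_real x))" using D_ge[OF x] by simp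
    also have "\<dots> = cmod (D' (of_real x))" by (simp add: D'_eq norm_mult)
    also have "\<dots> \<le> (1 + x * T) ^ m * exp (c / 2 * x)" by (rule m[OF x])
    finally show "exp (c / 2 * x) \<le> (1 + x * T) ^ m" by simp
  qed (use c T in auto)
qed

section \<open>Laws of point processes\<close>

lemma config_space_generator_subset:
  "{{\<xi>. counting_radon \<xi> \<and> emeasure \<xi> B \<in> A} | B A. B \<in> sets (borel :: 'e::topological_space measure)
      \<and> A \<in> sets (borel :: ennreal measure)} \<subseteq> Pow {\<xi> :: 'e measure. counting_radon \<xi>}"
  by auto

lemma space_config_space [simp]: "space (config_space :: 'e::topological_space measure measure) = {\<xi>. counting_radon \<xi>}"
  unfolding config_space_def by (rule space_measure_of[OF config_space_generator_subset])

lemma measurable_emeasure_config_space: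
  assumes "B \<in> sets borel"
  shows "(\<lambda>\<xi>. emeasure \<xi> B) \<in> borel_measurable (config_space :: 'e::topological_space measure measure)"
proof (rule measurableI)
  fix A :: "ennreal set" assume "A \<in> sets borel"
  then have "{\<xi>. counting_radon \<xi> \<and> emeasure \<xi> B \<in> A} \<in> sets (config_space :: 'e measure measure)"
    unfolding config_space_def sets_measure_of[OF config_space_generator_subset]
    using assms by (intro sigma_sets.Basic) blast
  then show "(\<lambda>\<xi>. emeasure \<xi> B) -` A \<inter> space config_space \<in> sets (config_space :: 'e measure measure)"
    by (simp add: vimage_def Int_def conj_commute)
qed simp

lemma measurable_config_spaceI:
  fixes f :: "'a \<Rightarrow> 'e::topological_space measure"
  assumes "\<And>x. x \<in> space M \<Longrightarrow> counting_radon (f x)"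
    and "\<And>B. B \<in> sets borel \<Longrightarrow> (\<lambda>x. emeasure (f x) B) \<in> borel_measurable M"
  shows "f \<in> measurable M config_space"
  unfolding config_space_def
proof (rule measurable_measure_of[OF config_space_generator_subset])
  show "f \<in> space M \<rightarrow> {\<xi>. counting_radon \<xi>}" using assms(1) by auto
  fix Y assume "Y \<in> {{\<xi>. counting_radon \<xi> \<and> emeasure \<xi> B \<in> A} | B A. B \<in> sets (borel :: 'e measure)
      \<and> A \<in> sets (borel :: ennreal measure)}"
  then obtain B A where Y: "Y = {\<xi>. counting_radon \<xi> \<and> emeasure \<xi> B \<in> A}"
    and B: "B \<in> sets borel" and A: "A \<in> sets borel" by blast
  have "f -` Y \<inter> space M = (\<lambda>x. emeasure (f x) B) -` A \<inter> space M"
    using assms(1) by (auto simp: Y)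
  also have "\<dots> \<in> sets M" by (rule measurable_sets[OF assms(2)[OF B] A])
  finally show "f -` Y \<inter> space M \<in> sets M" .
qed

text \<open>The index type is left free: pairs of a set and a count, indexed by themselves, give the
  generator \<open>count_events\<close>, while the unit type gives a single set.\<close>

definition count_event :: "'i set \<Rightarrow> ('i \<Rightarrow> 'e::topological_space set) \<Rightarrow> ('i \<Rightarrow> nat) \<Rightarrow> 'e measure set" where
  "count_event I B n = {\<xi>. counting_radon \<xi> \<and> (\<forall>i\<in>I. emeasure \<xi> (B i) = of_nat (n i))}"

lemma count_event_sets:
  assumes "finite I" "\<And>i. i \<in> I \<Longrightarrow> B i \<in> sets borel"
  shows "count_event I B n \<in> sets (config_space :: 'e::topological_space measure measure)"
proof -
  have "{\<xi> \<in> space config_space. emeasure \<xi> (B i) = of_nat (n i)} \<in> sets (config_space :: 'e measure measure)"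
    if "i \<in> I" for i
    using measurable_sets[OF measurable_emeasure_config_space[OF assms(2)[OF that]], of "{of_nat (n i)}"]
    by (simp add: vimage_def Int_def conj_commute)
  then have "{\<xi> \<in> space config_space. \<forall>i\<in>I. emeasure \<xi> (B i) = of_nat (n i)} \<in> sets (config_space :: 'e measure measure)"
    using assms(1) by (intro sets.sets_Collect_finite_All) auto
  then show ?thesis by (simp add: count_event_def)
qed

text \<open>Local compactness covers the space by relatively compact open sets; Lindelof extracts a
  countable cover, whose finite unions increase to the space.\<close>

lemma compact_exhaustion:
  assumes "locally_compact_space (euclidean :: 'e::{t2_space, second_countable_topology} topology)"
  obtains K :: "nat \<Rightarrow> 'e::{t2_space, second_countable_topology} set" where "\<And>n. bounded_borel (K n)" "incseq K" "(\<Union>n. K n) = UNIV"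
proof -
  define \<U> where "\<U> = {U :: 'e set. open U \<and> bounded_borel U}"
  have "\<Union>\<U> = UNIV"
  proof -
    have "\<exists>U\<in>\<U>. x \<in> U" for x
    proof -
      have "\<exists>U. open U \<and> (\<exists>C. compact C \<and> x \<in> U \<and> U \<subseteq> C)"
        using assms unfolding locally_compact_space_def by simp
      then obtain U C where UC: "open U" "compact C" "x \<in> U" "U \<subseteq> C" by blast
      have "bounded_borel C" using UC by (auto simp: bounded_borel_def rel_compact_def compact_imp_closed borel_compact)
      then have "bounded_borel U" using UC by (intro bounded_borel_subset[of C U]) auto
      then show ?thesis using UC by (auto simp: \<U>_def)
    qed
    then show ?thesis by blast
  qed
  obtain \<V> where \<V>: "\<V> \<subseteq> \<U>" "countable \<V>" "\<Union>\<V> = \<Union>\<U>"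
    by (rule Lindelof[of \<U>]) (auto simp: \<U>_def)
  have ne: "\<V> \<noteq> {}" using \<V>(3) \<open>\<Union>\<U> = UNIV\<close> by auto
  define K where "K n = (\<Union>i\<le>n. from_nat_into \<V> i)" for n
  show thesis
  proof (rule that[of K])
    show "bounded_borel (K n)" for n unfolding K_def
      using from_nat_into[OF ne] \<V>(1) by (intro bounded_borel_UN) (auto simp: \<U>_def)
    show "incseq K" unfolding K_def by (intro monoI UN_mono) auto
    have "(\<Union>n. K n) = (\<Union>i. from_nat_into \<V> i)" unfolding K_def by auto
    also have "\<dots> = \<Union>\<V>" using range_from_nat_into[OF ne \<V>(2)] by simp
    finally show "(\<Union>n. K n) = UNIV" using \<V>(3) \<open>\<Union>\<U> = UNIV\<close> by simp
  qed
qed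

text \<open>Using finite sets of pairs as index sets makes the intersection of two such events the
  event of the union, so stability under intersection is immediate.\<close>

definition count_events :: "'e::topological_space measure set set" where
  "count_events = {count_event F fst snd | F. finite F \<and> (\<forall>x\<in>F. bounded_borel (fst x))}"

text \<open>Counts of bounded Borel sets already generate the sigma-algebra: they are natural
  numbers, so countable unions of the generators suffice for them, and arbitrary Borel sets are
  reached along an exhaustion.\<close>

lemma sets_config_space_eq:
  assumes lc: "locally_compact_space (euclidean :: 'e::polish_space topology)"
  shows "sets (config_space :: 'e measure measure) = sigma_sets {\<xi>. counting_radon \<xi>} count_events"
proof
  let ?\<Omega> = "{\<xi> :: 'e measure. counting_radon \<xi>}"
  have sub: "count_events \<subseteq> Pow ?\<Omega>" by (auto simp: count_events_def count_event_def)
  let ?S = "sigma ?\<Omega> count_events"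
  have "id \<in> measurable ?S (config_space :: 'e measure measure)"
  proof (rule measurable_config_spaceI)
    show "counting_radon (id \<xi>)" if "\<xi> \<in> space ?S" for \<xi> using that space_measure_of[OF sub] by auto
    have bounded: "(\<lambda>\<xi>. emeasure \<xi> B) \<in> borel_measurable ?S" if B: "bounded_borel B" for B :: "'e set"
    proof (rule measurableI)
      fix A :: "ennreal set" assume "A \<in> sets borel"
      have "count_event {(B, n)} fst snd \<in> sets ?S" for n
      proof -
        have "count_event {(B, n)} fst snd \<in> count_events"
          unfolding count_events_def using B by (intro CollectI exI[of _ "{(B, n)}"]) auto
        then show ?thesis unfolding sets_measure_of[OF sub] by (rule sigma_sets.Basic)
      qed
      then have "(\<Union>n\<in>{n. of_nat n \<in> A}. count_event {(B, n)} fst snd) \<in> sets ?S" by blast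
      also have "(\<Union>n\<in>{n. of_nat n \<in> A}. count_event {(B, n)} fst snd) = (\<lambda>\<xi>. emeasure \<xi> B) -` A \<inter> space ?S"
        unfolding space_measure_of[OF sub] by (auto simp: count_event_def emeasure_eq_num_points[OF _ B])
      finally show "(\<lambda>\<xi>. emeasure \<xi> B) -` A \<inter> space ?S \<in> sets ?S" .
    qed simp
    fix B :: "'e set" assume B: "B \<in> sets borel"
    obtain K :: "nat \<Rightarrow> 'e set" where K: "\<And>n. bounded_borel (K n)" "incseq K" "(\<Union>n. K n) = UNIV"
      using compact_exhaustion[OF lc] by blast
    \<comment> \<open>On an unbounded set the count may be infinite; it is the supremum of the
      finite counts on \<open>K n\<close>.\<close>
    have "(\<lambda>\<xi>. SUP n. emeasure \<xi> (K n \<inter> B)) \<in> borel_measurable ?S"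
      by (intro borel_measurable_SUP bounded bounded_borel_Int K B) auto
    moreover have "(SUP n. emeasure \<xi> (K n \<inter> B)) = emeasure (id \<xi>) B" if "\<xi> \<in> space ?S" for \<xi>
    proof -
      have "counting_radon \<xi>" using that space_measure_of[OF sub] by auto
      then have "range (\<lambda>n. K n \<inter> B) \<subseteq> sets \<xi>" using K(1) B by (auto simp: counting_radon_sets)
      moreover have "incseq (\<lambda>n. K n \<inter> B)" using K(2) by (auto simp: mono_def)
      ultimately have "(SUP n. emeasure \<xi> (K n \<inter> B)) = emeasure \<xi> (\<Union>n. K n \<inter> B)" by (rule SUP_emeasure_incseq)
      also have "(\<Union>n. K n \<inter> B) = B" using K(3) by auto
      finally show ?thesis by simp
    qed
    ultimately show "(\<lambda>\<xi>. emeasure (id \<xi>) B) \<in> borel_measurable ?S"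
      by (simp cong: measurable_cong)
  qed
  then have "sets (config_space :: 'e measure measure) \<subseteq> sets ?S"
    using measurable_sets[of id ?S config_space] sets.sets_into_space[of _ "config_space :: 'e measure measure"]
    by (auto simp: space_measure_of[OF sub] Int_absorb2)
  then show "sets (config_space :: 'e measure measure) \<subseteq> sigma_sets ?\<Omega> count_events"
    by (simp add: sets_measure_of[OF sub])
  show "sigma_sets ?\<Omega> count_events \<subseteq> sets (config_space :: 'e measure measure)"
  proof (rule sets.sigma_sets_subset[of count_events config_space, simplified])
    show "count_events \<subseteq> sets (config_space :: 'e measure measure)"
      by (auto simp: count_events_def intro!: count_event_sets)
  qed
qed

text \<open>The events of \<open>count_events\<close> are stable under intersection and generate, so
  agreement on joint counts of finitely many bounded sets determines the law.\<close>

theorem config_law_eqI: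
  fixes X :: "'a \<Rightarrow> 'e::polish_space measure" and X' :: "'b \<Rightarrow> 'e measure"
  assumes lc: "locally_compact_space (euclidean :: 'e topology)"
    and M: "prob_space M" "prob_space M'"
    and X: "X \<in> measurable M config_space" "X' \<in> measurable M' config_space"
    and eq: "\<And>F. finite F \<Longrightarrow> (\<And>x. x \<in> F \<Longrightarrow> bounded_borel (fst x)) \<Longrightarrow>
      measure M {\<omega> \<in> space M. X \<omega> \<in> count_event F fst snd} = measure M' {\<omega> \<in> space M'. X' \<omega> \<in> count_event F fst snd}"
  shows "distr M config_space X = distr M' config_space X'"
proof (rule measure_eqI_generator_eq[where E = count_events and \<Omega> = "{\<xi>. counting_radon \<xi>}" and A = "\<lambda>_. {\<xi>. counting_radon \<xi>}"])
  interpret M: prob_space M by fact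
  interpret M': prob_space M' by fact
  show "Int_stable (count_events :: 'e measure set set)"
  proof (rule Int_stableI)
    fix a b :: "'e measure set" assume "a \<in> count_events" "b \<in> count_events"
    then obtain F G where FG: "a = count_event F fst snd" "finite F" "\<forall>x\<in>F. bounded_borel (fst x)"
      "b = count_event G fst snd" "finite G" "\<forall>x\<in>G. bounded_borel (fst x)"
      unfolding count_events_def by blast
    have "a \<inter> b = count_event (F \<union> G) fst snd" unfolding FG count_event_def by blast
    then show "a \<inter> b \<in> count_events" unfolding count_events_def using FG
      by (intro CollectI exI[of _ "F \<union> G"]) blast
  qed
  show "count_events \<subseteq> Pow {\<xi> :: 'e measure. counting_radon \<xi>}" by (auto simp: count_events_def count_event_def)
  show "sets (distr M config_space X) = sigma_sets {\<xi>. counting_radon \<xi>} count_events"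
    "sets (distr M' config_space X') = sigma_sets {\<xi>. counting_radon \<xi>} count_events"
    using sets_config_space_eq[OF lc] by simp_all
  fix Y :: "'e measure set" assume "Y \<in> count_events"
  then obtain F where F: "Y = count_event F fst snd" "finite F" "\<And>x. x \<in> F \<Longrightarrow> bounded_borel (fst x)"
    unfolding count_events_def by blast
  have Y: "Y \<in> sets config_space" unfolding F(1) using F by (intro count_event_sets) auto
  show "emeasure (distr M config_space X) Y = emeasure (distr M' config_space X') Y"
    using eq[OF F(2,3)] unfolding emeasure_distr[OF X(1) Y] emeasure_distr[OF X(2) Y]
      M.emeasure_eq_measure M'.emeasure_eq_measure
    by (simp add: F(1) vimage_def Int_def conj_commute)
next
  \<comment> \<open>The empty family imposes no condition, so the whole space is itself a generator
    and a constant sequence exhausts it.\<close>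
  have "{\<xi> :: 'e measure. counting_radon \<xi>} = count_event {} fst snd" by (simp add: count_event_def)
  then show "range (\<lambda>_. {\<xi> :: 'e measure. counting_radon \<xi>}) \<subseteq> count_events"
    unfolding count_events_def by blast
  interpret D: prob_space "distr M config_space X" by (rule prob_space.prob_space_distr[OF M(1) X(1)])
  show "emeasure (distr M config_space X) {\<xi>. counting_radon \<xi>} \<noteq> \<infinity>" by simp
qed simp

text \<open>\<open>measure_of\<close> returns the given set function only if it is countably
  additive, which has to be verified for the sum.\<close>

lemma emeasure_config_add:
  assumes \<xi>: "sets \<xi> = sets borel" and \<eta>: "sets \<eta> = sets borel" and B: "B \<in> sets borel"
  shows "emeasure (config_add \<xi> \<eta>) B = emeasure \<xi> B + emeasure \<eta> B"
  unfolding config_add_def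
proof (rule emeasure_measure_of_sigma)
  show "sigma_algebra UNIV (sets borel)" using sets.sigma_algebra_axioms[of borel] by simp
  show "positive (sets borel) (\<lambda>B. emeasure \<xi> B + emeasure \<eta> B)" by (simp add: positive_def)
  show "countably_additive (sets borel) (\<lambda>B. emeasure \<xi> B + emeasure \<eta> B)"
  proof (rule countably_additiveI)
    fix A :: "nat \<Rightarrow> 'a set" assume A: "range A \<subseteq> sets borel" "disjoint_family A"
    have "(\<Sum>i. emeasure \<xi> (A i) + emeasure \<eta> (A i)) = (\<Sum>i. emeasure \<xi> (A i)) + (\<Sum>i. emeasure \<eta> (A i))"
      by (rule suminf_add[symmetric]) auto
    then show "(\<Sum>i. emeasure \<xi> (A i) + emeasure \<eta> (A i)) = emeasure \<xi> (\<Union> (range A)) + emeasure \<eta> (\<Union> (range A))"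
      using A \<xi> \<eta> by (simp add: suminf_emeasure)
  qed
qed (rule B)

lemma counting_radon_config_add:
  fixes \<xi> \<eta> :: "'e::t2_space measure"
  assumes \<xi>: "counting_radon \<xi>" and \<eta>: "counting_radon \<eta>"
  shows "counting_radon (config_add \<xi> \<eta>)"
proof -
  have sets: "sets (config_add \<xi> \<eta>) = sets borel"
    unfolding config_add_def using sets.sigma_sets_eq[of borel] by simp
  note add = emeasure_config_add[OF counting_radon_sets[OF \<xi>] counting_radon_sets[OF \<eta>]]
  have "emeasure (config_add \<xi> \<eta>) C < \<infinity>" if "compact C" for C
    using that \<xi> \<eta> by (subst add) (auto simp: counting_radon_def radon_measure_def borel_compact)
  moreover have "emeasure (config_add \<xi> \<eta>) B \<in> range of_nat \<union> {\<infinity>}" if B: "B \<in> sets borel" for B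
  proof -
    have "emeasure \<xi> B \<in> range of_nat \<union> {\<infinity>}" "emeasure \<eta> B \<in> range of_nat \<union> {\<infinity>}"
      using \<xi> \<eta> B by (auto simp: counting_radon_def)
    then show ?thesis unfolding add[OF B] by (auto simp flip: of_nat_add)
  qed
  ultimately show ?thesis using sets by (simp add: counting_radon_def radon_measure_def)
qed

lemma config_add_measurable:
  fixes X Y :: "'a \<Rightarrow> 'e::t2_space measure"
  assumes X: "X \<in> measurable M config_space" and Y: "Y \<in> measurable M config_space"
  shows "(\<lambda>\<omega>. config_add (X \<omega>) (Y \<omega>)) \<in> measurable M config_space"
proof (rule measurable_config_spaceI)
  have c: "counting_radon (X \<omega>)" "counting_radon (Y \<omega>)" if "\<omega> \<in> space M" for \<omega>
    using measurable_space[OF X that] measurable_space[OF Y that] by auto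
  show "counting_radon (config_add (X \<omega>) (Y \<omega>))" if "\<omega> \<in> space M" for \<omega>
    using c[OF that] by (rule counting_radon_config_add)
  fix B :: "'e set" assume B: "B \<in> sets borel"
  have "(\<lambda>\<omega>. emeasure (X \<omega>) B + emeasure (Y \<omega>) B) \<in> borel_measurable M"
    using measurable_compose[OF X measurable_emeasure_config_space[OF B]]
      measurable_compose[OF Y measurable_emeasure_config_space[OF B]] by simp
  then show "(\<lambda>\<omega>. emeasure (config_add (X \<omega>) (Y \<omega>)) B) \<in> borel_measurable M"
    by (rule measurable_cong[THEN iffD2, rotated])
       (simp add: emeasure_config_add[OF counting_radon_sets[OF c(1)] counting_radon_sets[OF c(2)] B])
qed

section \<open>Superposition and Poisson processes\<close>

definition count_prob :: "'a measure \<Rightarrow> ('a \<Rightarrow> 'e::topological_space measure) \<Rightarrow> 'i set \<Rightarrow> ('i \<Rightarrow> 'e set) \<Rightarrow> ('i \<Rightarrow> nat) \<Rightarrow> real" where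
  "count_prob M X I B n = measure M {\<omega> \<in> space M. X \<omega> \<in> count_event I B n}"

lemma measurable_count_event:
  assumes "X \<in> measurable M config_space" "finite I" "\<And>i. i \<in> I \<Longrightarrow> bounded_borel (B i)"
  shows "{\<omega> \<in> space M. X \<omega> \<in> count_event I B n} \<in> sets M"
  using measurable_sets[OF assms(1) count_event_sets[of I B n]] assms(2,3)
  by (simp add: vimage_def Int_def conj_commute)

text \<open>The event is split by the counts \<open>m\<close> of the first summand. Members of the
  dependent product are fixed outside \<open>I\<close>, so distinct \<open>m\<close> give disjoint
  events, and independence factors each of them.\<close>

lemma count_prob_config_add:
  fixes X Y :: "'a \<Rightarrow> 'e::polish_space measure"
  assumes M: "prob_space M" and indep: "prob_space.indep_var M config_space X config_space Y"
    and X: "X \<in> measurable M config_space" and Y: "Y \<in> measurable M config_space"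
    and I: "finite I" and B: "\<And>i. i \<in> I \<Longrightarrow> bounded_borel (B i)"
  shows "count_prob M (\<lambda>\<omega>. config_add (X \<omega>) (Y \<omega>)) I B n =
    (\<Sum>m\<in>(\<Pi>\<^sub>E i\<in>I. {..n i}). count_prob M X I B m * count_prob M Y I B (\<lambda>i. n i - m i))"
proof -
  interpret prob_space M by fact
  let ?E = "\<lambda>m. {\<omega> \<in> space M. X \<omega> \<in> count_event I B m \<and> Y \<omega> \<in> count_event I B (\<lambda>i. n i - m i)}"
  let ?D = "\<Pi>\<^sub>E i\<in>I. {..n i}"
  have c: "counting_radon (X \<omega>)" "counting_radon (Y \<omega>)" if "\<omega> \<in> space M" for \<omega>
    using measurable_space[OF X that] measurable_space[OF Y that] by auto
  have add: "emeasure (config_add (X \<omega>) (Y \<omega>)) (B i) = emeasure (X \<omega>) (B i) + emeasure (Y \<omega>) (B i)"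
    if "\<omega> \<in> space M" "i \<in> I" for \<omega> i
    using c[OF that(1)] B[OF that(2)] by (intro emeasure_config_add counting_radon_sets) auto
  have "{\<omega> \<in> space M. config_add (X \<omega>) (Y \<omega>) \<in> count_event I B n} = (\<Union>m\<in>?D. ?E m)"
  proof (intro equalityI subsetI)
    fix \<omega> assume "\<omega> \<in> {\<omega> \<in> space M. config_add (X \<omega>) (Y \<omega>) \<in> count_event I B n}"
    then have \<omega>: "\<omega> \<in> space M" and eq: "\<And>i. i \<in> I \<Longrightarrow> emeasure (X \<omega>) (B i) + emeasure (Y \<omega>) (B i) = of_nat (n i)"
      using add by (auto simp: count_event_def)
    define m where "m = (\<lambda>i\<in>I. num_points (X \<omega>) (B i))"
    have Xm: "emeasure (X \<omega>) (B i) = of_nat (m i)" if "i \<in> I" for i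
      using emeasure_eq_num_points[OF c(1)[OF \<omega>] B[OF that]] that by (simp add: m_def)
    have nm: "n i = m i + num_points (Y \<omega>) (B i)" if "i \<in> I" for i
    proof -
      have "of_nat (n i) = (of_nat (m i + num_points (Y \<omega>) (B i)) :: ennreal)"
        using eq[OF that] Xm[OF that] emeasure_eq_num_points[OF c(2)[OF \<omega>] B[OF that]] by simp
      then show ?thesis by (simp only: of_nat_eq_iff)
    qed
    have "m \<in> ?D" using nm by (intro PiE_I) (auto simp: m_def)
    moreover have "\<omega> \<in> ?E m"
      using \<omega> c[OF \<omega>] Xm nm emeasure_eq_num_points[OF c(2)[OF \<omega>] B] by (simp add: count_event_def)
    ultimately show "\<omega> \<in> (\<Union>m\<in>?D. ?E m)" by blast
  next
    fix \<omega> assume "\<omega> \<in> (\<Union>m\<in>?D. ?E m)"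
    then obtain m where m: "m \<in> ?D" and \<omega>: "\<omega> \<in> ?E m" by blast
    have "emeasure (config_add (X \<omega>) (Y \<omega>)) (B i) = of_nat (n i)" if i: "i \<in> I" for i
    proof -
      have "m i \<le> n i" using m i by auto
      then have "of_nat (m i) + of_nat (n i - m i) = (of_nat (n i) :: ennreal)" by (simp flip: of_nat_add)
      then show ?thesis using \<omega> i by (simp add: add count_event_def)
    qed
    then show "\<omega> \<in> {\<omega> \<in> space M. config_add (X \<omega>) (Y \<omega>) \<in> count_event I B n}"
      using \<omega> counting_radon_config_add[OF c] by (simp add: count_event_def)
  qed
  then have "count_prob M (\<lambda>\<omega>. config_add (X \<omega>) (Y \<omega>)) I B n = prob (\<Union>m\<in>?D. ?E m)"
    by (simp add: count_prob_def)
  also have "\<dots> = (\<Sum>m\<in>?D. prob (?E m))"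
  proof (rule finite_measure_finite_Union)
    show "finite ?D" using I by (intro finite_PiE) auto
    have "?E m \<in> events" for m
    proof -
      have "?E m = {\<omega> \<in> space M. X \<omega> \<in> count_event I B m} \<inter> {\<omega> \<in> space M. Y \<omega> \<in> count_event I B (\<lambda>i. n i - m i)}"
        by auto
      then show ?thesis
        by (simp only: sets.Int measurable_count_event[OF X I B] measurable_count_event[OF Y I B])
    qed
    then show "?E ` ?D \<subseteq> events" by blast
    show "disjoint_family_on ?E ?D"
      unfolding disjoint_family_on_def
    proof (intro ballI impI)
      fix m m' assume m: "m \<in> ?D" "m' \<in> ?D" "m \<noteq> m'"
      then obtain i where "i \<in> I" "m i \<noteq> m' i" using PiE_ext[OF m(1,2)] by blast
      then show "?E m \<inter> ?E m' = {}" by (auto simp: count_event_def)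
    qed
  qed
  also have "\<dots> = (\<Sum>m\<in>?D. count_prob M X I B m * count_prob M Y I B (\<lambda>i. n i - m i))"
  proof (rule sum.cong[OF refl])
    fix m
    have "prob ((\<lambda>\<omega>. (X \<omega>, Y \<omega>)) -` (count_event I B m \<times> count_event I B (\<lambda>i. n i - m i)) \<inter> space M) =
      prob (X -` count_event I B m \<inter> space M) * prob (Y -` count_event I B (\<lambda>i. n i - m i) \<inter> space M)"
      using I B by (intro indep_varD[OF indep] count_event_sets) auto
    then show "prob (?E m) = count_prob M X I B m * count_prob M Y I B (\<lambda>i. n i - m i)"
      by (simp add: count_prob_def vimage_def Int_def conj_commute conj_left_commute)
  qed
  finally show ?thesis .
qed

text \<open>Induction on the total count: the zero term carries a nonzero coefficient, and all other
  terms involve \<open>q\<close> and \<open>q'\<close> at smaller totals. The congruence hypotheses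
  are there because members of the dependent product are \<open>undefined\<close> outside
  \<open>I\<close>, where \<open>n i - m i\<close> means nothing.\<close>

lemma deconvolution_unique:
  fixes p q q' :: "('i \<Rightarrow> nat) \<Rightarrow> real"
  assumes I: "finite I" and p0: "p (\<lambda>i\<in>I. 0) \<noteq> 0"
    and eq: "\<And>n. (\<Sum>m\<in>(\<Pi>\<^sub>E i\<in>I. {..n i}). p m * q (\<lambda>i. n i - m i)) = (\<Sum>m\<in>(\<Pi>\<^sub>E i\<in>I. {..n i}). p m * q' (\<lambda>i. n i - m i))"
    and cong: "\<And>m n. (\<And>i. i \<in> I \<Longrightarrow> m i = n i) \<Longrightarrow> q m = q n" "\<And>m n. (\<And>i. i \<in> I \<Longrightarrow> m i = n i) \<Longrightarrow> q' m = q' n"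
  shows "q n = q' n"
proof (induction "\<Sum>i\<in>I. n i" arbitrary: n rule: less_induct)
  case (less n)
  let ?D = "\<Pi>\<^sub>E i\<in>I. {..n i}"
  let ?z = "\<lambda>i\<in>I. 0 :: nat"
  have fin: "finite ?D" using I by (intro finite_PiE) auto
  have z: "?z \<in> ?D" by auto
  have rest: "p m * q (\<lambda>i. n i - m i) = p m * q' (\<lambda>i. n i - m i)" if m: "m \<in> ?D - {?z}" for m
  proof -
    obtain j where j: "j \<in> I" "m j \<noteq> 0"
    proof (rule ccontr)
      assume "\<not> thesis"
      with that have "\<And>i. i \<in> I \<Longrightarrow> m i = 0" by blast
      then have "m = ?z" using m by (intro PiE_ext[of m I _ ?z]) auto
      with m show False by simp
    qed
    have "m j \<le> n j" using m j by auto
    then have "n j - m j < n j" using j by linarith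
    then have "(\<Sum>i\<in>I. n i - m i) < (\<Sum>i\<in>I. n i)"
      using I j by (intro sum_strict_mono_ex1) auto
    then show ?thesis using less.hyps by simp
  qed
  have "(\<Sum>m\<in>?D. p m * q (\<lambda>i. n i - m i)) = p ?z * q (\<lambda>i. n i - ?z i) + (\<Sum>m\<in>?D - {?z}. p m * q (\<lambda>i. n i - m i))"
    by (rule sum.remove[OF fin z])
  moreover have "(\<Sum>m\<in>?D. p m * q' (\<lambda>i. n i - m i)) = p ?z * q' (\<lambda>i. n i - ?z i) + (\<Sum>m\<in>?D - {?z}. p m * q' (\<lambda>i. n i - m i))"
    by (rule sum.remove[OF fin z])
  moreover have "(\<Sum>m\<in>?D - {?z}. p m * q (\<lambda>i. n i - m i)) = (\<Sum>m\<in>?D - {?z}. p m * q' (\<lambda>i. n i - m i))"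
    by (rule sum.cong[OF refl rest])
  ultimately have "p ?z * q (\<lambda>i. n i - ?z i) = p ?z * q' (\<lambda>i. n i - ?z i)" using eq[of n] by linarith
  then have "q (\<lambda>i. n i - ?z i) = q' (\<lambda>i. n i - ?z i)" using p0 by simp
  moreover have "q (\<lambda>i. n i - ?z i) = q n" by (rule cong) simp
  moreover have "q' (\<lambda>i. n i - ?z i) = q' n" by (rule cong) simp
  ultimately show ?case by simp
qed

lemma poisson_pp_intensityD:
  fixes N :: "'a \<Rightarrow> 'e::topological_space measure" and k :: nat
  assumes "poisson_pp_intensity M N \<nu>"
  shows "prob_space M" "N \<in> measurable M config_space" "radon_measure \<nu>"
    and "bounded_borel B \<Longrightarrow> measure M {\<omega> \<in> space M. emeasure (N \<omega>) B = of_nat n} =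
      exp (- enn2real (emeasure \<nu> B)) * enn2real (emeasure \<nu> B) ^ n / fact n"
    and "(\<And>i. i < k \<Longrightarrow> bounded_borel (D i)) \<Longrightarrow> disjoint_family_on D {..<k} \<Longrightarrow>
      prob_space.indep_vars M (\<lambda>_. borel) (\<lambda>i \<omega>. emeasure (N \<omega>) (D i)) {..<k}"
proof -
  show "prob_space M" "N \<in> measurable M config_space" "radon_measure \<nu>"
    using assms by (simp_all add: poisson_pp_intensity_def point_process_def)
  have "\<forall>B. B \<in> sets borel \<and> rel_compact B \<longrightarrow>
      (\<forall>n::nat. measure M {\<omega>\<in>space M. emeasure (N \<omega>) B = of_nat n} =
        exp (- enn2real (emeasure \<nu> B)) * enn2real (emeasure \<nu> B) ^ n / fact n)"
    using assms[unfolded poisson_pp_intensity_def, THEN conjunct2, THEN conjunct2, THEN conjunct2] .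
  then show "measure M {\<omega> \<in> space M. emeasure (N \<omega>) B = of_nat n} =
      exp (- enn2real (emeasure \<nu> B)) * enn2real (emeasure \<nu> B) ^ n / fact n" if "bounded_borel B"
    using that unfolding bounded_borel_def by blast
  have "\<forall>(k::nat) (B::nat \<Rightarrow> 'e set).
      (\<forall>i<k. B i \<in> sets borel \<and> rel_compact (B i)) \<and> disjoint_family_on B {..<k} \<longrightarrow>
      prob_space.indep_vars M (\<lambda>_. borel) (\<lambda>i \<omega>. emeasure (N \<omega>) (B i)) {..<k}"
    using assms[unfolded poisson_pp_intensity_def, THEN conjunct2, THEN conjunct2, THEN conjunct1] .
  from this[rule_format, of k D]
  show "prob_space.indep_vars M (\<lambda>_. borel) (\<lambda>i \<omega>. emeasure (N \<omega>) (D i)) {..<k}"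
    if "\<And>i. i < k \<Longrightarrow> bounded_borel (D i)" "disjoint_family_on D {..<k}"
    using that unfolding bounded_borel_def by simp
qed

text \<open>No points in the union of the \<open>B i\<close> means none in each of them, and this
  void probability is an exponential of a finite number.\<close>

lemma poisson_count_prob_zero:
  fixes N :: "'a \<Rightarrow> 'e::polish_space measure"
  assumes N: "poisson_pp_intensity M N \<nu>" and I: "finite I" and B: "\<And>i. i \<in> I \<Longrightarrow> bounded_borel (B i)"
  shows "0 < count_prob M N I B (\<lambda>i\<in>I. 0)"
proof -
  interpret prob_space M by (rule poisson_pp_intensityD(1)[OF N])
  note X = poisson_pp_intensityD(2)[OF N]
  let ?U = "\<Union>i\<in>I. B i"
  have U: "bounded_borel ?U" using I B by (rule bounded_borel_UN)
  have "0 < prob {\<omega> \<in> space M. emeasure (N \<omega>) ?U = of_nat 0}"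
    unfolding poisson_pp_intensityD(4)[OF N U] by simp
  also have "\<dots> \<le> prob {\<omega> \<in> space M. N \<omega> \<in> count_event I B (\<lambda>i\<in>I. 0)}"
  proof (rule finite_measure_mono)
    show "{\<omega> \<in> space M. N \<omega> \<in> count_event I B (\<lambda>i\<in>I. 0)} \<in> events"
      by (rule measurable_count_event[OF X I B])
    show "{\<omega> \<in> space M. emeasure (N \<omega>) ?U = of_nat 0} \<subseteq> {\<omega> \<in> space M. N \<omega> \<in> count_event I B (\<lambda>i\<in>I. 0)}"
    proof
      fix \<omega> assume "\<omega> \<in> {\<omega> \<in> space M. emeasure (N \<omega>) ?U = of_nat 0}"
      then have \<omega>: "\<omega> \<in> space M" and 0: "emeasure (N \<omega>) ?U = 0" by auto
      have c: "counting_radon (N \<omega>)" using measurable_space[OF X \<omega>] by simp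
      have "emeasure (N \<omega>) (B i) = 0" if "i \<in> I" for i
      proof -
        have "emeasure (N \<omega>) (B i) \<le> emeasure (N \<omega>) ?U"
          using that bounded_borelD(1)[OF U] counting_radon_sets[OF c] by (intro emeasure_mono) auto
        then show ?thesis using 0 by simp
      qed
      then show "\<omega> \<in> {\<omega> \<in> space M. N \<omega> \<in> count_event I B (\<lambda>i\<in>I. 0)}"
        using c \<omega> by (simp add: count_event_def)
    qed
  qed
  finally show ?thesis by (simp add: count_prob_def)
qed

section \<open>Joint counts of a Poisson process through atoms\<close>

lemma of_nat_valued_law:
  fixes Y :: "'a \<Rightarrow> ennreal"
  assumes M: "prob_space M" and Y: "Y \<in> borel_measurable M"
    and nat: "\<And>\<omega>. \<omega> \<in> space M \<Longrightarrow> Y \<omega> \<in> range of_nat" and A: "A \<in> sets borel"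
  shows "emeasure (distr M borel Y) A =
    (\<integral>\<^sup>+n. ennreal (measure M {\<omega> \<in> space M. Y \<omega> = of_nat n}) \<partial>count_space {n. of_nat n \<in> A})"
proof -
  interpret prob_space M by fact
  let ?E = "\<lambda>n. {\<omega> \<in> space M. Y \<omega> = of_nat n}"
  have E: "?E n \<in> events" for n
    using measurable_sets[OF Y, of "{of_nat n}"] by (simp add: vimage_def Int_def conj_commute)
  have "emeasure (distr M borel Y) A = emeasure M (Y -` A \<inter> space M)" by (rule emeasure_distr[OF Y A])
  also have "Y -` A \<inter> space M = (\<Union>n\<in>{n. of_nat n \<in> A}. ?E n)"
  proof (intro equalityI subsetI)
    fix \<omega> assume \<omega>: "\<omega> \<in> Y -` A \<inter> space M"
    then obtain n where "Y \<omega> = of_nat n" using nat by blast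
    then show "\<omega> \<in> (\<Union>n\<in>{n. of_nat n \<in> A}. ?E n)" using \<omega> by auto
  qed auto
  also have "emeasure M \<dots> = (\<integral>\<^sup>+n. emeasure M (?E n) \<partial>count_space {n. of_nat n \<in> A})"
    using E by (intro emeasure_UN_countable) (auto simp: disjoint_family_on_def)
  finally show ?thesis by (simp only: emeasure_eq_measure)
qed

lemma distr_eq_of_nat_valued:
  fixes Y :: "'a \<Rightarrow> ennreal" and Y' :: "'b \<Rightarrow> ennreal"
  assumes M: "prob_space M" "prob_space M'" and Y: "Y \<in> borel_measurable M" "Y' \<in> borel_measurable M'"
    and nat: "\<And>\<omega>. \<omega> \<in> space M \<Longrightarrow> Y \<omega> \<in> range of_nat" "\<And>\<omega>. \<omega> \<in> space M' \<Longrightarrow> Y' \<omega> \<in> range of_nat"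
    and eq: "\<And>n. measure M {\<omega> \<in> space M. Y \<omega> = of_nat n} = measure M' {\<omega> \<in> space M'. Y' \<omega> = of_nat n}"
  shows "distr M borel Y = distr M' borel Y'"
proof (rule measure_eqI)
  fix A assume "A \<in> sets (distr M borel Y)"
  then have A: "A \<in> sets borel" by simp
  show "emeasure (distr M borel Y) A = emeasure (distr M' borel Y') A"
    by (simp only: of_nat_valued_law[OF M(1) Y(1) nat(1) A] of_nat_valued_law[OF M(2) Y(2) nat(2) A] eq)
qed simp

text \<open>A numbering of the subsets of \<open>I\<close>: a subset stands for the points lying in
  exactly those \<open>B i\<close> with \<open>i\<close> in it. It depends on \<open>I\<close>
  alone, so both processes are compared on the same atoms.\<close>

definition atom_index :: "'i set \<Rightarrow> nat \<Rightarrow> 'i set" where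
  "atom_index I = (SOME h. bij_betw h {..<card (Pow I)} (Pow I))"

text \<open>The atoms of the finite algebra generated by the sets \<open>B i\<close>, with the one outside all of them
replaced by the empty set to keep every atom relatively compact. They are numbered because
independence is only postulated for families of sets indexed by natural numbers.\<close>

definition atom :: "'i set \<Rightarrow> ('i \<Rightarrow> 'e set) \<Rightarrow> nat \<Rightarrow> 'e set" where
  "atom I B j = (\<Union>i\<in>I. B i) - (\<Union>i\<in>I. if i \<in> atom_index I j then - B i else B i)"

text \<open>The joint count event read on vectors: \<open>v j\<close> stands for the number of
  points in atom \<open>j\<close>, and the count of \<open>B i\<close> is the sum over the atoms
  inside \<open>B i\<close>.\<close>

definition atom_event :: "'i set \<Rightarrow> ('i \<Rightarrow> nat) \<Rightarrow> (nat \<Rightarrow> ennreal) set" where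
  "atom_event I n = {v \<in> space (\<Pi>\<^sub>M j\<in>{..<card (Pow I)}. borel).
    \<forall>i\<in>I. (\<Sum>j\<in>{j \<in> {..<card (Pow I)}. i \<in> atom_index I j}. v j) = of_nat (n i)}"

lemma atom_index_bij:
  assumes "finite I"
  shows "bij_betw (atom_index I) {..<card (Pow I)} (Pow I)"
proof -
  have "\<exists>h. bij_betw h {..<card (Pow I)} (Pow I)"
    using ex_bij_betw_nat_finite[of "Pow I"] assms by (simp add: lessThan_atLeast0)
  then show ?thesis unfolding atom_index_def by (rule someI_ex)
qed

lemma mem_atom_iff:
  assumes "finite I" "j < card (Pow I)"
  shows "x \<in> atom I B j \<longleftrightarrow> x \<in> (\<Union>i\<in>I. B i) \<and> atom_index I j = {i \<in> I. x \<in> B i}"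
proof -
  have "atom_index I j \<subseteq> I" using bij_betwE[OF atom_index_bij[OF assms(1)]] assms(2) by blast
  then show ?thesis unfolding atom_def by (auto split: if_splits)
qed

lemma bounded_borel_atom:
  fixes B :: "'i \<Rightarrow> 'e::t2_space set"
  assumes I: "finite I" and B: "\<And>i. i \<in> I \<Longrightarrow> bounded_borel (B i)"
  shows "bounded_borel (atom I B j)"
proof (rule bounded_borel_subset[OF bounded_borel_UN[of I B]])
  have "(if i \<in> atom_index I j then - B i else B i) \<in> sets borel" if "i \<in> I" for i
    using bounded_borelD(1)[OF B[OF that]] by (simp add: borel_comp)
  then show "atom I B j \<in> sets borel" unfolding atom_def using bounded_borelD(1)[OF B]
    by (intro sets.Diff sets.finite_UN[OF I]) blast+
  show "atom I B j \<subseteq> (\<Union>i\<in>I. B i)" by (auto simp: atom_def)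
qed (rule I, rule B)

lemma disjoint_atoms:
  assumes "finite I"
  shows "disjoint_family_on (atom I B) {..<card (Pow I)}"
  unfolding disjoint_family_on_def
proof (intro ballI impI)
  fix j j' assume j: "j \<in> {..<card (Pow I)}" "j' \<in> {..<card (Pow I)}" "j \<noteq> j'"
  then have "atom_index I j \<noteq> atom_index I j'"
    using atom_index_bij[OF assms] by (auto simp: bij_betw_def dest: inj_onD)
  then show "atom I B j \<inter> atom I B j' = {}" using j assms by (auto simp: mem_atom_iff)
qed

lemma emeasure_sum_atoms:
  fixes B :: "'i \<Rightarrow> 'e::t2_space set"
  assumes \<xi>: "counting_radon \<xi>" and I: "finite I" and B: "\<And>i. i \<in> I \<Longrightarrow> bounded_borel (B i)" and i: "i \<in> I"
  shows "emeasure \<xi> (B i) = (\<Sum>j\<in>{j \<in> {..<card (Pow I)}. i \<in> atom_index I j}. emeasure \<xi> (atom I B j))"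
proof -
  let ?J = "{j \<in> {..<card (Pow I)}. i \<in> atom_index I j}"
  have "B i = (\<Union>j\<in>?J. atom I B j)"
  proof (intro equalityI subsetI)
    fix x assume x: "x \<in> B i"
    have "{i \<in> I. x \<in> B i} \<in> atom_index I ` {..<card (Pow I)}"
      using bij_betw_imp_surj_on[OF atom_index_bij[OF I]] by auto
    then obtain j where "j < card (Pow I)" "atom_index I j = {i \<in> I. x \<in> B i}" by auto
    then show "x \<in> (\<Union>j\<in>?J. atom I B j)" using x i mem_atom_iff[OF I, of j x B] by auto
  next
    fix x assume "x \<in> (\<Union>j\<in>?J. atom I B j)"
    then show "x \<in> B i" by (auto simp: mem_atom_iff[OF I])
  qed
  moreover have "disjoint_family_on (atom I B) ?J"
    by (rule disjoint_family_on_mono[OF _ disjoint_atoms[OF I]]) auto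
  moreover have "atom I B ` ?J \<subseteq> sets \<xi>"
    using bounded_borelD(1)[OF bounded_borel_atom[OF I B]] counting_radon_sets[OF \<xi>] by auto
  ultimately show ?thesis using sum_emeasure[of "atom I B" ?J \<xi>] by simp
qed

lemma atom_event_sets:
  assumes "finite I"
  shows "atom_event I n \<in> sets (\<Pi>\<^sub>M j\<in>{..<card (Pow I)}. borel)"
  unfolding atom_event_def
proof (intro sets.sets_Collect_finite_All assms)
  fix i assume "i \<in> I"
  let ?s = "\<lambda>v :: nat \<Rightarrow> ennreal. \<Sum>j\<in>{j \<in> {..<card (Pow I)}. i \<in> atom_index I j}. v j"
  have "?s \<in> borel_measurable (\<Pi>\<^sub>M j\<in>{..<card (Pow I)}. borel)"
    by (intro borel_measurable_sum measurable_component_singleton) auto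
  from measurable_sets[OF this, of "{of_nat (n i)}"]
  show "{v \<in> space (\<Pi>\<^sub>M j\<in>{..<card (Pow I)}. borel). ?s v = of_nat (n i)} \<in> sets (\<Pi>\<^sub>M j\<in>{..<card (Pow I)}. borel)"
    by (simp add: vimage_def Int_def conj_commute)
qed

text \<open>The \<open>B i\<close> may overlap, so their counts need not be independent. Counts of
  atoms are, hence their joint law is a product measure, and the counts of the \<open>B i\<close>
  are functions of them.\<close>

lemma poisson_count_prob_atoms:
  fixes N :: "'a \<Rightarrow> 'e::polish_space measure"
  assumes N: "poisson_pp_intensity M N \<nu>" and I: "finite I" and B: "\<And>i. i \<in> I \<Longrightarrow> bounded_borel (B i)"
  shows "count_prob M N I B n =
    measure (\<Pi>\<^sub>M j\<in>{..<card (Pow I)}. distr M borel (\<lambda>\<omega>. emeasure (N \<omega>) (atom I B j))) (atom_event I n)"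
proof -
  interpret prob_space M by (rule poisson_pp_intensityD(1)[OF N])
  note X = poisson_pp_intensityD(2)[OF N]
  note bD = bounded_borel_atom[OF I B]
  define k where "k = card (Pow I)"
  let ?V = "\<lambda>\<omega>. \<lambda>j\<in>{..<k}. emeasure (N \<omega>) (atom I B j)"
  \<comment> \<open>The product characterisation of independence needs a nonempty index set; the
    empty subset of \<open>I\<close> always provides one index.\<close>
  have k: "{..<k} \<noteq> {}" unfolding k_def using I by (simp add: card_Pow lessThan_empty_iff)
  have Dm: "(\<lambda>\<omega>. emeasure (N \<omega>) (atom I B j)) \<in> borel_measurable M" for j
    by (rule measurable_compose[OF X measurable_emeasure_config_space[OF bounded_borelD(1)[OF bD]]])
  have "indep_vars (\<lambda>_. borel) (\<lambda>j \<omega>. emeasure (N \<omega>) (atom I B j)) {..<k}"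
    using disjoint_atoms[OF I] unfolding k_def by (intro poisson_pp_intensityD(5)[OF N bD])
  then have eq: "distr M (\<Pi>\<^sub>M j\<in>{..<k}. borel) ?V = (\<Pi>\<^sub>M j\<in>{..<k}. distr M borel (\<lambda>\<omega>. emeasure (N \<omega>) (atom I B j)))"
    using indep_vars_iff_distr_eq_PiM'[OF k, where M' = "\<lambda>_. borel" and X = "\<lambda>j \<omega>. emeasure (N \<omega>) (atom I B j)"] Dm by simp
  have V: "?V \<in> measurable M (\<Pi>\<^sub>M j\<in>{..<k}. borel)"
    by (rule measurable_restrict) (rule Dm)
  have W: "atom_event I n \<in> sets (\<Pi>\<^sub>M j\<in>{..<k}. borel)" unfolding k_def by (rule atom_event_sets[OF I])
  have "N \<omega> \<in> count_event I B n \<longleftrightarrow> ?V \<omega> \<in> atom_event I n" if \<omega>: "\<omega> \<in> space M" for \<omega>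
  proof -
    have c: "counting_radon (N \<omega>)" using measurable_space[OF X \<omega>] by simp
    have "emeasure (N \<omega>) (B i) = (\<Sum>j | j < card (Pow I) \<and> i \<in> atom_index I j. emeasure (N \<omega>) (atom I B j))"
      if "i \<in> I" for i
      using emeasure_sum_atoms[OF c I B that] by simp
    then have "?V \<omega> \<in> atom_event I n \<longleftrightarrow> (\<forall>i\<in>I. emeasure (N \<omega>) (B i) = of_nat (n i))"
      using measurable_space[OF V \<omega>] unfolding atom_event_def k_def
      by simp
    then show ?thesis using c by (simp add: count_event_def)
  qed
  then have "{\<omega> \<in> space M. N \<omega> \<in> count_event I B n} = ?V -` atom_event I n \<inter> space M" by blast
  then have "count_prob M N I B n = measure (distr M (\<Pi>\<^sub>M j\<in>{..<k}. borel) ?V) (atom_event I n)"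
    by (simp only: measure_distr[OF V W] count_prob_def)
  then show ?thesis unfolding eq unfolding k_def .
qed

text \<open>Equal intensities give equal Poisson laws on every atom, and a product measure is
  determined by its factors.\<close>

theorem poisson_count_prob_eq:
  fixes N :: "'a \<Rightarrow> 'e::polish_space measure" and N' :: "'b \<Rightarrow> 'e measure"
  assumes N: "poisson_pp_intensity M N \<nu>" and N': "poisson_pp_intensity M' N' \<nu>'"
    and \<nu>: "\<And>B. bounded_borel B \<Longrightarrow> enn2real (emeasure \<nu> B) = enn2real (emeasure \<nu>' B)"
    and I: "finite I" and B: "\<And>i. i \<in> I \<Longrightarrow> bounded_borel (B i)"
  shows "count_prob M N I B n = count_prob M' N' I B n"
proof -
  note bD = bounded_borel_atom[OF I B]
  have "distr M borel (\<lambda>\<omega>. emeasure (N \<omega>) (atom I B j)) = distr M' borel (\<lambda>\<omega>. emeasure (N' \<omega>) (atom I B j))" for j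
  proof (rule distr_eq_of_nat_valued)
    show "prob_space M" "prob_space M'" by (rule poisson_pp_intensityD(1)[OF N], rule poisson_pp_intensityD(1)[OF N'])
    show "(\<lambda>\<omega>. emeasure (N \<omega>) (atom I B j)) \<in> borel_measurable M"
      by (rule measurable_compose[OF poisson_pp_intensityD(2)[OF N] measurable_emeasure_config_space[OF bounded_borelD(1)[OF bD]]])
    show "(\<lambda>\<omega>. emeasure (N' \<omega>) (atom I B j)) \<in> borel_measurable M'"
      by (rule measurable_compose[OF poisson_pp_intensityD(2)[OF N'] measurable_emeasure_config_space[OF bounded_borelD(1)[OF bD]]])
    show "emeasure (N \<omega>) (atom I B j) \<in> range of_nat" if "\<omega> \<in> space M" for \<omega>
    proof -
      have "counting_radon (N \<omega>)" using measurable_space[OF poisson_pp_intensityD(2)[OF N] that] by simp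
      then have "emeasure (N \<omega>) (atom I B j) = of_nat (num_points (N \<omega>) (atom I B j))"
        using bD by (rule emeasure_eq_num_points)
      then show ?thesis by (rule range_eqI)
    qed
    show "emeasure (N' \<omega>) (atom I B j) \<in> range of_nat" if "\<omega> \<in> space M'" for \<omega>
    proof -
      have "counting_radon (N' \<omega>)" using measurable_space[OF poisson_pp_intensityD(2)[OF N'] that] by simp
      then have "emeasure (N' \<omega>) (atom I B j) = of_nat (num_points (N' \<omega>) (atom I B j))"
        using bD by (rule emeasure_eq_num_points)
      then show ?thesis by (rule range_eqI)
    qed
    show "measure M {\<omega> \<in> space M. emeasure (N \<omega>) (atom I B j) = of_nat n}
        = measure M' {\<omega> \<in> space M'. emeasure (N' \<omega>) (atom I B j) = of_nat n}" for n
      by (simp only: poisson_pp_intensityD(4)[OF N bD] poisson_pp_intensityD(4)[OF N' bD] \<nu>[OF bD])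
  qed
  then show ?thesis by (simp only: poisson_count_prob_atoms[OF N I B] poisson_count_prob_atoms[OF N' I B])
qed

section \<open>Generating functions of determinantal and superposed processes\<close>

text \<open>The right-hand cutoff in the determinantal formula is the essential support and not
  \<open>B\<close>. It lies in the closure of \<open>B\<close>, so local trace class applies to it
  too.\<close>

lemma bounded_borel_ess_supp:
  fixes B :: "'e::t2_space set"
  assumes B: "bounded_borel B"
  shows "bounded_borel (ess_supp \<mu> (indicator B))"
proof (rule bounded_borel_subset)
  show "bounded_borel (closure B)" using B by (simp add: bounded_borel_def rel_compact_def)
  show "ess_supp \<mu> (indicator B) \<subseteq> closure B"
    unfolding ess_supp_def
  proof (rule Inter_lower, intro CollectI conjI)
    show "AE x in \<mu>. x \<notin> closure B \<longrightarrow> (indicator B x :: complex) = 0"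
      using closure_subset[of B] by (intro AE_I2) (auto simp: indicator_def)
  qed simp
  show "ess_supp \<mu> (indicator B) \<in> sets borel"
    unfolding ess_supp_def by (intro borel_closed closed_Inter) auto
qed

lemma bdd_compact_fun_indicator:
  assumes "bounded_borel B"
  shows "bdd_compact_fun (\<lambda>x. c * indicator B x)"
  unfolding bdd_compact_fun_def
proof (intro conjI)
  show "(\<lambda>x. c * indicator B x) \<in> borel_measurable borel"
    using bounded_borelD(1)[OF assms] by simp
  show "bounded (range (\<lambda>x. c * indicator B x :: complex))"
    by (rule boundedI[of _ "cmod c"]) (auto simp: indicator_def)
  have "compact (closure {x. c * indicator B x \<noteq> (0::complex)})" if "c = 0" using that by simp
  moreover have "{x. c * indicator B x \<noteq> (0::complex)} = B" if "c \<noteq> 0" using that by (auto simp: indicator_def)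
  ultimately show "compact (closure {x. c * indicator B x \<noteq> (0::complex)})"
    using bounded_borelD(2)[OF assms] by (cases "c = 0") (auto simp: rel_compact_def)
qed

text \<open>The test function is s - 1 times the indicator of \<open>B\<close>. The operator then
  depends on \<open>s\<close> only through the scalar s - 1, so a single trace class operator
  \<open>A\<close> yields the whole function \<open>D\<close>.\<close>

theorem determinantal_generating_function:
  fixes DP :: "'a \<Rightarrow> 'e::polish_space measure"
  assumes DP: "determinantal_pp \<mu> M DP K" and B: "bounded_borel B"
  obtains D :: "complex \<Rightarrow> complex" and a T where
    "\<And>z. (\<lambda>n. a n * z ^ n) sums D z" "0 \<le> T"
    "\<And>\<epsilon>. 0 < \<epsilon> \<Longrightarrow> \<exists>m. \<forall>x\<ge>0. cmod (D (of_real x)) \<le> (1 + x * T) ^ m * exp (\<epsilon> * x)"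
    "\<And>s. cmod s < 1 \<Longrightarrow>
      (\<lambda>n. of_real (measure M {\<omega> \<in> space M. emeasure (DP \<omega>) B = of_nat n}) * s ^ n) sums D (s - 1)"
proof -
  have X: "DP \<in> measurable M config_space" and M: "prob_space M"
    using DP by (simp_all add: determinantal_pp_def point_process_def)
  interpret prob_space M by (rule M)
  define S where "S = ess_supp \<mu> (indicator B :: 'e \<Rightarrow> complex)"
  have S: "bounded_borel S" unfolding S_def by (rule bounded_borel_ess_supp[OF B])
  define A where "A = mult_op (indicator B) \<circ> K \<circ> mult_op (indicator S)"
  have A: "trace_class \<mu> A"
    using DP B S unfolding determinantal_pp_def locally_trace_class_def A_def bounded_borel_def by blast
  obtain a T where D: "\<And>z. (\<lambda>n. a n * z ^ n) sums fredholm_det1 \<mu> (\<lambda>f x. z * A f x)" "0 \<le> T"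
    "\<And>\<epsilon>. 0 < \<epsilon> \<Longrightarrow> \<exists>m. \<forall>x\<ge>0. cmod (fredholm_det1 \<mu> (\<lambda>f y. of_real x * A f y)) \<le> (1 + x * T) ^ m * exp (\<epsilon> * x)"
    by (rule fredholm_det1_entire[OF A]) blast
  have "(\<lambda>n. of_real (prob {\<omega> \<in> space M. emeasure (DP \<omega>) B = of_nat n}) * s ^ n) sums
      fredholm_det1 \<mu> (\<lambda>f x. (s - 1) * A f x)" if s: "norm s < 1" for s :: complex
  proof -
    let ?\<phi> = "\<lambda>x. (s - 1) * indicator B x :: complex"
    have s1: "s \<noteq> 1" using s by auto
    have c: "counting_radon (DP \<omega>)" if "\<omega> \<in> space M" for \<omega> using measurable_space[OF X that] by simp
    have num: "emeasure (DP \<omega>) B = of_nat n \<longleftrightarrow> num_points (DP \<omega>) B = n" if "\<omega> \<in> space M" for \<omega> n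
      by (simp add: emeasure_eq_num_points[OF c[OF that] B])
    have ev: "{\<omega> \<in> space M. num_points (DP \<omega>) B = n} = {\<omega> \<in> space M. emeasure (DP \<omega>) B = of_nat n}" for n
      using num by auto
    have "{\<omega> \<in> space M. emeasure (DP \<omega>) B = of_nat n} \<in> events" for n
      using measurable_sets[OF measurable_compose[OF X measurable_emeasure_config_space[OF bounded_borelD(1)[OF B]]], of "{of_nat n}"]
      by (simp add: vimage_def Int_def conj_commute)
    then have "(\<lambda>n. of_real (prob {\<omega> \<in> space M. emeasure (DP \<omega>) B = of_nat n}) * s ^ n) sums
        (\<integral>\<omega>. s ^ num_points (DP \<omega>) B \<partial>M)"
      using expectation_power_sums[of "\<lambda>\<omega>. num_points (DP \<omega>) B" s] s unfolding ev by simp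
    also have "(\<integral>\<omega>. s ^ num_points (DP \<omega>) B \<partial>M) = pgfl M DP ?\<phi>"
      unfolding pgfl_def
      by (rule Bochner_Integration.integral_cong[OF refl]) (simp add: config_prod_indicator[OF c B s1])
    also have "\<dots> = fredholm_det1 \<mu> (mult_op ?\<phi> \<circ> K \<circ> mult_op (indicator (ess_supp \<mu> ?\<phi>)))"
      using DP bdd_compact_fun_indicator[OF B, of "s - 1"] unfolding determinantal_pp_def by blast
    \<comment> \<open>A nonzero scalar does not change the essential support, so the right cutoff is
      the same for all \<open>s\<close> different from 1.\<close>
    also have "ess_supp \<mu> ?\<phi> = S" using s1 by (simp add: ess_supp_def S_def)
    also have "mult_op ?\<phi> \<circ> K \<circ> mult_op (indicator S) = (\<lambda>f x. (s - 1) * A f x)"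
      by (simp add: A_def mult_op_def fun_eq_iff mult.assoc)
    finally show ?thesis .
  qed
  then show thesis using D by (intro that[of a "\<lambda>z. fredholm_det1 \<mu> (\<lambda>f x. z * A f x)" T]) simp_all
qed

lemma poisson_generating_function:
  "(\<lambda>n. of_real (exp (- r) * r ^ n / fact n) * s ^ n) sums exp (of_real r * (s - 1 :: complex))"
proof -
  have "(\<lambda>n. exp (of_real (- r)) * ((of_real r * s) ^ n /\<^sub>R fact n)) sums (exp (of_real (- r)) * exp (of_real r * s))"
    by (intro sums_mult exp_converges)
  moreover have "exp (of_real (- r)) * ((of_real r * s) ^ n /\<^sub>R fact n) = of_real (exp (- r) * r ^ n / fact n) * s ^ n" for n
    by (simp add: exp_of_real[symmetric] power_mult_distrib scaleR_conv_of_real divide_inverse mult_ac)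
  moreover have "exp (of_real (- r)) * exp (of_real r * s) = exp (of_real r * (s - 1))"
    by (simp add: exp_add[symmetric] algebra_simps)
  ultimately show ?thesis by simp
qed

lemma count_prob_singleton:
  fixes X :: "'a \<Rightarrow> 'e::topological_space measure"
  assumes X: "X \<in> measurable M config_space"
  shows "count_prob M X {()} (\<lambda>_. B) n = measure M {\<omega> \<in> space M. emeasure (X \<omega>) B = of_nat (n ())}"
proof -
  have "{\<omega> \<in> space M. X \<omega> \<in> count_event {()} (\<lambda>_. B) n} = {\<omega> \<in> space M. emeasure (X \<omega>) B = of_nat (n ())}"
    using measurable_space[OF X] by (auto simp: count_event_def)
  then show ?thesis by (simp add: count_prob_def)
qed

text \<open>Independence makes the counts of the sum a convolution, that is, a Cauchy product; both
  series converge absolutely for |s| < 1 by comparison with the geometric series.\<close>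

theorem superposition_generating_function:
  fixes N DP :: "'a \<Rightarrow> 'e::polish_space measure" and s d :: complex
  assumes N: "poisson_pp_intensity M N \<nu>" and DP: "DP \<in> measurable M config_space"
    and indep: "prob_space.indep_var M config_space N config_space DP" and B: "bounded_borel B"
    and D: "(\<lambda>n. of_real (measure M {\<omega> \<in> space M. emeasure (DP \<omega>) B = of_nat n}) * s ^ n) sums d"
    and s: "cmod s < 1"
  shows "(\<lambda>n. of_real (count_prob M (\<lambda>\<omega>. config_add (N \<omega>) (DP \<omega>)) {()} (\<lambda>_. B) (\<lambda>_. n)) * s ^ n) sums
    (exp (of_real (enn2real (emeasure \<nu> B)) * (s - 1)) * d)"
proof -
  note M = poisson_pp_intensityD(1)[OF N] and X = poisson_pp_intensityD(2)[OF N]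
  interpret prob_space M by (rule M)
  define p where "p n = measure M {\<omega> \<in> space M. emeasure (N \<omega>) B = of_nat n}" for n :: nat
  define q where "q n = measure M {\<omega> \<in> space M. emeasure (DP \<omega>) B = of_nat n}" for n :: nat
  have conv: "count_prob M (\<lambda>\<omega>. config_add (N \<omega>) (DP \<omega>)) {()} (\<lambda>_. B) (\<lambda>_. n) = (\<Sum>i\<le>n. p i * q (n - i))" for n
  proof -
    have "count_prob M (\<lambda>\<omega>. config_add (N \<omega>) (DP \<omega>)) {()} (\<lambda>_. B) (\<lambda>_. n) =
      (\<Sum>m\<in>(\<Pi>\<^sub>E i\<in>{()}. {..n}). count_prob M N {()} (\<lambda>_. B) m * count_prob M DP {()} (\<lambda>_. B) (\<lambda>i. n - m i))"
      using B by (intro count_prob_config_add[OF M indep X DP]) auto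
    also have "\<dots> = (\<Sum>m\<in>(\<Pi>\<^sub>E i\<in>{()}. {..n}). p (m ()) * q (n - m ()))"
      by (simp only: count_prob_singleton[OF X] count_prob_singleton[OF DP] p_def q_def)
    also have "\<dots> = (\<Sum>i\<le>n. p i * q (n - i))"
      by (rule sum.reindex_bij_witness[where i = "\<lambda>i _. i" and j = "\<lambda>m. m ()"]) (auto simp: PiE_def extensional_def)
    finally show ?thesis .
  qed
  have geometric: "summable (\<lambda>n. cmod (of_real (f n) * s ^ n))" if "\<And>n. 0 \<le> f n \<and> f n \<le> 1" for f :: "nat \<Rightarrow> real"
  proof (rule summable_comparison_test')
    show "summable (\<lambda>n. norm s ^ n)" using s by (intro summable_geometric) simp
    show "norm (cmod (of_real (f n) * s ^ n)) \<le> norm s ^ n" if "0 \<le> n" for n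
      using \<open>\<And>n. 0 \<le> f n \<and> f n \<le> 1\<close>[of n]
      by (simp add: norm_mult norm_power mult_left_le_one_le)
  qed
  have P: "(\<lambda>n. of_real (p n) * s ^ n) sums exp (of_real (enn2real (emeasure \<nu> B)) * (s - 1))"
    unfolding p_def poisson_pp_intensityD(4)[OF N B] by (rule poisson_generating_function)
  have "(\<lambda>n. \<Sum>i\<le>n. (of_real (p i) * s ^ i) * (of_real (q (n - i)) * s ^ (n - i))) sums
      ((\<Sum>n. of_real (p n) * s ^ n) * (\<Sum>n. of_real (q n) * s ^ n))"
    by (intro Cauchy_product_sums geometric) (auto simp: p_def q_def)
  moreover have "(\<Sum>i\<le>n. (of_real (p i) * s ^ i) * (of_real (q (n - i)) * s ^ (n - i)))
      = of_real (\<Sum>i\<le>n. p i * q (n - i)) * s ^ n" for n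
  proof -
    have "(of_real (p i) * s ^ i) * (of_real (q (n - i)) * s ^ (n - i)) = of_real (p i * q (n - i)) * s ^ n" if "i \<le> n" for i
    proof -
      have "s ^ i * s ^ (n - i) = s ^ n" using that by (simp flip: power_add)
      moreover have "(of_real (p i) * s ^ i) * (of_real (q (n - i)) * s ^ (n - i)) = of_real (p i * q (n - i)) * (s ^ i * s ^ (n - i))"
        by simp
      ultimately show ?thesis by (simp only:)
    qed
    then show ?thesis unfolding of_real_sum sum_distrib_right by (intro sum.cong refl) simp
  qed
  ultimately show ?thesis
    unfolding conv using P D by (simp add: sums_unique[symmetric] q_def[symmetric])
qed

lemma intensity_le:
  fixes N DP :: "'a \<Rightarrow> 'e::polish_space measure" and N' DP' :: "'b \<Rightarrow> 'e measure"
  assumes N: "poisson_pp_intensity M N \<nu>" and DP: "determinantal_pp \<mu> M DP K"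
    and indep: "prob_space.indep_var M config_space N config_space DP"
    and N': "poisson_pp_intensity M' N' \<nu>'" and DP': "determinantal_pp \<mu> M' DP' K'"
    and indep': "prob_space.indep_var M' config_space N' config_space DP'"
    and eq: "\<And>n. count_prob M (\<lambda>\<omega>. config_add (N \<omega>) (DP \<omega>)) {()} (\<lambda>_. B) n =
      count_prob M' (\<lambda>\<omega>. config_add (N' \<omega>) (DP' \<omega>)) {()} (\<lambda>_. B) n"
    and B: "bounded_borel B"
  shows "enn2real (emeasure \<nu> B) \<le> enn2real (emeasure \<nu>' B)"
proof -
  interpret prob_space M by (rule poisson_pp_intensityD(1)[OF N])
  have X: "DP \<in> measurable M config_space" "DP' \<in> measurable M' config_space"
    using DP DP' by (simp_all add: determinantal_pp_def point_process_def)
  obtain D a T where D: "\<And>z. (\<lambda>n. a n * z ^ n) sums D z" and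
    q: "\<And>s. cmod s < 1 \<Longrightarrow> (\<lambda>n. of_real (measure M {\<omega> \<in> space M. emeasure (DP \<omega>) B = of_nat n}) * s ^ n) sums D (s - 1)"
    by (rule determinantal_generating_function[OF DP B]) blast
  obtain D' a' T' where D': "\<And>z. (\<lambda>n. a' n * z ^ n) sums D' z" and T': "0 \<le> T'" and
    growth: "\<And>\<epsilon>. 0 < \<epsilon> \<Longrightarrow> \<exists>m. \<forall>x\<ge>0. cmod (D' (of_real x)) \<le> (1 + x * T') ^ m * exp (\<epsilon> * x)" and
    q': "\<And>s. cmod s < 1 \<Longrightarrow> (\<lambda>n. of_real (measure M' {\<omega> \<in> space M'. emeasure (DP' \<omega>) B = of_nat n}) * s ^ n) sums D' (s - 1)"
    by (rule determinantal_generating_function[OF DP' B]) blast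
  show ?thesis
  proof (rule exponential_rate_le)
    show "(\<lambda>n. a n * z ^ n) sums D z" for z by (rule D)
    show "(\<lambda>n. a' n * z ^ n) sums D' z" for z by (rule D')
    show "(\<lambda>n. of_real (prob {\<omega> \<in> space M. emeasure (DP \<omega>) B = of_nat n}) * s ^ n) sums D (s - 1)"
      if "cmod s < 1" for s using that by (rule q)
    show "\<exists>m. \<forall>x\<ge>0. cmod (D' (of_real x)) \<le> (1 + x * T') ^ m * exp (\<epsilon> * x)" if "0 < \<epsilon>" for \<epsilon>
      using that by (rule growth)
    show "0 \<le> T'" by (rule T')
    have c: "counting_radon (DP \<omega>)" if "\<omega> \<in> space M" for \<omega> using measurable_space[OF X(1) that] by simp
    have ev: "{\<omega> \<in> space M. num_points (DP \<omega>) B = n} = {\<omega> \<in> space M. emeasure (DP \<omega>) B = of_nat n}" for n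
    proof -
      have "emeasure (DP \<omega>) B = of_nat n \<longleftrightarrow> num_points (DP \<omega>) B = n" if "\<omega> \<in> space M" for \<omega>
        by (simp add: emeasure_eq_num_points[OF c[OF that] B])
      then show ?thesis by blast
    qed
    have "{\<omega> \<in> space M. emeasure (DP \<omega>) B = of_nat n} \<in> events" for n
      using measurable_sets[OF measurable_compose[OF X(1) measurable_emeasure_config_space[OF bounded_borelD(1)[OF B]]], of "{of_nat n}"]
      by (simp add: vimage_def Int_def conj_commute)
    then show "(\<lambda>n. prob {\<omega> \<in> space M. emeasure (DP \<omega>) B = of_nat n}) sums 1"
      using prob_nat_sums[of "\<lambda>\<omega>. num_points (DP \<omega>) B"] unfolding ev by simp
    fix s :: complex assume s: "norm s < 1"
    show "exp (of_real (enn2real (emeasure \<nu> B)) * (s - 1)) * D (s - 1)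
        = exp (of_real (enn2real (emeasure \<nu>' B)) * (s - 1)) * D' (s - 1)"
      using superposition_generating_function[OF N X(1) indep B q[OF s] s]
        superposition_generating_function[OF N' X(2) indep' B q'[OF s] s]
      \<comment> \<open>After rewriting with the equal count probabilities, both products are sums
        of one and the same series.\<close>
      unfolding eq by (rule sums_unique2)
  qed simp
qed

theorem theorem1p1:
  fixes \<mu> :: "'e::polish_space measure"
    and M :: "'a measure" and M' :: "'b measure"
    and N DP :: "'a \<Rightarrow> 'e measure" and N' DP' :: "'b \<Rightarrow> 'e measure"
    and K K' :: "'e op"
  assumes "locally_compact_space (euclidean :: 'e topology)"
    and "radon_measure \<mu>"
    and "prob_space M" and "prob_space M'"
    and "poisson_pp M N" and "determinantal_pp \<mu> M DP K"
    and "prob_space.indep_var M config_space N config_space DP"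
    and "poisson_pp M' N'" and "determinantal_pp \<mu> M' DP' K'"
    and "prob_space.indep_var M' config_space N' config_space DP'"
    and "distr M config_space (\<lambda>\<omega>. config_add (N \<omega>) (DP \<omega>)) =
         distr M' config_space (\<lambda>\<omega>. config_add (N' \<omega>) (DP' \<omega>))"
  shows "distr M config_space N = distr M' config_space N' \<and>
         distr M config_space DP = distr M' config_space DP'"
proof -
  note lc = assms(1) and M = assms(3) and M' = assms(4) and DP = assms(6) and indep = assms(7)
    and DP' = assms(9) and indep' = assms(10)
  obtain \<nu> where N: "poisson_pp_intensity M N \<nu>" using assms(5) by (auto simp: poisson_pp_def)
  obtain \<nu>' where N': "poisson_pp_intensity M' N' \<nu>'" using assms(8) by (auto simp: poisson_pp_def)
  note XN = poisson_pp_intensityD(2)[OF N] and XN' = poisson_pp_intensityD(2)[OF N']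
  have XD: "DP \<in> measurable M config_space" and XD': "DP' \<in> measurable M' config_space"
    using DP DP' by (simp_all add: determinantal_pp_def point_process_def)
  \<comment> \<open>The index type stays polymorphic: the unit type is used for comparing
    intensities on one set, an arbitrary type for joint counts.\<close>
  have sum_eq: "count_prob M (\<lambda>\<omega>. config_add (N \<omega>) (DP \<omega>)) I B n = count_prob M' (\<lambda>\<omega>. config_add (N' \<omega>) (DP' \<omega>)) I B n"
    if I: "finite I" and B: "\<And>i. i \<in> I \<Longrightarrow> bounded_borel (B i)" for I :: "'i set" and B n
  proof -
    have ev: "count_event I B n \<in> sets config_space" using I B by (intro count_event_sets) auto
    have "count_prob M (\<lambda>\<omega>. config_add (N \<omega>) (DP \<omega>)) I B n = measure (distr M config_space (\<lambda>\<omega>. config_add (N \<omega>) (DP \<omega>))) (count_event I B n)"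
      unfolding measure_distr[OF config_add_measurable[OF XN XD] ev] count_prob_def
      by (simp add: vimage_def Int_def conj_commute)
    also have "\<dots> = count_prob M' (\<lambda>\<omega>. config_add (N' \<omega>) (DP' \<omega>)) I B n"
      unfolding assms(11) measure_distr[OF config_add_measurable[OF XN' XD'] ev] count_prob_def
      by (simp add: vimage_def Int_def conj_commute)
    finally show ?thesis .
  qed
  have \<nu>: "enn2real (emeasure \<nu> B) = enn2real (emeasure \<nu>' B)" if B: "bounded_borel B" for B
  proof (rule antisym)
    show "enn2real (emeasure \<nu> B) \<le> enn2real (emeasure \<nu>' B)"
      by (rule intensity_le[OF N DP indep N' DP' indep' sum_eq B]) (use B in auto)
    show "enn2real (emeasure \<nu>' B) \<le> enn2real (emeasure \<nu> B)"
      by (rule intensity_le[OF N' DP' indep' N DP indep sum_eq[symmetric] B]) (use B in auto)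
  qed
  have N_eq: "count_prob M N I B n = count_prob M' N' I B n"
    if "finite I" "\<And>i. i \<in> I \<Longrightarrow> bounded_borel (B i)" for I :: "'i set" and B n
    using poisson_count_prob_eq[OF N N' \<nu> that] .
  have DP_eq: "count_prob M DP I B n = count_prob M' DP' I B n"
    if I: "finite I" and B: "\<And>i. i \<in> I \<Longrightarrow> bounded_borel (B i)" for I :: "'i set" and B n
  \<comment> \<open>By \<open>N_eq\<close> the Poisson factors of the two convolutions coincide, so
    a single \<open>p\<close> serves both sides.\<close>
  proof (rule deconvolution_unique[of I "count_prob M N I B"])
    show "finite I" by (rule I)
    show "count_prob M N I B (\<lambda>i\<in>I. 0) \<noteq> 0" using poisson_count_prob_zero[where B = B, OF N I B] by simp
    show "(\<Sum>m\<in>(\<Pi>\<^sub>E i\<in>I. {..n i}). count_prob M N I B m * count_prob M DP I B (\<lambda>i. n i - m i)) =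
      (\<Sum>m\<in>(\<Pi>\<^sub>E i\<in>I. {..n i}). count_prob M N I B m * count_prob M' DP' I B (\<lambda>i. n i - m i))" for n
    proof -
      have conv: "count_prob M (\<lambda>\<omega>. config_add (N \<omega>) (DP \<omega>)) I B n =
          (\<Sum>m\<in>(\<Pi>\<^sub>E i\<in>I. {..n i}). count_prob M N I B m * count_prob M DP I B (\<lambda>i. n i - m i))"
        by (rule count_prob_config_add[OF M indep XN XD I]) (rule B)
      have conv': "count_prob M' (\<lambda>\<omega>. config_add (N' \<omega>) (DP' \<omega>)) I B n =
          (\<Sum>m\<in>(\<Pi>\<^sub>E i\<in>I. {..n i}). count_prob M' N' I B m * count_prob M' DP' I B (\<lambda>i. n i - m i))"
        by (rule count_prob_config_add[OF M' indep' XN' XD' I]) (rule B)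
      have N_eq: "count_prob M N I B m = count_prob M' N' I B m" for m by (rule N_eq[OF I]) (rule B)
      have "count_prob M (\<lambda>\<omega>. config_add (N \<omega>) (DP \<omega>)) I B n = count_prob M' (\<lambda>\<omega>. config_add (N' \<omega>) (DP' \<omega>)) I B n"
        by (rule sum_eq[OF I]) (rule B)
      then show ?thesis by (simp only: conv conv' N_eq)
    qed
  qed (auto simp: count_prob_def count_event_def)
  show ?thesis
  proof (intro conjI config_law_eqI[OF lc M M'])
    show "N \<in> measurable M config_space" "N' \<in> measurable M' config_space" by (rule XN, rule XN')
    show "DP \<in> measurable M config_space" "DP' \<in> measurable M' config_space" by (rule XD, rule XD')
    fix F :: "('e set \<times> nat) set" assume F: "finite F" "\<And>x. x \<in> F \<Longrightarrow> bounded_borel (fst x)"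
    show "measure M {\<omega> \<in> space M. N \<omega> \<in> count_event F fst snd} = measure M' {\<omega> \<in> space M'. N' \<omega> \<in> count_event F fst snd}"
      unfolding count_prob_def[symmetric] by (rule N_eq) (use F in auto)
    show "measure M {\<omega> \<in> space M. DP \<omega> \<in> count_event F fst snd} = measure M' {\<omega> \<in> space M'. DP' \<omega> \<in> count_event F fst snd}"
      unfolding count_prob_def[symmetric] by (rule DP_eq) (use F in auto)
  qed
qed

end
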